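(* Let $n\ge1$, let $\bm{P}_1\in\mathbb{C}^{n\times n}$ be Hermitian and invertible, $\bm{R}\in\mathbb{C}^{n\times n}$ (Hermitian) positive semi-definite, and $\bm{H}\in\mathbb{C}^{n\times n}$ (Hermitian) positive definite. Let $\mathcal{H}=\mathbb{C}^n$ with inner product $\langle v,w\rangle_{\mathcal{H}}=v^*\bm{H}w$, and assume that $\bm{C}=(\bm{R}-i\bm{P}_1)\bm{H}$ is hypocoercive on $\mathcal{H}$ with hypocoercivity index $m_{\mathrm{HC}}$. Let $\mathcal{V}=L^2([0,2\pi];\mathbb{C}^n)$ with inner product $\langle x,y\rangle=\int_0^{2\pi}x(\zeta)^*\bm{H}y(\zeta)\,\mathrm{d}\zeta$, and let $\bm{A}$ be the operator on $\mathcal{V}$ $$\bm{A}x=\Big(\bm{P}_1\frac{\partial}{\partial\zeta}-\bm{R}\Big)\bm{H}x,\qquad D(\bm{A})=\{x\in H^1([0,2\pi];\mathbb{C}^n)\mid x(0)=x(2\pi)\},$$ which generates a strongly continuous semigroup $(\bm{T}(t))_{t\ge0}$ on $\mathcal{V}$. Let $$\mathcal{V}_\infty=\{x\in L^2([0,2\pi];\mathbb{C}^n)\mid x\text{ is constant and }x(\zeta)\in\ker\bm{R}\bm{H}\text{ almost everywhere}\}$$ and let $\bm{Q}_\infty$ be the orthogonal projection in $\mathcal{V}$ onto $\mathcal{V}_\infty$. For $m\in\mathbb{Z}$ set $\bm{C}_m=m\,\bm{C}_{\mathrm{S}}+\bm{C}_{\mathrm{H}}$ with $\bm{C}_{\mathrm{S}}=-i\bm{P}_1\bm{H}$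 and $\bm{C}_{\mathrm{H}}=\bm{R}\bm{H}$, and let $\bm{C}_m^*$ be the adjoint of $\bm{C}_m$ with respect to $\langle\cdot,\cdot\rangle_{\mathcal{H}}$. Let $\varphi_m(\zeta)=\mathrm{e}^{im\zeta}$. Then the following holds. (a) There are constants $\tau,c_1,c_2>0$ such that, with $a=2m_{\mathrm{HC}}+1$, $$1-c_1t^a\le\|\bm{T}(t)-\bm{Q}_\infty\|^2\le1-c_2t^a,\qquad 0\le t\le\tau.$$ (b) The subspaces $\mathcal{V}_\infty,\mathcal{V}_\infty^\perp\subset\mathcal{V}$ are invariant for $(\bm{T}(t))_{t\ge0}$ and there are constants $C,\omega>0$ such that $$\|\bm{T}(t)-\bm{Q}_\infty\|\le C\,\mathrm{e}^{-\omega t},\qquad t\ge0.$$ (c) The operator $\bm{P}$ on $\mathcal{V}$ defined, for $x=\sum_{m=-\infty}^\infty z_m\varphi_m$ with $z_m\in\mathbb{C}^n$, by $$\bm{P}x=\sum_{m\in\mathbb{Z}\setminus\{0\}}\sum_{j=0}^{m_{\mathrm{HC}}}\frac{1}{m^{2j}}(\bm{C}_m^* )^j\bm{C}_m^j\,z_m\,\varphi_m+z_0\,\varphi_0$$ is bounded and self-adjoint, satisfies $\bm{P}\ge\bm{1}_{\mathcal{V}}$, and there is $\sigma>0$ such that $$\langle\bm{A}x,\bm{P}x\rangle+\langle\bm{P}x,\bm{A}x\rangle\le-\sigma\|x\|^2,\qquad x\in D(\bm{A})\cap\mathcal{V}_\infty^\perp.$$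
   Context: For a Hilbert space $\mathcal{H}$ and bounded $\bm{C}$ on $\mathcal{H}$, the skew-Hermitian part is $\bm{C}_{\mathrm{S}}=\frac{\bm{C}-\bm{C}^*}{2}$ and the Hermitian part is $\bm{C}_{\mathrm{H}}=\frac{\bm{C}+\bm{C}^*}{2}$, with adjoints taken in $\mathcal{H}$ (here: with respect to $\langle v,w\rangle_{\mathcal{H}}=v^*\bm{H}w$; for $\bm{C}=(\bm{R}-i\bm{P}_1)\bm{H}$ these are $\bm{C}_{\mathrm{S}}=-i\bm{P}_1\bm{H}$ and $\bm{C}_{\mathrm{H}}=\bm{R}\bm{H}$). For bounded self-adjoint operators, $\bm{B}_1\ge\bm{B}_2$ means $\langle\bm{B}_1x,x\rangle\ge\langle\bm{B}_2x,x\rangle$ for all $x$; $\bm{1}$ denotes the identity. $\bm{C}$ is accretive if $\bm{C}_{\mathrm{H}}\ge0$. An accretive bounded operator $\bm{C}$ on $\mathcal{H}$ is called hypocoercive if there is an integer $m\ge0$ and $\kappa>0$ such that $\sum_{j=0}^m\bm{C}^j\bm{C}_{\mathrm{H}}(\bm{C}^* )^j\ge\kappa\,\bm{1}_{\mathcal{H}}$. The smallest such $m$ is the hypocoercivity index $m_{\mathrm{HC}}$ of $\bm{C}$. It is known that the condition may be replaced by $\sum_{j=0}^m(\bm{C}_{\mathrm{S}}^* )^j\bm{C}_{\mathrm{H}}\bm{C}_{\mathrm{S}}^j\ge\tilde\kappa\,\bm{1}_{\mathcal{H}}$ for some $\tilde\kappa>0$, yielding the same index. Every $x\in\mathcal{V}$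 has a Fourier expansion $x=\sum_{m\in\mathbb{Z}}z_m\varphi_m$ with $z_m\in\mathbb{C}^n$. Operator norms, orthogonality and self-adjointness on $\mathcal{V}$ are with respect to the inner product $\langle x,y\rangle=\int_0^{2\pi}x(\zeta)^*\bm{H}y(\zeta)\,\mathrm{d}\zeta$. *)

theory Defs
  imports "HOL-Analysis.Analysis"
begin

section \<open>Operators with respect to an inner product\<close>

text \<open>
  The inner products in question depend on a matrix parameter, so they cannot be type class
  operations. The notions below take the inner product \<open>ip\<close> (conjugate linear in the first
  argument) and, where needed, the complex scalar multiplication \<open>s\<close> as arguments.
\<close>

definition ip_norm :: "('v \<Rightarrow> 'v \<Rightarrow> complex) \<Rightarrow> 'v \<Rightarrow> real" where
  "ip_norm ip x = sqrt (Re (ip x x))"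

definition bounded_operator ::
    "(complex \<Rightarrow> 'v \<Rightarrow> 'v) \<Rightarrow> ('v \<Rightarrow> 'v \<Rightarrow> complex) \<Rightarrow> ('v::real_vector \<Rightarrow> 'v) \<Rightarrow> bool" where
  "bounded_operator s ip B \<longleftrightarrow>
     Vector_Spaces.linear s s B \<and> (\<exists>K. \<forall>x. ip_norm ip (B x) \<le> K * ip_norm ip x)"

text \<open>Same convention as \<^const>\<open>onorm\<close>; meaningful for bounded operators only.\<close>

definition op_norm :: "('v \<Rightarrow> 'v \<Rightarrow> complex) \<Rightarrow> ('v \<Rightarrow> 'v) \<Rightarrow> real" where
  "op_norm ip B = (SUP x. ip_norm ip (B x) / ip_norm ip x)"

definition adjoint_wrt :: "('v \<Rightarrow> 'v \<Rightarrow> complex) \<Rightarrow> ('v \<Rightarrow> 'v) \<Rightarrow> 'v \<Rightarrow> 'v" where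
  "adjoint_wrt ip B = (THE B'. \<forall>x y. ip (B x) y = ip x (B' y))"

definition self_adjoint_wrt :: "('v \<Rightarrow> 'v \<Rightarrow> complex) \<Rightarrow> ('v \<Rightarrow> 'v) \<Rightarrow> bool" where
  "self_adjoint_wrt ip B \<longleftrightarrow> (\<forall>x y. ip (B x) y = ip x (B y))"

text \<open>Used for self-adjoint operators, whose quadratic forms are real.\<close>

definition op_ge :: "('v \<Rightarrow> 'v \<Rightarrow> complex) \<Rightarrow> ('v \<Rightarrow> 'v) \<Rightarrow> ('v \<Rightarrow> 'v) \<Rightarrow> bool" where
  "op_ge ip B1 B2 \<longleftrightarrow> (\<forall>x. Re (ip (B1 x) x) \<ge> Re (ip (B2 x) x))"

definition hermitian_part ::
    "('v \<Rightarrow> 'v \<Rightarrow> complex) \<Rightarrow> ('v::real_vector \<Rightarrow> 'v) \<Rightarrow> 'v \<Rightarrow> 'v" where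
  "hermitian_part ip B x = (1 / 2) *\<^sub>R (B x + adjoint_wrt ip B x)"

definition accretive :: "('v \<Rightarrow> 'v \<Rightarrow> complex) \<Rightarrow> ('v::real_vector \<Rightarrow> 'v) \<Rightarrow> bool" where
  "accretive ip B \<longleftrightarrow> op_ge ip (hermitian_part ip B) (\<lambda>x. 0)"

definition hypocoercive_with ::
    "('v \<Rightarrow> 'v \<Rightarrow> complex) \<Rightarrow> ('v::real_vector \<Rightarrow> 'v) \<Rightarrow> nat \<Rightarrow> bool" where
  "hypocoercive_with ip B m \<longleftrightarrow>
     (\<exists>\<kappa>>0. op_ge ip
        (\<lambda>x. \<Sum>j\<le>m. (B ^^ j) (hermitian_part ip B ((adjoint_wrt ip B ^^ j) x)))
        (\<lambda>x. \<kappa> *\<^sub>R x))"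

definition hypocoercive ::
    "(complex \<Rightarrow> 'v \<Rightarrow> 'v) \<Rightarrow> ('v \<Rightarrow> 'v \<Rightarrow> complex) \<Rightarrow> ('v::real_vector \<Rightarrow> 'v) \<Rightarrow> bool" where
  "hypocoercive s ip B \<longleftrightarrow>
     bounded_operator s ip B \<and> accretive ip B \<and> (\<exists>m. hypocoercive_with ip B m)"

definition hypocoercivity_index ::
    "('v \<Rightarrow> 'v \<Rightarrow> complex) \<Rightarrow> ('v::real_vector \<Rightarrow> 'v) \<Rightarrow> nat" where
  "hypocoercivity_index ip B = (LEAST m. hypocoercive_with ip B m)"

definition orth_complement :: "('v \<Rightarrow> 'v \<Rightarrow> complex) \<Rightarrow> 'v set \<Rightarrow> 'v set" where
  "orth_complement ip S = {x. \<forall>v\<in>S. ip v x = 0}"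

definition orth_projection ::
    "('v \<Rightarrow> 'v \<Rightarrow> complex) \<Rightarrow> 'v set \<Rightarrow> 'v::real_vector \<Rightarrow> 'v" where
  "orth_projection ip S x = (THE y. y \<in> S \<and> x - y \<in> orth_complement ip S)"

text \<open>A semigroup is a family indexed by the reals of which only the part \<open>t \<ge> 0\<close> matters.\<close>

definition c0_semigroup ::
    "(complex \<Rightarrow> 'v \<Rightarrow> 'v) \<Rightarrow> ('v \<Rightarrow> 'v \<Rightarrow> complex) \<Rightarrow> (real \<Rightarrow> 'v::real_vector \<Rightarrow> 'v) \<Rightarrow> bool" where
  "c0_semigroup s ip T \<longleftrightarrow>
     (\<forall>t\<ge>0. bounded_operator s ip (T t)) \<and>
     (\<forall>x. T 0 x = x) \<and>
     (\<forall>t\<ge>0. \<forall>r\<ge>0. \<forall>x. T (t + r) x = T t (T r x)) \<and>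
     (\<forall>x. ((\<lambda>t. ip_norm ip (T t x - x)) \<longlongrightarrow> 0) (at_right 0))"

definition has_generator_value ::
    "('v \<Rightarrow> 'v \<Rightarrow> complex) \<Rightarrow> (real \<Rightarrow> 'v::real_vector \<Rightarrow> 'v) \<Rightarrow> 'v \<Rightarrow> 'v \<Rightarrow> bool" where
  "has_generator_value ip T x y \<longleftrightarrow>
     ((\<lambda>t. ip_norm ip ((1 / t) *\<^sub>R (T t x - x) - y)) \<longlongrightarrow> 0) (at_right 0)"

text \<open>
  An unbounded operator is given by its domain \<open>D\<close> and a function \<open>A\<close> whose values outside \<open>D\<close>
  are irrelevant.
\<close>

definition generates_c0_semigroup ::
    "(complex \<Rightarrow> 'v \<Rightarrow> 'v) \<Rightarrow> ('v \<Rightarrow> 'v \<Rightarrow> complex) \<Rightarrow> 'v set \<Rightarrow> ('v \<Rightarrow> 'v) \<Rightarrow>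
      (real \<Rightarrow> 'v::real_vector \<Rightarrow> 'v) \<Rightarrow> bool" where
  "generates_c0_semigroup s ip D A T \<longleftrightarrow>
     c0_semigroup s ip T \<and>
     D = {x. \<exists>y. has_generator_value ip T x y} \<and>
     (\<forall>x\<in>D. has_generator_value ip T x (A x))"


section \<open>Finite-dimensional space and matrices\<close>

definition cdot :: "complex^'n \<Rightarrow> complex^'n \<Rightarrow> complex" where
  "cdot v w = (\<Sum>i\<in>UNIV. cnj (v $ i) * w $ i)"

definition hermitian :: "complex^'n^'n \<Rightarrow> bool" where
  "hermitian M \<longleftrightarrow> (\<forall>i j. M $ j $ i = cnj (M $ i $ j))"

definition pos_semidef :: "complex^'n^'n \<Rightarrow> bool" where
  "pos_semidef M \<longleftrightarrow> hermitian M \<and> (\<forall>v. Re (cdot v (M *v v)) \<ge> 0)"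

definition pos_def :: "complex^'n^'n \<Rightarrow> bool" where
  "pos_def M \<longleftrightarrow> hermitian M \<and> (\<forall>v. v \<noteq> 0 \<longrightarrow> Re (cdot v (M *v v)) > 0)"

definition hdot :: "complex^'n^'n \<Rightarrow> complex^'n \<Rightarrow> complex^'n \<Rightarrow> complex" where
  "hdot H v w = cdot v (H *v w)"

text \<open>The scalar multiple \<open>c M\<close> of a matrix is written \<open>mat c ** M\<close>.\<close>

definition C_mat :: "complex^'n^'n \<Rightarrow> complex^'n^'n \<Rightarrow> complex^'n^'n \<Rightarrow> complex^'n^'n" where
  "C_mat P1 R H = (R - mat \<i> ** P1) ** H"

definition CS_mat :: "complex^'n^'n \<Rightarrow> complex^'n^'n \<Rightarrow> complex^'n^'n" where
  "CS_mat P1 H = - (mat \<i> ** P1 ** H)"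

definition CH_mat :: "complex^'n^'n \<Rightarrow> complex^'n^'n \<Rightarrow> complex^'n^'n" where
  "CH_mat R H = R ** H"

definition Cm_mat ::
    "complex^'n^'n \<Rightarrow> complex^'n^'n \<Rightarrow> complex^'n^'n \<Rightarrow> int \<Rightarrow> complex^'n^'n" where
  "Cm_mat P1 R H m = mat (of_int m) ** CS_mat P1 H + CH_mat R H"


section \<open>The space of square integrable functions\<close>

abbreviation period_measure :: "real measure" where
  "period_measure \<equiv> lebesgue_on {0..2 * pi}"

definition square_integrable :: "(real \<Rightarrow> complex^'n) \<Rightarrow> bool" where
  "square_integrable f \<longleftrightarrow>
     f \<in> borel_measurable period_measure \<and> integrable period_measure (\<lambda>t. (norm (f t))\<^sup>2)"

definition l2_eq :: "(real \<Rightarrow> complex^'n) \<Rightarrow> (real \<Rightarrow> complex^'n) \<Rightarrow> bool" where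
  "l2_eq f g \<longleftrightarrow>
     square_integrable f \<and> square_integrable g \<and> (AE t in period_measure. f t = g t)"

lemma square_integrable_linear_image:
  fixes f :: "real \<Rightarrow> complex^'n" and g :: "real \<Rightarrow> complex^'n"
  assumes f: "square_integrable f" and h: "linear h"
  shows "square_integrable (\<lambda>t. h (f t) :: complex^'n)"
proof -
  have bl: "bounded_linear h"
    using h by (simp add: linear_conv_bounded_linear)
  then obtain K where K: "\<And>x. norm (h x) \<le> norm x * K"
    using bounded_linear.bounded by blast
  have meas: "(\<lambda>t. h (f t)) \<in> borel_measurable period_measure"
    using f bl unfolding square_integrable_def
    by (auto intro!: borel_measurable_continuous_on[of h] linear_continuous_on)
  have "integrable period_measure (\<lambda>t. K\<^sup>2 * (norm (f t))\<^sup>2)"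
    using f unfolding square_integrable_def by auto
  then have "integrable period_measure (\<lambda>t. (norm (h (f t)))\<^sup>2)"
  proof (rule Bochner_Integration.integrable_bound)
    show "(\<lambda>t. (norm (h (f t)))\<^sup>2) \<in> borel_measurable period_measure"
      using meas by measurable
    have "(norm (h (f t)))\<^sup>2 \<le> K\<^sup>2 * (norm (f t))\<^sup>2" for t
      using power_mono[OF K[of "f t"], of 2] by (simp add: power_mult_distrib mult.commute)
    then show "AE t in period_measure. norm ((norm (h (f t)))\<^sup>2) \<le> norm (K\<^sup>2 * (norm (f t))\<^sup>2)"
      by simp
  qed
  with meas show ?thesis
    by (simp add: square_integrable_def)
qed

lemma square_integrable_add:
  assumes f: "square_integrable f" and g: "square_integrable g"
  shows "square_integrable (\<lambda>t. f t + g t)"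
proof -
  have meas: "(\<lambda>t. f t + g t) \<in> borel_measurable period_measure"
    using f g unfolding square_integrable_def by auto
  have "integrable period_measure (\<lambda>t. 2 * (norm (f t))\<^sup>2 + 2 * (norm (g t))\<^sup>2)"
    using f g unfolding square_integrable_def by auto
  then have "integrable period_measure (\<lambda>t. (norm (f t + g t))\<^sup>2)"
  proof (rule Bochner_Integration.integrable_bound)
    show "(\<lambda>t. (norm (f t + g t))\<^sup>2) \<in> borel_measurable period_measure"
      using meas by measurable
    have "(norm (f t + g t))\<^sup>2 \<le> 2 * (norm (f t))\<^sup>2 + 2 * (norm (g t))\<^sup>2" for t
    proof -
      have "(norm (f t + g t))\<^sup>2 \<le> (norm (f t) + norm (g t))\<^sup>2"
        by (intro power_mono norm_triangle_ineq) simp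
      also have "\<dots> \<le> 2 * (norm (f t))\<^sup>2 + 2 * (norm (g t))\<^sup>2"
        using sum_squares_bound[of "norm (f t)" "norm (g t)"] by (simp add: power2_sum)
      finally show ?thesis .
    qed
    then show "AE t in period_measure.
        norm ((norm (f t + g t))\<^sup>2) \<le> norm (2 * (norm (f t))\<^sup>2 + 2 * (norm (g t))\<^sup>2)"
      by (simp add: add_nonneg_nonneg)
  qed
  with meas show ?thesis
    by (simp add: square_integrable_def)
qed

lemma square_integrable_continuous:
  assumes "continuous_on {0..2 * pi} f"
  shows "square_integrable f"
proof -
  have meas: "f \<in> borel_measurable period_measure"
    using assms by (rule continuous_imp_measurable_on_sets_lebesgue) simp
  have "(\<lambda>t. (norm (f t))\<^sup>2) absolutely_integrable_on {0..2 * pi}"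
    by (intro absolutely_integrable_continuous_real continuous_intros assms)
  then have "integrable period_measure (\<lambda>t. (norm (f t))\<^sup>2)"
    by (simp add: set_integrable_def integrable_restrict_space)
  with meas show ?thesis
    by (simp add: square_integrable_def)
qed

lemma linear_matrix_vector [simp]: "linear ((*v) (M :: complex^'n^'n))"
  by (rule linearI)
    (simp_all add: vec_eq_iff matrix_vector_mult_def scaleR_sum_right distrib_left sum.distrib)

lemma linear_vector_scalar [simp]: "linear ((*s) c :: complex^'n \<Rightarrow> complex^'n)"
  by (rule linearI) (simp_all add: vec_eq_iff algebra_simps)

lemma square_integrable_uminus: "square_integrable f \<Longrightarrow> square_integrable (\<lambda>t. - f t)"
  using square_integrable_linear_image[of f uminus] linear_uminus by auto

lemma square_integrable_scaleR: "square_integrable f \<Longrightarrow> square_integrable (\<lambda>t. c *\<^sub>R f t)"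
  using square_integrable_linear_image[of f "(*\<^sub>R) c"] linear_scaleR by auto

lemma square_integrable_vector_scalar:
  "square_integrable f \<Longrightarrow> square_integrable (\<lambda>t. c *s f t)"
  using square_integrable_linear_image[of f "(*s) c"] by auto

lemma square_integrable_matrix_vector:
  fixes M :: "complex^'n^'n"
  shows "square_integrable f \<Longrightarrow> square_integrable (\<lambda>t. M *v f t)"
  using square_integrable_linear_image[of f "(*v) M"] by auto

lemmas square_integrable_intros =
  square_integrable_add square_integrable_uminus square_integrable_scaleR
  square_integrable_vector_scalar square_integrable_matrix_vector

lemma part_equivp_l2_eq: "part_equivp (l2_eq :: (real \<Rightarrow> complex^'n) \<Rightarrow> _)"
proof (rule part_equivpI)
  have "square_integrable (\<lambda>t. 0 :: complex^'n)"
    by (intro square_integrable_continuous continuous_intros)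
  then have "l2_eq (\<lambda>t. 0 :: complex^'n) (\<lambda>t. 0)"
    by (simp add: l2_eq_def)
  then show "\<exists>f :: real \<Rightarrow> complex^'n. l2_eq f f" by blast
  show "symp (l2_eq :: (real \<Rightarrow> complex^'n) \<Rightarrow> _)"
    by (rule sympI) (auto simp: l2_eq_def eq_commute)
  show "transp (l2_eq :: (real \<Rightarrow> complex^'n) \<Rightarrow> _)"
  proof (rule transpI)
    fix f g h :: "real \<Rightarrow> complex^'n"
    assume *: "l2_eq f g" "l2_eq g h"
    then have "AE t in period_measure. f t = g t" "AE t in period_measure. g t = h t"
      by (auto simp: l2_eq_def)
    then have "AE t in period_measure. f t = h t" by eventually_elim simp
    with * show "l2_eq f h" by (simp add: l2_eq_def)
  qed
qed

text \<open>\<open>'n l2\<close> is \<open>L\<^sup>2([0,2\<pi>]; \<complex>\<^sup>n)\<close>, functions being identified if they agree almost everywhere.\<close>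

quotient_type (overloaded) 'n l2 = "real \<Rightarrow> complex^'n::finite" / partial: l2_eq
  morphisms rep_l2 class_l2
  by (rule part_equivp_l2_eq)

instantiation l2 :: (finite) real_vector
begin

lift_definition zero_l2 :: "'a l2" is "\<lambda>t. 0"
  by (simp add: l2_eq_def square_integrable_continuous)

lift_definition plus_l2 :: "'a l2 \<Rightarrow> 'a l2 \<Rightarrow> 'a l2" is "\<lambda>f g t. f t + g t"
  by (auto simp: l2_eq_def square_integrable_add)

lift_definition uminus_l2 :: "'a l2 \<Rightarrow> 'a l2" is "\<lambda>f t. - f t"
  by (auto simp: l2_eq_def intro: square_integrable_intros)

definition minus_l2 :: "'a l2 \<Rightarrow> 'a l2 \<Rightarrow> 'a l2" where
  "minus_l2 x y = x + - y"

lift_definition scaleR_l2 :: "real \<Rightarrow> 'a l2 \<Rightarrow> 'a l2" is "\<lambda>c f t. c *\<^sub>R f t"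
  by (auto simp: l2_eq_def intro: square_integrable_intros)

instance
proof
  fix a b c :: "'a l2" and r s :: real
  show "a + b + c = a + (b + c)"
    by transfer (auto simp: l2_eq_def square_integrable_add add.assoc)
  show "a + b = b + a"
    by transfer (auto simp: l2_eq_def square_integrable_add add.commute)
  show "0 + a = a"
    by transfer (auto simp: l2_eq_def)
  show "- a + a = 0"
    by transfer (auto simp: l2_eq_def square_integrable_continuous)
  show "a - b = a + - b"
    by (simp add: minus_l2_def)
  show "r *\<^sub>R (a + b) = r *\<^sub>R a + r *\<^sub>R b"
    by transfer (auto simp: l2_eq_def scaleR_add_right
        intro!: square_integrable_intros)
  show "(r + s) *\<^sub>R a = r *\<^sub>R a + s *\<^sub>R a"
    by transfer (auto simp: l2_eq_def scaleR_add_left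
        intro!: square_integrable_intros)
  show "r *\<^sub>R s *\<^sub>R a = (r * s) *\<^sub>R a"
    by transfer (auto simp: l2_eq_def
        intro!: square_integrable_intros)
  show "1 *\<^sub>R a = a"
    by transfer (auto simp: l2_eq_def)
qed

end

lift_definition scaleC_l2 :: "complex \<Rightarrow> 'n::finite l2 \<Rightarrow> 'n l2" is "\<lambda>c f t. c *s f t"
  by (auto simp: l2_eq_def intro: square_integrable_intros)

lift_definition mult_l2 :: "complex^'n^'n \<Rightarrow> 'n::finite l2 \<Rightarrow> 'n l2" is "\<lambda>M f t. M *v f t"
  by (auto simp: l2_eq_def intro: square_integrable_intros)

lift_definition const_l2 :: "complex^'n \<Rightarrow> 'n::finite l2" is "\<lambda>v t. v"
  by (simp add: l2_eq_def square_integrable_continuous)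

lift_definition fourier_mode :: "int \<Rightarrow> complex^'n \<Rightarrow> 'n::finite l2"
  is "\<lambda>m z t. exp (\<i> * of_int m * of_real t) *s z"
proof -
  fix m :: int and z :: "complex^'n"
  have "continuous_on {0..2 * pi} (\<lambda>t. exp (\<i> * of_int m * of_real t) *s z)"
    unfolding vector_scalar_mult_def by (intro continuous_intros)
  then show "l2_eq (\<lambda>t. exp (\<i> * of_int m * of_real t) *s z) (\<lambda>t. exp (\<i> * of_int m * of_real t) *s z)"
    by (simp add: l2_eq_def square_integrable_continuous)
qed

lemma vector_space_scaleC_l2: "vector_space (scaleC_l2 :: complex \<Rightarrow> 'n::finite l2 \<Rightarrow> 'n l2)"
proof
  fix a b :: complex and x y :: "'n l2"
  show "scaleC_l2 a (x + y) = scaleC_l2 a x + scaleC_l2 a y"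
    by transfer (auto simp: l2_eq_def vector_add_ldistrib
        intro!: square_integrable_intros)
  show "scaleC_l2 (a + b) x = scaleC_l2 a x + scaleC_l2 b x"
    by transfer (auto simp: l2_eq_def vector_sadd_rdistrib
        intro!: square_integrable_intros)
  show "scaleC_l2 a (scaleC_l2 b x) = scaleC_l2 (a * b) x"
    by transfer (auto simp: l2_eq_def vector_smult_assoc
        intro!: square_integrable_intros)
  show "scaleC_l2 1 x = x"
    by transfer (auto simp: l2_eq_def)
qed

lift_definition l2_inner :: "complex^'n^'n \<Rightarrow> 'n::finite l2 \<Rightarrow> 'n l2 \<Rightarrow> complex"
  is "\<lambda>H f g. integral\<^sup>L period_measure (\<lambda>t. hdot H (f t) (g t))"
proof -
  fix H :: "complex^'n^'n" and f f' g g' :: "real \<Rightarrow> complex^'n"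
  assume *: "l2_eq f f'" "l2_eq g g'"
  have meas: "(\<lambda>t. hdot H (u t) (v t)) \<in> borel_measurable period_measure"
    if "square_integrable u" "square_integrable v" for u v :: "real \<Rightarrow> complex^'n"
  proof -
    have "continuous_on UNIV (\<lambda>p :: (complex^'n) \<times> (complex^'n). hdot H (fst p) (snd p))"
      unfolding hdot_def cdot_def matrix_vector_mult_def by (auto intro!: continuous_intros)
    from borel_measurable_continuous_on[OF this, of "\<lambda>t. (u t, v t)"] that
    show ?thesis by (simp add: square_integrable_def borel_measurable_Pair)
  qed
  have "AE t in period_measure. f t = f' t" "AE t in period_measure. g t = g' t"
    using * by (auto simp: l2_eq_def)
  then have "AE t in period_measure. hdot H (f t) (g t) = hdot H (f' t) (g' t)"
    by eventually_elim simp
  with * show "integral\<^sup>L period_measure (\<lambda>t. hdot H (f t) (g t)) =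
      integral\<^sup>L period_measure (\<lambda>t. hdot H (f' t) (g' t))"
    by (intro integral_cong_AE meas) (auto simp: l2_eq_def)
qed


section \<open>Weak derivatives and the operator\<close>

text \<open>Continuously differentiable with compact support in the open interval.\<close>

definition test_function :: "(real \<Rightarrow> real) \<Rightarrow> bool" where
  "test_function \<phi> \<longleftrightarrow>
     \<phi> C1_differentiable_on UNIV \<and> closure {t. \<phi> t \<noteq> 0} \<subseteq> {0<..<2 * pi}"

lemma test_function_continuous:
  assumes "test_function \<phi>"
  shows "continuous_on UNIV \<phi>" "continuous_on UNIV (deriv \<phi>)"
proof -
  obtain D where D: "\<And>t. (\<phi> has_vector_derivative D t) (at t)" "continuous_on UNIV D"
    using assms unfolding test_function_def C1_differentiable_on_def by auto
  then have "deriv \<phi> = D"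
    by (auto intro!: ext DERIV_imp_deriv simp: has_real_derivative_iff_has_vector_derivative)
  with D show "continuous_on UNIV (deriv \<phi>)" by simp
  show "continuous_on UNIV \<phi>"
    using D(1) by (intro continuous_at_imp_continuous_on ballI has_vector_derivative_continuous)
qed

lift_definition has_weak_deriv :: "'n::finite l2 \<Rightarrow> 'n l2 \<Rightarrow> bool"
  is "\<lambda>f g. \<forall>\<phi>. test_function \<phi> \<longrightarrow>
        integral\<^sup>L period_measure (\<lambda>t. deriv \<phi> t *\<^sub>R f t) =
        - integral\<^sup>L period_measure (\<lambda>t. \<phi> t *\<^sub>R g t)"
proof -
  fix f f' g g' :: "real \<Rightarrow> complex^'n"
  assume *: "l2_eq f f'" "l2_eq g g'"
  have cong: "integral\<^sup>L period_measure (\<lambda>t. \<psi> t *\<^sub>R u t) =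
      integral\<^sup>L period_measure (\<lambda>t. \<psi> t *\<^sub>R v t)"
    if "l2_eq u v" "continuous_on UNIV \<psi>" for u v :: "real \<Rightarrow> complex^'n" and \<psi> :: "real \<Rightarrow> real"
  proof (rule integral_cong_AE)
    have "\<psi> \<in> borel_measurable period_measure"
      using that(2)
      by (intro continuous_imp_measurable_on_sets_lebesgue) (auto intro: continuous_on_subset)
    with that(1) show
      "(\<lambda>t. \<psi> t *\<^sub>R u t) \<in> borel_measurable period_measure"
      "(\<lambda>t. \<psi> t *\<^sub>R v t) \<in> borel_measurable period_measure"
      by (auto simp: l2_eq_def square_integrable_def)
    show "AE t in period_measure. \<psi> t *\<^sub>R u t = \<psi> t *\<^sub>R v t"
      using that(1) by (auto simp: l2_eq_def)
  qed
  show "(\<forall>\<phi>. test_function \<phi> \<longrightarrow>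
        integral\<^sup>L period_measure (\<lambda>t. deriv \<phi> t *\<^sub>R f t) =
        - integral\<^sup>L period_measure (\<lambda>t. \<phi> t *\<^sub>R g t)) =
      (\<forall>\<phi>. test_function \<phi> \<longrightarrow>
        integral\<^sup>L period_measure (\<lambda>t. deriv \<phi> t *\<^sub>R f' t) =
        - integral\<^sup>L period_measure (\<lambda>t. \<phi> t *\<^sub>R g' t))"
    by (simp add: cong[OF *(1)] cong[OF *(2)] test_function_continuous cong: imp_cong)
qed

definition weak_deriv :: "'n::finite l2 \<Rightarrow> 'n l2" where
  "weak_deriv x = (THE y. has_weak_deriv x y)"

definition H1 :: "'n::finite l2 set" where
  "H1 = {x. \<exists>y. has_weak_deriv x y}"

text \<open>The boundary values of \<open>x\<close> in \<^const>\<open>H1\<close> are those of its continuous representative.\<close>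

definition domain_A :: "'n::finite l2 set" where
  "domain_A = {x \<in> H1. \<exists>f. continuous_on {0..2 * pi} f \<and> class_l2 f = x \<and> f 0 = f (2 * pi)}"

definition op_A ::
    "complex^'n^'n \<Rightarrow> complex^'n^'n \<Rightarrow> complex^'n^'n \<Rightarrow> 'n::finite l2 \<Rightarrow> 'n l2" where
  "op_A P1 R H x = mult_l2 P1 (weak_deriv (mult_l2 H x)) - mult_l2 R (mult_l2 H x)"

definition V_inf :: "complex^'n^'n \<Rightarrow> complex^'n^'n \<Rightarrow> 'n::finite l2 set" where
  "V_inf R H = {const_l2 v | v. (R ** H) *v v = 0}"

definition Q_inf :: "complex^'n^'n \<Rightarrow> complex^'n^'n \<Rightarrow> 'n::finite l2 \<Rightarrow> 'n l2" where
  "Q_inf R H = orth_projection (l2_inner H) (V_inf R H)"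

definition has_fourier_expansion ::
    "complex^'n^'n \<Rightarrow> 'n::finite l2 \<Rightarrow> (int \<Rightarrow> complex^'n) \<Rightarrow> bool" where
  "has_fourier_expansion H x z \<longleftrightarrow>
     ((\<lambda>F. ip_norm (l2_inner H) (x - (\<Sum>m\<in>F. fourier_mode m (z m)))) \<longlongrightarrow> 0)
       (finite_subsets_at_top UNIV)"

definition P_coeff ::
    "complex^'n^'n \<Rightarrow> complex^'n^'n \<Rightarrow> complex^'n^'n \<Rightarrow> nat \<Rightarrow> int \<Rightarrow> complex^'n \<Rightarrow> complex^'n" where
  "P_coeff P1 R H k m v =
     (if m = 0 then v
      else \<Sum>j\<le>k. (1 / of_int m ^ (2 * j)) *\<^sub>R
             ((adjoint_wrt (hdot H) ((*v) (Cm_mat P1 R H m)) ^^ j)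
                (((*v) (Cm_mat P1 R H m) ^^ j) v)))"

definition op_P ::
    "complex^'n^'n \<Rightarrow> complex^'n^'n \<Rightarrow> complex^'n^'n \<Rightarrow> nat \<Rightarrow> 'n::finite l2 \<Rightarrow> 'n l2" where
  "op_P P1 R H k x =
     (THE y. \<exists>z. has_fourier_expansion H x z \<and>
                 has_fourier_expansion H y (\<lambda>m. P_coeff P1 R H k m (z m)))"

end

theory Submission
  imports Defs
begin

text \<open>
  On the Fourier mode \<open>\<phi>\<^sub>m\<close> the semigroup acts as \<open>exp (- t C\<^sub>m)\<close>, so everything reduces to estimates
  in \<open>\<complex>\<^sup>n\<close> that are uniform in \<open>m\<close>. The energy lost by a solution of \<open>y' = - C\<^sub>m y\<close> up to time \<open>t\<close>
  controls \<open>\<integral> \<parallel>C\<^sub>H y\<parallel>\<^sup>2\<close>. After rescaling time by \<open>\<bar>m\<bar>\<close>, the Taylor polynomial of \<open>C\<^sub>H y\<close> of degree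
  \<open>m\<^sub>H\<^sub>C\<close> has the coefficients \<open>C\<^sub>H (C\<^sub>m / m)\<^sup>j y(0) / j!\<close> up to signs. Hypocoercivity bounds their sum from
  below independently of \<open>m\<close>, which gives the loss \<open>c t\<^sup>a\<close> with \<open>a = 2 m\<^sub>H\<^sub>C + 1\<close>. Conversely, for a vector
  annihilated by \<open>C\<^sub>H C\<^sub>S\<^sup>j\<close>, \<open>j < m\<^sub>H\<^sub>C\<close>, the first \<open>m\<^sub>H\<^sub>C\<close> coefficients vanish and the mode \<open>m = 1\<close> loses
  no more than \<open>O(t\<^sup>a)\<close>. On \<open>\<V>\<^sub>\<infinity>\<^sup>\<bottom>\<close> the norm is thus below one at time one, hence decays exponentially.
  The Lyapunov inequality follows by summing
  \<open>Re \<langle>C\<^sub>m z, (C\<^sub>m\<^sup>*)\<^sup>j C\<^sub>m\<^sup>j z\<rangle> = \<langle>C\<^sub>H C\<^sub>m\<^sup>j z, C\<^sub>m\<^sup>j z\<rangle>\<close> with the weights \<open>m\<^sup>-\<^sup>2\<^sup>j\<close> over \<open>j\<close> and \<open>m\<close>.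
\<close>

section \<open>Hypocoercive decay in finite dimensions\<close>

text \<open>The constants are independent of m because C_m / |m| = \<sigma> C_S + \<epsilon> C_H
  with |\<sigma>| = 1 and \<epsilon> = 1/|m| \<le> 1, a bounded family whose members and C_S can be
  expressed through each other up to multiples of C_H. The price is a factor \<epsilon> in the
  energy loss. The stretched time |m| t pays it back: through the power |m|^(2k) while |m| t \<le>
  1, and through the number of unit steps afterwards. In place of a square root of C_H stands the
  inequality c |C_H x|^2 \<le> <C_H x, x>, so norms of C_H x suffice. The mode m = 0 has no skew
  part; there C_H alone must act off its kernel. The semigroup is given only through its generator,
  so its action on a mode is recovered from difference quotients at 0; stability then requires local
  boundedness of T, by Baire and hence by completeness of L^2. For x in the domain of A the
  coefficients of A x are read off from T. Completeness of the exponentials carries both the Fourier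
  expansions and the uniqueness of weak derivatives.\<close>

lemma integral_norm_dilation:
  fixes f :: "real \<Rightarrow> 'v::euclidean_space"
  assumes "continuous_on UNIV f" "m > 0"
  shows "integral {0..1} (\<lambda>s. norm (f (m * s))) = integral {0..m} (\<lambda>s. norm (f s)) / m"
proof -
  have "continuous_on {0..m} (\<lambda>s. norm (f s))"
    by (intro continuous_intros continuous_on_subset[OF assms(1)]) auto
  then have "((\<lambda>s. norm (f s)) has_integral integral {0..m} (\<lambda>s. norm (f s))) {0..m}"
    by (intro integrable_integral integrable_continuous_real)
  from has_integral_stretch_real[OF this, of m] assms(2)
  have "((\<lambda>s. norm (f (m * s))) has_integral (integral {0..m} (\<lambda>s. norm (f s)) / m)) ((\<lambda>x. x / m) ` {0..m})"
    by (simp add: divide_inverse mult.commute)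
  moreover have "(\<lambda>x. x / m) ` {0..m} = {0..1}"
    using assms(2) image_divide_atLeastAtMost[of m 0 m] by simp
  ultimately show ?thesis by (simp add: integral_unique)
qed

text \<open>For p of degree k+1 the combination 2^(k+1) p(s/2) - p(s) has no term of degree k+1 and
  multiplies the lower coefficients by factors of at least 1, while its L^1 norm on [0,1] is bounded
  by that of p. So the lower coefficients follow by induction and the top one by
  subtraction.\<close>

lemma coeff_le_integral_norm_unit:
  "\<exists>K>0. \<forall>a :: nat \<Rightarrow> 'v::euclidean_space. \<forall>j\<le>k.
     norm (a j) \<le> K * integral {0..1} (\<lambda>s. norm (\<Sum>i\<le>k. s ^ i *\<^sub>R a i))"
proof (induction k)
  case 0
  show ?case by (rule exI[of _ 1]) simp
next
  case (Suc k)
  then obtain K where K: "K > 0" and IH: "\<And>(a :: nat \<Rightarrow> 'v) j. j \<le> k \<Longrightarrow>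
     norm (a j) \<le> K * integral {0..1} (\<lambda>s. norm (\<Sum>i\<le>k. s ^ i *\<^sub>R a i))"
    by blast
  define K1 where "K1 = K * (2 ^ Suc (Suc k) + 1)"
  define K2 where "K2 = K1 + (real k + 2) * (1 + (real k + 1) * K1)"
  have K1: "K1 > 0" using K by (simp add: K1_def add_pos_pos)
  show ?case
  proof (intro exI[of _ K2] conjI allI impI)
    show "K2 > 0" using K1 by (simp add: K2_def add_pos_pos)
    fix a :: "nat \<Rightarrow> 'v" and j assume j: "j \<le> Suc k"
    define p where "p s = (\<Sum>i\<le>Suc k. s ^ i *\<^sub>R a i)" for s :: real
    define I where "I = integral {0..1} (\<lambda>s. norm (p s))"
    have cp: "continuous_on A p" for A unfolding p_def by (intro continuous_intros)
    have cph: "continuous_on A (\<lambda>s. p (1/2 * s))" for A unfolding p_def by (intro continuous_intros)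
    have cph': "continuous_on A (\<lambda>s. p (s / 2))" for A using cph[of A] by simp
    have I0: "I \<ge> 0" unfolding I_def by (intro integral_nonneg integrable_continuous_real continuous_intros cp) auto
    define b where "b i = (2 ^ Suc k / 2 ^ i - 1) *\<^sub>R a i" for i
    have psplit: "(\<Sum>i\<le>k. s ^ i *\<^sub>R b i) = 2 ^ Suc k *\<^sub>R p (1/2 * s) - p s" for s
    proof -
      have "2 ^ Suc k *\<^sub>R p (1/2 * s) - p s = (\<Sum>i\<le>Suc k. s ^ i *\<^sub>R b i)"
        unfolding p_def b_def scaleR_sum_right sum_subtractf[symmetric]
        by (intro sum.cong) (simp_all add: power_mult_distrib power_divide algebra_simps)
      then show ?thesis by (simp add: b_def)
    qed
    have small: "norm (a i) \<le> K1 * I" if i: "i \<le> k" for i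
    proof -
      have "norm (a i) = 1 * norm (a i)" by simp
      also have "\<dots> \<le> (2 ^ Suc k / 2 ^ i - 1) * norm (a i)"
      proof (rule mult_right_mono)
        have "(2::real) ^ Suc k \<ge> 2 ^ Suc i" using i by (intro power_increasing) auto
        then show "1 \<le> (2::real) ^ Suc k / 2 ^ i - 1" by (simp add: field_simps)
      qed simp
      also have "\<dots> = norm (b i)"
      proof -
        have "(2::real) ^ i \<le> 2 ^ Suc k" using i by (intro power_increasing) auto
        then show ?thesis by (simp add: b_def)
      qed
      also have "\<dots> \<le> K * integral {0..1} (\<lambda>s. norm (\<Sum>i\<le>k. s ^ i *\<^sub>R b i))"
        by (rule IH[OF i])
      also have "\<dots> \<le> K * ((2 ^ Suc (Suc k) + 1) * I)"
      proof (intro mult_left_mono)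
        have "integral {0..1} (\<lambda>s. norm (\<Sum>i\<le>k. s ^ i *\<^sub>R b i))
           \<le> integral {0..1} (\<lambda>s. 2 ^ Suc k * norm (p (1/2 * s)) + norm (p s))"
          unfolding psplit
        proof (rule integral_le)
          fix s :: real
          show "norm (2 ^ Suc k *\<^sub>R p (1/2 * s) - p s) \<le> 2 ^ Suc k * norm (p (1/2 * s)) + norm (p s)"
            by (rule order_trans[OF norm_triangle_ineq4]) simp
        qed (intro integrable_continuous_real continuous_intros cp cph)+
        also have "\<dots> = 2 ^ Suc k * integral {0..1} (\<lambda>s. norm (p (1/2 * s))) + I"
          unfolding I_def by (subst integral_add)
            (auto intro!: integrable_continuous_real continuous_intros cp cph' simp del: power_Suc)
        also have "integral {0..1} (\<lambda>s. norm (p (1/2 * s))) = integral {0..1/2} (\<lambda>s. norm (p s)) / (1/2)"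
          by (rule integral_norm_dilation[OF cp]) simp
        also have "\<dots> \<le> 2 * I"
        proof -
          have "integral {0..1/2} (\<lambda>s. norm (p s)) \<le> I"
            unfolding I_def
            by (rule integral_subset_le) (auto intro!: integrable_continuous_real continuous_intros cp)
          then show ?thesis by simp
        qed
        finally show "integral {0..1} (\<lambda>s. norm (\<Sum>i\<le>k. s ^ i *\<^sub>R b i)) \<le> (2 ^ Suc (Suc k) + 1) * I"
          by (simp add: algebra_simps)
      qed (use K in auto)
      finally show ?thesis by (simp add: K1_def)
    qed
    \<comment> \<open>The leading term is p minus the lower ones. Integrating s^(k+1) over [0,1]
      gives 1/(k+2), which is the source of the factor in \<open>K2\<close>.\<close>
    have top: "norm (a (Suc k)) \<le> (real k + 2) * (1 + (real k + 1) * K1) * I"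
    proof -
      have "integral {0..1} (\<lambda>s. s ^ Suc k * norm (a (Suc k))) \<le> integral {0..1} (\<lambda>s. norm (p s) + (\<Sum>i\<le>k. norm (a i)))"
      proof (rule integral_le)
        fix s :: real assume s: "s \<in> {0..1}"
        have "s ^ Suc k *\<^sub>R a (Suc k) = p s - (\<Sum>i\<le>k. s ^ i *\<^sub>R a i)" by (simp add: p_def)
        then have "norm (s ^ Suc k *\<^sub>R a (Suc k)) \<le> norm (p s) + norm (\<Sum>i\<le>k. s ^ i *\<^sub>R a i)"
          using norm_triangle_ineq4 by metis
        also have "norm (\<Sum>i\<le>k. s ^ i *\<^sub>R a i) \<le> (\<Sum>i\<le>k. norm (a i))"
        proof (rule sum_norm_le)
          fix i
          have "\<bar>s\<bar> ^ i \<le> 1" using s by (intro power_le_one) auto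
          then show "norm (s ^ i *\<^sub>R a i) \<le> norm (a i)"
            using mult_right_mono[of "\<bar>s\<bar> ^ i" 1 "norm (a i)"] by (simp add: power_abs)
        qed
        finally show "s ^ Suc k * norm (a (Suc k)) \<le> norm (p s) + (\<Sum>i\<le>k. norm (a i))"
          using s by simp
      qed (intro integrable_continuous_real continuous_intros cp)+
      also have "\<dots> = I + (\<Sum>i\<le>k. norm (a i))"
        unfolding I_def by (subst integral_add) (auto intro!: integrable_continuous_real continuous_intros cp)
      also have "(\<Sum>i\<le>k. norm (a i)) \<le> (\<Sum>i\<le>k. K1 * I)" by (intro sum_mono small) auto
      also have "integral {0..1} (\<lambda>s. s ^ Suc k * norm (a (Suc k))) = norm (a (Suc k)) / (real k + 2)"
      proof -
        have "((\<lambda>s. s ^ Suc k * norm (a (Suc k))) has_integral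
          (1 ^ Suc (Suc k) / (real k + 2) * norm (a (Suc k)) - 0 ^ Suc (Suc k) / (real k + 2) * norm (a (Suc k)))) {0..1::real}"
        proof (intro fundamental_theorem_of_calculus)
          fix s :: real assume "s \<in> {0..1}"
          have "((\<lambda>s. s ^ Suc (Suc k) / (real k + 2) * norm (a (Suc k))) has_real_derivative
              (real (Suc (Suc k)) * s ^ Suc k / (real k + 2) * norm (a (Suc k)))) (at s within {0..1})"
            using DERIV_pow[of "Suc (Suc k)" s "{0..1}"]
            by (intro DERIV_cmult_right DERIV_cdivide) (simp del: power_Suc of_nat_Suc)
          moreover have "real (Suc (Suc k)) * s ^ Suc k / (real k + 2) * norm (a (Suc k)) = s ^ Suc k * norm (a (Suc k))"
            by (simp del: power_Suc add: add.commute)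
          ultimately show "((\<lambda>s. s ^ Suc (Suc k) / (real k + 2) * norm (a (Suc k))) has_vector_derivative
              s ^ Suc k * norm (a (Suc k))) (at s within {0..1})"
            by (simp add: has_real_derivative_iff_has_vector_derivative del: power_Suc)
        qed simp
        from integral_unique[OF this] show ?thesis by simp
      qed
      finally show ?thesis by (simp add: field_simps)
    qed
    have "K1 * I \<le> K2 * I" "(real k + 2) * (1 + (real k + 1) * K1) * I \<le> K2 * I"
      using K1 I0 by (auto intro!: mult_right_mono simp: K2_def)
    then have "norm (a j) \<le> K2 * I"
      using small[of j] top j by (cases "j = Suc k") auto
    then show "norm (a j) \<le> K2 * integral {0..1} (\<lambda>s. norm (\<Sum>i\<le>Suc k. s ^ i *\<^sub>R a i))"
      by (simp add: I_def p_def)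
  qed
qed

text \<open>Rescaling to the unit interval: the coefficient picks up T^j and the change of variables
  one more T, whence the exponent \<open>j + 1\<close>.\<close>

lemma coeff_le_integral_norm:
  "\<exists>K>0. \<forall>(a :: nat \<Rightarrow> 'v::euclidean_space) T. \<forall>j\<le>k. T > 0 \<longrightarrow>
     norm (a j) * T ^ (j + 1) \<le> K * integral {0..T} (\<lambda>s. norm (\<Sum>i\<le>k. s ^ i *\<^sub>R a i))"
proof -
  obtain K where K: "K > 0" and *: "\<And>(a :: nat \<Rightarrow> 'v) j. j \<le> k \<Longrightarrow>
     norm (a j) \<le> K * integral {0..1} (\<lambda>s. norm (\<Sum>i\<le>k. s ^ i *\<^sub>R a i))"
    using coeff_le_integral_norm_unit[of k] by blast
  show ?thesis
  proof (intro exI[of _ K] conjI K allI impI)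
    fix a :: "nat \<Rightarrow> 'v" and T :: real and j assume j: "j \<le> k" and T: "T > 0"
    let ?p = "\<lambda>s. \<Sum>i\<le>k. s ^ i *\<^sub>R a i"
    have "norm (T ^ j *\<^sub>R a j) \<le> K * integral {0..1} (\<lambda>s. norm (\<Sum>i\<le>k. s ^ i *\<^sub>R (T ^ i *\<^sub>R a i)))"
      using *[OF j, of "\<lambda>i. T ^ i *\<^sub>R a i"] .
    also have "(\<lambda>s. norm (\<Sum>i\<le>k. s ^ i *\<^sub>R (T ^ i *\<^sub>R a i))) = (\<lambda>s. norm (?p (T * s)))"
      by (simp add: power_mult_distrib mult.commute)
    also have "integral {0..1} \<dots> = integral {0..T} (\<lambda>s. norm (?p s)) / T"
      by (rule integral_norm_dilation[OF _ T]) (intro continuous_intros)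
    finally show "norm (a j) * T ^ (j + 1) \<le> K * integral {0..T} (\<lambda>s. norm (?p s))"
      using T by (simp add: field_simps)
  qed
qed

section \<open>Words in linear maps and Taylor remainders\<close>

lemma linear_funpow:
  fixes B :: "'v::real_vector \<Rightarrow> 'v"
  assumes "linear B"
  shows "linear (B ^^ i)"
proof (induction i)
  case 0
  show ?case by (simp add: linear_iff)
next
  case (Suc i)
  show ?case unfolding funpow.simps by (rule linear_compose[OF Suc assms])
qed

lemma norm_funpow_le:
  fixes f :: "'v::real_normed_vector \<Rightarrow> 'v"
  assumes "\<And>v. norm (f v) \<le> K * norm v" "K \<ge> 0"
  shows "norm ((f ^^ j) v) \<le> K ^ j * norm v"
proof (induction j)
  case (Suc j)
  have "norm ((f ^^ Suc j) v) \<le> K * norm ((f ^^ j) v)" using assms by simp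
  also have "\<dots> \<le> K * (K ^ j * norm v)" using Suc assms by (intro mult_left_mono) auto
  finally show ?case by (simp add: mult.assoc)
qed simp

text \<open>Peeling off the innermost letter, S^(j+1) z = S^j (a B z + b C z), reduces to shorter
  words applied to B z and to C z; the latter contribute only multiples of |C z|. The operators and
  \<open>a\<close>, \<open>b\<close> are quantified after the constant because the lemma serves a
  whole family with common bounds. This is the comparison behind replacing an operator by its skew
  part in the hypocoercivity condition.\<close>

lemma norm_word_le:
  assumes "Kc \<ge> 0" "Kb \<ge> 0"
  shows "\<exists>K>0. \<forall>(C :: 'v::euclidean_space \<Rightarrow> 'v) B S a b z.
     linear C \<longrightarrow> linear B \<longrightarrow> (\<forall>v. norm (C v) \<le> Kc * norm v) \<longrightarrow> (\<forall>v. norm (B v) \<le> Kb * norm v) \<longrightarrow>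
     \<bar>a\<bar> \<le> 1 \<longrightarrow> \<bar>b\<bar> \<le> 1 \<longrightarrow> (\<forall>v. S v = a *\<^sub>R B v + b *\<^sub>R C v) \<longrightarrow>
     norm (C ((S ^^ j) z)) \<le> K * (\<Sum>i\<le>j. norm (C ((B ^^ i) z)))"
proof (induction j)
  case 0
  show ?case by (rule exI[of _ 1]) simp
next
  case (Suc j)
  then obtain K where K: "K > 0" and IH: "\<forall>(C :: 'v \<Rightarrow> 'v) B S a b z.
     linear C \<longrightarrow> linear B \<longrightarrow> (\<forall>v. norm (C v) \<le> Kc * norm v) \<longrightarrow> (\<forall>v. norm (B v) \<le> Kb * norm v) \<longrightarrow>
     \<bar>a\<bar> \<le> 1 \<longrightarrow> \<bar>b\<bar> \<le> 1 \<longrightarrow> (\<forall>v. S v = a *\<^sub>R B v + b *\<^sub>R C v) \<longrightarrow>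
     norm (C ((S ^^ j) z)) \<le> K * (\<Sum>i\<le>j. norm (C ((B ^^ i) z)))"
    by (elim exE conjE) (rule that)
  define K' where "K' = K * (1 + (\<Sum>i\<le>j. Kc * Kb ^ i))"
  have s0: "(\<Sum>i\<le>j. Kc * Kb ^ i) \<ge> 0" using assms by (intro sum_nonneg) auto
  show ?case
  proof (intro exI[of _ K'] conjI allI impI)
    show "K' > 0" using K s0 by (simp add: K'_def)
    fix C B S :: "'v \<Rightarrow> 'v" and a b :: real and z
    assume C: "linear C" and B: "linear B" and c: "\<forall>v. norm (C v) \<le> Kc * norm v"
      and b: "\<forall>v. norm (B v) \<le> Kb * norm v" and ab: "\<bar>a\<bar> \<le> 1" "\<bar>b\<bar> \<le> 1"
      and S: "\<forall>v. S v = a *\<^sub>R B v + b *\<^sub>R C v"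
    have linB: "linear (B ^^ i)" for i by (rule linear_funpow[OF B])
    have normB: "norm ((B ^^ i) v) \<le> Kb ^ i * norm v" for i v
      by (rule norm_funpow_le) (use b assms in auto)
    let ?D = "\<Sum>i\<le>Suc j. norm (C ((B ^^ i) z))"
    have z0: "norm (C z) \<le> ?D"
      by (rule order_trans[OF _ member_le_sum[of 0]]) auto
    have "norm (C ((S ^^ Suc j) z)) = norm (C ((S ^^ j) (S z)))" by (simp add: funpow_swap1)
    also have "\<dots> \<le> K * (\<Sum>i\<le>j. norm (C ((B ^^ i) (S z))))" by (rule IH[rule_format, where a=a and b=b]) (use C B c b ab S in auto)
    also have "(\<Sum>i\<le>j. norm (C ((B ^^ i) (S z)))) \<le> (\<Sum>i\<le>j. norm (C ((B ^^ Suc i) z)) + Kc * Kb ^ i * norm (C z))"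
    proof (rule sum_mono)
      fix i
      have "C ((B ^^ i) (S z)) = a *\<^sub>R C ((B ^^ Suc i) z) + b *\<^sub>R C ((B ^^ i) (C z))"
        using S by (simp add: linear_add[OF linB] linear_scale[OF linB] linear_add[OF C] linear_scale[OF C] funpow_swap1)
      then have "norm (C ((B ^^ i) (S z))) \<le> \<bar>a\<bar> * norm (C ((B ^^ Suc i) z)) + \<bar>b\<bar> * norm (C ((B ^^ i) (C z)))"
        using norm_triangle_ineq by (metis norm_scaleR)
      also have "\<dots> \<le> 1 * norm (C ((B ^^ Suc i) z)) + 1 * norm (C ((B ^^ i) (C z)))"
        using ab by (intro add_mono mult_right_mono) auto
      also have "norm (C ((B ^^ i) (C z))) \<le> Kc * norm ((B ^^ i) (C z))" using c by blast
      also have "\<dots> \<le> Kc * (Kb ^ i * norm (C z))" using normB assms by (intro mult_left_mono) auto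
      finally show "norm (C ((B ^^ i) (S z))) \<le> norm (C ((B ^^ Suc i) z)) + Kc * Kb ^ i * norm (C z)" by simp
    qed
    also have "\<dots> = (\<Sum>i\<le>j. norm (C ((B ^^ Suc i) z))) + (\<Sum>i\<le>j. Kc * Kb ^ i) * norm (C z)"
      by (simp add: sum.distrib sum_distrib_right)
    also have "(\<Sum>i\<le>j. norm (C ((B ^^ Suc i) z))) \<le> ?D"
      by (subst sum.atMost_Suc_shift) simp
    also have "(\<Sum>i\<le>j. Kc * Kb ^ i) * norm (C z) \<le> (\<Sum>i\<le>j. Kc * Kb ^ i) * ?D"
      by (intro mult_left_mono z0 s0)
    finally show "norm (C ((S ^^ Suc j) z)) \<le> K' * ?D"
      using K by (simp add: K'_def algebra_simps)
  qed
qed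

text \<open>The remainders satisfy r_(n+1)' = B r_n and r_(n+1)(0) = 0, so the mean value inequality
  raises the order by one. Since it is used instead of integration, the bound carries no
  1/n!.\<close>

lemma norm_taylor_remainder_le:
  fixes Y :: "real \<Rightarrow> 'v::euclidean_space"
  assumes B: "linear B" "\<And>v. norm (B v) \<le> K * norm v"
    and Y: "\<And>s. (Y has_vector_derivative B (Y s)) (at s)"
    and M: "\<And>s. s \<in> {0..T} \<Longrightarrow> norm (Y s) \<le> M" and s: "s \<in> {0..T}" and K: "K \<ge> 0"
  shows "norm (Y s - (\<Sum>j<n. (s ^ j / fact j) *\<^sub>R (B ^^ j) (Y 0))) \<le> K ^ n * M * s ^ n"
  using s
proof (induction n arbitrary: s)
  case 0
  then show ?case using M by simp
next
  case (Suc n)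
  let ?r = "\<lambda>n s. Y s - (\<Sum>j<n. (s ^ j / fact j) *\<^sub>R (B ^^ j) (Y 0))"
  have der: "(?r (Suc n) has_vector_derivative B (?r n s)) (at s)" for s
  proof -
    have "((\<lambda>s. \<Sum>j<n. (s ^ Suc j / fact (Suc j)) *\<^sub>R (B ^^ Suc j) (Y 0)) has_vector_derivative
        (\<Sum>j<n. (s ^ j / fact j) *\<^sub>R (B ^^ Suc j) (Y 0))) (at s)"
    proof (intro has_vector_derivative_sum)
      fix j
      have "((\<lambda>s. s ^ Suc j / fact (Suc j)) has_real_derivative s ^ j / fact j) (at s)"
        using DERIV_cdivide[OF DERIV_pow[of "Suc j" s UNIV], of "fact (Suc j)"]
        by (simp add: field_simps del: power_Suc of_nat_Suc)
      then show "((\<lambda>s. (s ^ Suc j / fact (Suc j)) *\<^sub>R (B ^^ Suc j) (Y 0)) has_vector_derivative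
        (s ^ j / fact j) *\<^sub>R (B ^^ Suc j) (Y 0)) (at s)"
        by (intro has_vector_derivative_scaleR[THEN has_vector_derivative_eq_rhs] has_vector_derivative_const) auto
    qed
    then have "((\<lambda>s. Y s - (Y 0 + (\<Sum>j<n. (s ^ Suc j / fact (Suc j)) *\<^sub>R (B ^^ Suc j) (Y 0)))) has_vector_derivative
        (B (Y s) - (0 + (\<Sum>j<n. (s ^ j / fact j) *\<^sub>R (B ^^ Suc j) (Y 0))))) (at s)"
      by (intro has_vector_derivative_diff has_vector_derivative_add has_vector_derivative_const Y)
    moreover have "B (Y s) - (0 + (\<Sum>j<n. (s ^ j / fact j) *\<^sub>R (B ^^ Suc j) (Y 0))) = B (?r n s)"
      by (simp add: linear_diff[OF B(1)] linear_sum[OF B(1)] linear_scale[OF B(1)])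
    moreover have "(\<Sum>j<Suc n. (s ^ j / fact j) *\<^sub>R (B ^^ j) (Y 0)) =
        Y 0 + (\<Sum>j<n. (s ^ Suc j / fact (Suc j)) *\<^sub>R (B ^^ Suc j) (Y 0))" for s
      by (subst sum.lessThan_Suc_shift) simp
    ultimately show ?thesis by simp
  qed
  have r0: "?r (Suc n) 0 = 0" by (simp add: sum.lessThan_Suc_shift del: sum.lessThan_Suc)
  show ?case
  proof (cases "s = 0")
    case True
    then show ?thesis using r0 by simp
  next
    case False
    with Suc.prems have s: "0 < s" "s \<le> T" by auto
    have "\<exists>x\<in>{0<..<s}. norm (?r (Suc n) s - ?r (Suc n) 0) \<le> norm ((s - 0) *\<^sub>R B (?r n x))"
    proof (rule mvt_general[OF s(1)])
      show "continuous_on {0..s} (?r (Suc n))"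
        using der by (intro continuous_at_imp_continuous_on ballI has_vector_derivative_continuous)
      show "\<And>x. \<lbrakk>0 < x; x < s\<rbrakk> \<Longrightarrow> (?r (Suc n) has_derivative (\<lambda>h. h *\<^sub>R B (?r n x))) (at x)"
        using der by (simp add: has_vector_derivative_def)
    qed
    then obtain x where x: "0 < x" "x < s" and le: "norm (?r (Suc n) s) \<le> s * norm (B (?r n x))"
      using s(1) r0 by auto
    have "norm (B (?r n x)) \<le> K * (K ^ n * M * x ^ n)"
      using B(2) Suc.IH[of x] x s K by (meson mult_left_mono order_trans atLeastAtMost_iff less_imp_le)
    also have "\<dots> \<le> K * (K ^ n * M * s ^ n)"
    proof -
      have "M \<ge> 0" using M[of s] s norm_ge_zero order_trans[OF norm_ge_zero] by auto
      then show ?thesis using x K by (intro mult_left_mono power_mono) auto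
    qed
    finally have "s * norm (B (?r n x)) \<le> s * (K * (K ^ n * M * s ^ n))"
      using s by (intro mult_left_mono) auto
    with le show ?thesis by (simp add: algebra_simps)
  qed
qed

text \<open>Cauchy-Schwarz against the constant 1, read off from the nonnegative integral of the
  squared deviation from the mean \<open>l\<close>.\<close>

lemma square_integral_le:
  fixes f :: "real \<Rightarrow> real"
  assumes f: "continuous_on {0..T} f" and T: "T > 0"
  shows "(integral {0..T} f)\<^sup>2 \<le> T * integral {0..T} (\<lambda>s. (f s)\<^sup>2)"
proof -
  define l where "l = integral {0..T} f / T"
  have "0 \<le> integral {0..T} (\<lambda>s. (f s - l)\<^sup>2)"
    by (intro integral_nonneg integrable_continuous_real continuous_intros f) auto
  also have "\<dots> = integral {0..T} (\<lambda>s. (f s)\<^sup>2 - 2 * l * f s + l\<^sup>2)"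
    by (simp add: power2_diff algebra_simps)
  also have "\<dots> = integral {0..T} (\<lambda>s. (f s)\<^sup>2) - 2 * l * integral {0..T} f + l\<^sup>2 * T"
    using T by (subst integral_add integral_diff;
      (intro integrable_continuous_real continuous_intros f)?)+ simp
  also have "\<dots> = integral {0..T} (\<lambda>s. (f s)\<^sup>2) - (integral {0..T} f)\<^sup>2 / T"
    using T by (simp add: l_def field_simps power2_eq_square)
  finally show ?thesis using T by (simp add: field_simps)
qed

lemma exp_minus_le:
  fixes u :: real
  assumes u: "0 \<le> u" "u \<le> 1"
  shows "exp (- u) \<le> 1 - u / 2"
proof -
  have "exp (- u) = 1 / exp u" by (simp add: exp_minus divide_inverse)
  also have "\<dots> \<le> 1 / (1 + u)" using u exp_ge_add_one_self[of u] by (intro divide_left_mono) auto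
  also have "\<dots> \<le> 1 - u / 2"
  proof -
    have "u * u \<le> u" using u mult_left_mono[of u 1 u] by simp
    then have "1 \<le> (1 - u / 2) * (1 + u)" by (simp add: algebra_simps)
    then show ?thesis using u by (simp add: pos_divide_le_eq)
  qed
  finally show ?thesis .
qed

text \<open>Abstract form of the pair C_S, C_H on a real Euclidean space: \<open>h\<close> is meant
  as the real part of the weighted inner product, which turns skew-adjointness into
  \<open>skew\<close>. \<open>coercive\<close> stands in for the square root of C_H, and
  \<open>kernel\<close> is hypocoercivity stated with norms. Symmetry of \<open>C\<close> is added
  in a context further below.\<close>

locale hypocoercive_pair =
  fixes h :: "'v::euclidean_space \<Rightarrow> 'v \<Rightarrow> real" and S C :: "'v \<Rightarrow> 'v" and k :: nat
    and \<alpha> \<beta> c \<kappa> :: real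
  assumes h: "bounded_bilinear h" and sym: "h x y = h y x"
    and lower: "\<alpha> * (norm x)\<^sup>2 \<le> h x x" and upper: "h x x \<le> \<beta> * (norm x)\<^sup>2" and \<alpha>: "\<alpha> > 0"
    and S: "linear S" and C: "linear C"
    and skew: "h (S x) x = 0" and coercive: "c * (norm (C x))\<^sup>2 \<le> h (C x) x" and c: "c > 0"
    and kernel: "\<kappa> * norm x \<le> (\<Sum>j\<le>k. norm (C ((S ^^ j) x)))" and \<kappa>: "\<kappa> > 0"
begin

sublocale h: bounded_bilinear h by (rule h)

section \<open>Energy along solutions\<close>

lemma h_nonneg: "h x x \<ge> 0"
  using lower[of x] \<alpha> by (smt (verit) mult_nonneg_nonneg zero_le_power2)

lemma dissipative: "h (C x) x \<ge> 0"
  using coercive[of x] c by (smt (verit) mult_nonneg_nonneg zero_le_power2)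

lemma \<beta>: "\<beta> > 0"
proof -
  obtain b :: 'v where "b \<in> Basis" using nonempty_Basis by blast
  then show ?thesis using lower[of b] upper[of b] \<alpha> by simp
qed

text \<open>The skew part drops out. General coefficients \<open>a\<close>, \<open>b\<close> cover
  the original equation, the one rescaled by |m|, and the zero mode.\<close>

lemma energy_derivative:
  assumes "(Y has_vector_derivative - (a *\<^sub>R S (Y s) + b *\<^sub>R C (Y s))) (at s within A)"
  shows "((\<lambda>s. h (Y s) (Y s)) has_real_derivative - (2 * b * h (C (Y s)) (Y s))) (at s within A)"
proof -
  have "((\<lambda>s. h (Y s) (Y s)) has_vector_derivative
      (h (Y s) (- (a *\<^sub>R S (Y s) + b *\<^sub>R C (Y s))) + h (- (a *\<^sub>R S (Y s) + b *\<^sub>R C (Y s))) (Y s))) (at s within A)"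
    by (rule h.has_vector_derivative[OF assms assms])
  moreover have "h (Y s) (- (a *\<^sub>R S (Y s) + b *\<^sub>R C (Y s))) + h (- (a *\<^sub>R S (Y s) + b *\<^sub>R C (Y s))) (Y s)
      = - (2 * b * h (C (Y s)) (Y s))"
    by (subst (1) sym) (simp add: h.minus_left h.add_left h.diff_left h.scaleR_left skew)
  ultimately show ?thesis by (simp add: has_real_derivative_iff_has_vector_derivative)
qed

lemma energy_integral:
  assumes Y: "\<And>s. (Y has_vector_derivative - (a *\<^sub>R S (Y s) + b *\<^sub>R C (Y s))) (at s)" and "T \<ge> 0"
  shows "((\<lambda>s. 2 * b * h (C (Y s)) (Y s)) has_integral (h (Y 0) (Y 0) - h (Y T) (Y T))) {0..T}"
proof -
  have "((\<lambda>s. - (2 * b * h (C (Y s)) (Y s))) has_integral (h (Y T) (Y T) - h (Y 0) (Y 0))) {0..T}"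
  proof (rule fundamental_theorem_of_calculus[OF assms(2)])
    fix s
    have "((\<lambda>s. h (Y s) (Y s)) has_real_derivative - (2 * b * h (C (Y s)) (Y s))) (at s within {0..T})"
      by (rule energy_derivative[OF has_vector_derivative_at_within[OF Y]])
    then show "((\<lambda>s. h (Y s) (Y s)) has_vector_derivative - (2 * b * h (C (Y s)) (Y s))) (at s within {0..T})"
      by (simp add: has_real_derivative_iff_has_vector_derivative)
  qed
  from has_integral_neg[OF this] show ?thesis by simp
qed

lemma energy_antimono:
  assumes Y: "\<And>s. (Y has_vector_derivative - (a *\<^sub>R S (Y s) + b *\<^sub>R C (Y s))) (at s)"
    and "r \<le> T" "b \<ge> 0"
  shows "h (Y T) (Y T) \<le> h (Y r) (Y r)"
proof (rule DERIV_nonpos_imp_nonincreasing[OF assms(2)])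
  fix s
  show "\<exists>y. ((\<lambda>s. h (Y s) (Y s)) has_real_derivative y) (at s) \<and> y \<le> 0"
    using energy_derivative[OF Y] dissipative assms(3) by (meson mult_nonneg_nonneg neg_le_0_iff_le zero_le_numeral)
qed

lemma solution_norm_le:
  assumes Y: "\<And>s. (Y has_vector_derivative - (a *\<^sub>R S (Y s) + b *\<^sub>R C (Y s))) (at s)"
    and "0 \<le> T" "b \<ge> 0"
  shows "norm (Y T) \<le> sqrt (\<beta> / \<alpha>) * norm (Y 0)"
proof -
  have "\<alpha> * (norm (Y T))\<^sup>2 \<le> \<beta> * (norm (Y 0))\<^sup>2"
    using lower[of "Y T"] upper[of "Y 0"] energy_antimono[OF Y assms(2,3)] by linarith
  then have "(norm (Y T))\<^sup>2 \<le> \<beta> / \<alpha> * (norm (Y 0))\<^sup>2" using \<alpha> by (simp add: field_simps)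
  then have "sqrt ((norm (Y T))\<^sup>2) \<le> sqrt (\<beta> / \<alpha> * (norm (Y 0))\<^sup>2)" by (rule real_sqrt_le_mono)
  then show ?thesis unfolding real_sqrt_mult by simp
qed

lemma solution_continuous:
  assumes Y: "\<And>s. (Y has_vector_derivative Y' s) (at s)"
  shows "continuous_on A Y"
  using Y by (intro continuous_at_imp_continuous_on ballI has_vector_derivative_continuous)

text \<open>For B = \<sigma> S + \<epsilon> C with \<sigma>^2 = 1 one has S = \<sigma> B - \<sigma>
  \<epsilon> C. Words in S are thus controlled by words in B, with constants that depend only on
  bounds for S and C. This transports \<open>kernel\<close> to all C_m / |m| at once.\<close>

lemma uniform_kernel:
  "\<exists>K>0. \<forall>\<sigma> \<epsilon> x. \<bar>\<sigma>\<bar> = 1 \<longrightarrow> \<bar>\<epsilon>\<bar> \<le> 1 \<longrightarrow>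
     norm x \<le> K * (\<Sum>j\<le>k. norm (C (((\<lambda>v. \<sigma> *\<^sub>R S v + \<epsilon> *\<^sub>R C v) ^^ j) x)))"
proof -
  obtain Ks where Ks: "\<And>v. norm (S v) \<le> Ks * norm v" "Ks > 0"
    using linear_bounded_pos[OF S] by blast
  obtain Kc where Kc: "\<And>v. norm (C v) \<le> Kc * norm v" "Kc > 0"
    using linear_bounded_pos[OF C] by blast
  have "\<exists>K>0. \<forall>\<sigma> \<epsilon> x. \<bar>\<sigma>\<bar> = 1 \<longrightarrow> \<bar>\<epsilon>\<bar> \<le> 1 \<longrightarrow>
     norm (C ((S ^^ j) x)) \<le> K * (\<Sum>i\<le>j. norm (C (((\<lambda>v. \<sigma> *\<^sub>R S v + \<epsilon> *\<^sub>R C v) ^^ i) x)))" for j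
  proof -
    obtain K where K: "K > 0" and *: "\<forall>(C :: 'v \<Rightarrow> 'v) B S a b z.
     linear C \<longrightarrow> linear B \<longrightarrow> (\<forall>v. norm (C v) \<le> Kc * norm v) \<longrightarrow> (\<forall>v. norm (B v) \<le> (Ks + Kc) * norm v) \<longrightarrow>
     \<bar>a\<bar> \<le> 1 \<longrightarrow> \<bar>b\<bar> \<le> 1 \<longrightarrow> (\<forall>v. S v = a *\<^sub>R B v + b *\<^sub>R C v) \<longrightarrow>
     norm (C ((S ^^ j) z)) \<le> K * (\<Sum>i\<le>j. norm (C ((B ^^ i) z)))"
      using norm_word_le[OF less_imp_le[OF Kc(2)] add_nonneg_nonneg[OF less_imp_le[OF Ks(2)] less_imp_le[OF Kc(2)]], of j, where 'v='v]
      by (elim exE conjE) (rule that)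
    show ?thesis
    proof (intro exI[of _ K] conjI K allI impI)
      fix \<sigma> \<epsilon> :: real and x assume \<sigma>: "\<bar>\<sigma>\<bar> = 1" and \<epsilon>: "\<bar>\<epsilon>\<bar> \<le> 1"
      let ?B = "\<lambda>v. \<sigma> *\<^sub>R S v + \<epsilon> *\<^sub>R C v"
      have ss: "\<sigma> * \<sigma> = 1" using \<sigma> by (metis abs_mult_self_eq mult_1)
      show "norm (C ((S ^^ j) x)) \<le> K * (\<Sum>i\<le>j. norm (C ((?B ^^ i) x)))"
      proof (rule *[rule_format, where a = \<sigma> and b = "- (\<sigma> * \<epsilon>)"])
        show "linear ?B" by (intro linear_compose_add linear_compose_scale_right S C)
        fix v
        show "norm (?B v) \<le> (Ks + Kc) * norm v"
        proof -
          have "norm (?B v) \<le> \<bar>\<sigma>\<bar> * norm (S v) + \<bar>\<epsilon>\<bar> * norm (C v)"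
            using norm_triangle_ineq by (metis norm_scaleR)
          also have "\<dots> \<le> 1 * (Ks * norm v) + 1 * (Kc * norm v)"
            using \<sigma> \<epsilon> Ks(1) Kc(1) by (intro add_mono mult_mono) auto
          finally show "norm (?B v) \<le> (Ks + Kc) * norm v" by (simp add: algebra_simps)
        qed
        show "S v = \<sigma> *\<^sub>R ?B v + - (\<sigma> * \<epsilon>) *\<^sub>R C v"
          by (simp add: scaleR_add_right ss)
      qed (use C Kc \<sigma> \<epsilon> in \<open>auto simp: abs_mult\<close>)
    qed
  qed
  then obtain K where K: "\<And>j. K j > 0" and *: "\<And>j \<sigma> \<epsilon> x. \<bar>\<sigma>\<bar> = 1 \<Longrightarrow> \<bar>\<epsilon>\<bar> \<le> 1 \<Longrightarrow>
     norm (C ((S ^^ j) x)) \<le> K j * (\<Sum>i\<le>j. norm (C (((\<lambda>v. \<sigma> *\<^sub>R S v + \<epsilon> *\<^sub>R C v) ^^ i) x)))"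
    by metis
  have pos: "(\<Sum>j\<le>k. K j) > 0" using K by (intro sum_pos) auto
  show ?thesis
  proof (intro exI[of _ "(\<Sum>j\<le>k. K j) / \<kappa>"] conjI allI impI)
    show "(\<Sum>j\<le>k. K j) / \<kappa> > 0" using pos \<kappa> by simp
    fix \<sigma> \<epsilon> :: real and x assume \<sigma>: "\<bar>\<sigma>\<bar> = 1" and \<epsilon>: "\<bar>\<epsilon>\<bar> \<le> 1"
    let ?B = "\<lambda>v. \<sigma> *\<^sub>R S v + \<epsilon> *\<^sub>R C v"
    let ?D = "\<Sum>i\<le>k. norm (C ((?B ^^ i) x))"
    have "\<kappa> * norm x \<le> (\<Sum>j\<le>k. norm (C ((S ^^ j) x)))" by (rule kernel)
    also have "\<dots> \<le> (\<Sum>j\<le>k. K j * ?D)"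
    proof (rule sum_mono)
      fix j assume j: "j \<in> {..k}"
      have "norm (C ((S ^^ j) x)) \<le> K j * (\<Sum>i\<le>j. norm (C ((?B ^^ i) x)))" by (rule *[OF \<sigma> \<epsilon>])
      also have "\<dots> \<le> K j * ?D"
        using K[of j] j by (intro mult_left_mono sum_mono2) auto
      finally show "norm (C ((S ^^ j) x)) \<le> K j * ?D" .
    qed
    finally have "\<kappa> * norm x \<le> (\<Sum>j\<le>k. K j) * ?D" by (simp only: sum_distrib_right)
    then show "norm x \<le> (\<Sum>j\<le>k. K j) / \<kappa> * ?D"
      using \<kappa> by (simp only: times_divide_eq_left pos_le_divide_eq mult.commute[of "norm x"])
  qed
qed

text \<open>For small T the Taylor polynomial p of C Y of degree k dominates. Its coefficients are C
  B^j Y(0) / j!; \<open>uniform_kernel\<close> bounds |Y(0)| by them, and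
  \<open>coeff_le_integral_norm\<close> bounds T^(k+1) times them by the integral of |p|. The
  remainder contributes T^(k+2) after integration, one order less, and is absorbed.\<close>

lemma integral_C_lower:
  "\<exists>c1>0. \<exists>T0>0. T0 \<le> 1 \<and> (\<forall>\<sigma> \<epsilon> Y T. \<bar>\<sigma>\<bar> = 1 \<longrightarrow> 0 \<le> \<epsilon> \<longrightarrow> \<epsilon> \<le> 1 \<longrightarrow>
     (\<forall>s. (Y has_vector_derivative - (\<sigma> *\<^sub>R S (Y s) + \<epsilon> *\<^sub>R C (Y s))) (at s)) \<longrightarrow> 0 < T \<longrightarrow> T \<le> T0 \<longrightarrow>
     c1 * T ^ (k + 1) * norm (Y 0) \<le> integral {0..T} (\<lambda>s. norm (C (Y s))))"
proof -
  obtain Ks where Ks: "\<And>v. norm (S v) \<le> Ks * norm v" "Ks > 0"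
    using linear_bounded_pos[OF S] by blast
  obtain Kc where Kc: "\<And>v. norm (C v) \<le> Kc * norm v" "Kc > 0"
    using linear_bounded_pos[OF C] by blast
  obtain K1 where K1: "K1 > 0" and ker: "\<And>\<sigma> \<epsilon> x. \<bar>\<sigma>\<bar> = 1 \<Longrightarrow> \<bar>\<epsilon>\<bar> \<le> 1 \<Longrightarrow>
     norm x \<le> K1 * (\<Sum>j\<le>k. norm (C (((\<lambda>v. \<sigma> *\<^sub>R S v + \<epsilon> *\<^sub>R C v) ^^ j) x)))"
    using uniform_kernel by blast
  obtain K2 where K2: "K2 > 0" and coeff: "\<And>(a :: nat \<Rightarrow> 'v) T j. j \<le> k \<Longrightarrow> T > 0 \<Longrightarrow>
     norm (a j) * T ^ (j + 1) \<le> K2 * integral {0..T} (\<lambda>s. norm (\<Sum>i\<le>k. s ^ i *\<^sub>R a i))"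
    using coeff_le_integral_norm[of k, where 'v='v] by blast
  define Kb where "Kb = Ks + Kc"
  define M where "M = sqrt (\<beta> / \<alpha>)"
  have M0: "M > 0" using \<alpha> \<beta> by (simp add: M_def)
  define L where "L = Kc * (Kb ^ Suc k * M)"
  have L: "L > 0" using Ks Kc M0 by (simp add: L_def Kb_def add_pos_pos)
  define K3 where "K3 = K1 * K2 * (\<Sum>j\<le>k. fact j)"
  have "(\<Sum>j\<le>k. fact j :: real) > 0" by (intro sum_pos) auto
  then have K3: "K3 > 0" using K1 K2 by (simp add: K3_def)
  define c1 where "c1 = 1 / (2 * K3)"
  \<comment> \<open>For T \<le> T0 the remainder term K3 L T^(k+2) |Y(0)| is at most half of T^(k+1)
    |Y(0)|; the other half explains the 2 in \<open>c1\<close>.\<close>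
  define T0 where "T0 = min 1 (1 / (2 * K3 * L))"
  show ?thesis
  proof (rule exI[of _ c1], intro conjI exI[of _ T0] allI impI)
    show "c1 > 0" "T0 > 0" "T0 \<le> 1" using K3 L by (auto simp: c1_def T0_def)
    fix \<sigma> \<epsilon> T :: real and Y
    assume \<sigma>: "\<bar>\<sigma>\<bar> = 1" and \<epsilon>: "0 \<le> \<epsilon>" "\<epsilon> \<le> 1" and T: "0 < T" "T \<le> T0"
      and Y: "\<forall>s. (Y has_vector_derivative - (\<sigma> *\<^sub>R S (Y s) + \<epsilon> *\<^sub>R C (Y s))) (at s)"
    have T1: "T \<le> 1" using T by (simp add: T0_def)
    define B where "B = (\<lambda>v. (- \<sigma>) *\<^sub>R S v + (- \<epsilon>) *\<^sub>R C v)"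
    have B: "linear B" unfolding B_def by (intro linear_compose_add linear_compose_scale_right S C)
    have normB: "norm (B v) \<le> Kb * norm v" for v
    proof -
      have "norm (B v) \<le> \<bar>\<sigma>\<bar> * norm (S v) + \<bar>\<epsilon>\<bar> * norm (C v)"
        unfolding B_def by (rule order_trans[OF norm_triangle_ineq]) simp
      also have "\<dots> \<le> 1 * (Ks * norm v) + 1 * (Kc * norm v)"
        using \<sigma> \<epsilon> Ks(1) Kc(1) by (intro add_mono mult_mono) auto
      finally show ?thesis by (simp add: algebra_simps Kb_def)
    qed
    have YB: "(Y has_vector_derivative B (Y s)) (at s)" for s
      using Y[rule_format, of s] by (simp add: B_def)
    have contY: "continuous_on A Y" for A by (rule solution_continuous[OF YB])
    have contC: "continuous_on A (\<lambda>s. C (Y s))" for A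
      by (rule linear_continuous_on_compose[OF contY C])
    define a where "a j = C ((B ^^ j) (Y 0)) /\<^sub>R fact j" for j
    define p where "p s = (\<Sum>j\<le>k. s ^ j *\<^sub>R a j)" for s :: real
    have contp: "continuous_on A p" for A unfolding p_def by (intro continuous_intros)
    define I where "I = integral {0..T} (\<lambda>s. norm (C (Y s)))"
    have rem: "norm (p s) \<le> norm (C (Y s)) + L * norm (Y 0) * T ^ Suc k" if s: "s \<in> {0..T}" for s
    proof -
      have "norm (Y s - (\<Sum>j<Suc k. (s ^ j / fact j) *\<^sub>R (B ^^ j) (Y 0))) \<le> Kb ^ Suc k * (M * norm (Y 0)) * s ^ Suc k"
        by (rule norm_taylor_remainder_le[OF B normB YB _ s])
          (use solution_norm_le[OF Y[rule_format]] \<epsilon> Ks Kc in \<open>auto simp: M_def Kb_def\<close>)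
      then have "Kc * norm (Y s - (\<Sum>j<Suc k. (s ^ j / fact j) *\<^sub>R (B ^^ j) (Y 0))) \<le> Kc * (Kb ^ Suc k * (M * norm (Y 0)) * s ^ Suc k)"
        using Kc by (intro mult_left_mono) auto
      also have "\<dots> = L * norm (Y 0) * s ^ Suc k" by (simp add: L_def)
      also have "\<dots> \<le> L * norm (Y 0) * T ^ Suc k" using s L by (intro mult_left_mono power_mono) auto
      finally have "norm (C (Y s - (\<Sum>j<Suc k. (s ^ j / fact j) *\<^sub>R (B ^^ j) (Y 0)))) \<le> L * norm (Y 0) * T ^ Suc k"
        using Kc(1) order_trans by blast
      moreover have "C (Y s - (\<Sum>j<Suc k. (s ^ j / fact j) *\<^sub>R (B ^^ j) (Y 0))) = C (Y s) - p s"
        unfolding lessThan_Suc_atMost p_def a_def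
        by (simp add: linear_diff[OF C] linear_sum[OF C] linear_scale[OF C] divide_inverse)
      ultimately show ?thesis
        using norm_triangle_ineq2[of "p s" "C (Y s)"] by (simp add: norm_minus_commute)
    qed
    have "integral {0..T} (\<lambda>s. norm (p s)) \<le> integral {0..T} (\<lambda>s. norm (C (Y s)) + L * norm (Y 0) * T ^ Suc k)"
      by (rule integral_le) (use rem in \<open>auto intro!: integrable_continuous_real continuous_intros contp contC\<close>)
    also have "\<dots> = I + L * norm (Y 0) * T ^ (k + 2)"
      using T unfolding I_def
      by (subst integral_add) (auto intro!: integrable_continuous_real continuous_intros contC)
    finally have pI: "integral {0..T} (\<lambda>s. norm (p s)) \<le> I + L * norm (Y 0) * T ^ (k + 2)" .
    \<comment> \<open>The minus sign of the equation sits in B, hence the coefficients -\<sigma> and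
      -\<epsilon>; for this reason \<open>uniform_kernel\<close> restricts only absolute
      values.\<close>
    have "norm (Y 0) * T ^ (k + 1) \<le> K1 * (\<Sum>j\<le>k. norm (C ((B ^^ j) (Y 0)))) * T ^ (k + 1)"
      using ker[of "- \<sigma>" "- \<epsilon>" "Y 0"] \<sigma> \<epsilon> T unfolding B_def by (intro mult_right_mono) auto
    also have "\<dots> = K1 * (\<Sum>j\<le>k. fact j * (norm (a j) * T ^ (k + 1)))"
    proof -
      have "norm (C ((B ^^ j) (Y 0))) = fact j * norm (a j)" for j by (simp add: a_def)
      then show ?thesis by (simp add: sum_distrib_left sum_distrib_right mult_ac)
    qed
    also have "\<dots> \<le> K1 * (\<Sum>j\<le>k. fact j * (K2 * integral {0..T} (\<lambda>s. norm (p s))))"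
    proof (intro mult_left_mono sum_mono)
      fix j assume j: "j \<in> {..k}"
      have "norm (a j) * T ^ (k + 1) \<le> norm (a j) * T ^ (j + 1)"
        using T T1 j by (intro mult_left_mono power_decreasing) auto
      also have "\<dots> \<le> K2 * integral {0..T} (\<lambda>s. norm (p s))"
        unfolding p_def using coeff j T by auto
      finally show "norm (a j) * T ^ (k + 1) \<le> K2 * integral {0..T} (\<lambda>s. norm (p s))" .
    qed (use K1 in auto)
    also have "\<dots> = K3 * integral {0..T} (\<lambda>s. norm (p s))"
      by (simp add: K3_def sum_distrib_left sum_distrib_right mult_ac)
    also have "\<dots> \<le> K3 * (I + L * norm (Y 0) * T ^ (k + 2))"
      using pI K3 by (intro mult_left_mono) auto
    also have "\<dots> = K3 * I + (K3 * L * T) * (norm (Y 0) * T ^ (k + 1))" by (simp add: algebra_simps)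
    also have "\<dots> \<le> K3 * I + 1/2 * (norm (Y 0) * T ^ (k + 1))"
    proof -
      have "T * (2 * K3 * L) \<le> 1 / (2 * K3 * L) * (2 * K3 * L)"
        using T L K3 by (intro mult_right_mono) (auto simp: T0_def)
      then have "K3 * L * T \<le> 1 / 2" using L K3 by (simp add: algebra_simps)
      then show ?thesis using T by (intro add_left_mono mult_right_mono) auto
    qed
    finally have "1/2 * (norm (Y 0) * T ^ (k + 1)) \<le> K3 * I" by simp
    then show "c1 * T ^ (k + 1) * norm (Y 0) \<le> integral {0..T} (\<lambda>s. norm (C (Y s)))"
      using K3 by (simp add: c1_def I_def field_simps)
  qed
qed

text \<open>Cauchy-Schwarz squares the L^1 bound T^(k+1) and divides by T, which produces the
  exponent 2k+1. The factor \<epsilon> is the weight of the dissipation in the rescaled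
  equation.\<close>

lemma short_time_decay:
  "\<exists>c1>0. c1 \<le> 1 \<and> (\<forall>\<sigma> \<epsilon> Y T. \<bar>\<sigma>\<bar> = 1 \<longrightarrow> 0 \<le> \<epsilon> \<longrightarrow> \<epsilon> \<le> 1 \<longrightarrow>
     (\<forall>s. (Y has_vector_derivative - (\<sigma> *\<^sub>R S (Y s) + \<epsilon> *\<^sub>R C (Y s))) (at s)) \<longrightarrow> 0 \<le> T \<longrightarrow> T \<le> 1 \<longrightarrow>
     h (Y T) (Y T) \<le> (1 - \<epsilon> * c1 * T ^ (2 * k + 1)) * h (Y 0) (Y 0))"
proof -
  obtain c0 T0 where c0: "c0 > 0" and T0: "T0 > 0" "T0 \<le> 1" and *: "\<And>\<sigma> \<epsilon> Y T. \<bar>\<sigma>\<bar> = 1 \<Longrightarrow> 0 \<le> \<epsilon> \<Longrightarrow> \<epsilon> \<le> 1 \<Longrightarrow>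
     (\<forall>s. (Y has_vector_derivative - (\<sigma> *\<^sub>R S (Y s) + \<epsilon> *\<^sub>R C (Y s))) (at s)) \<Longrightarrow> 0 < T \<Longrightarrow> T \<le> T0 \<Longrightarrow>
     c0 * T ^ (k + 1) * norm (Y 0) \<le> integral {0..T} (\<lambda>s. norm (C (Y s)))"
    using integral_C_lower by blast
  \<comment> \<open>2 c comes from the energy identity with \<open>coercive\<close>, c0 from the
    integral bound, and \<beta> converts |Y(0)|^2 into energy. The factor T0^(2k+1) in
    \<open>c1\<close> extends the estimate from [0, T0] to [0, 1], on which the energy does not
    increase.\<close>
  define c2 where "c2 = min 1 (2 * c * c0\<^sup>2 / \<beta>)"
  define c1 where "c1 = c2 * T0 ^ (2 * k + 1)"
  have c2: "c2 > 0" "c2 \<le> 1" using c c0 \<beta> by (auto simp: c2_def)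
  have T01: "T0 ^ (2 * k + 1) \<le> 1" using T0 by (intro power_le_one) auto
  have c12: "c1 \<le> c2" using c2 T01 mult_left_mono[OF T01, of c2] by (simp add: c1_def)
  show ?thesis
  proof (intro exI[of _ c1] conjI allI impI)
    show "c1 > 0" using c2 T0 by (simp add: c1_def)
    show "c1 \<le> 1" using c12 c2 by simp
    fix \<sigma> \<epsilon> T :: real and Y
    assume \<sigma>: "\<bar>\<sigma>\<bar> = 1" and \<epsilon>: "0 \<le> \<epsilon>" "\<epsilon> \<le> 1" and T: "0 \<le> T" "T \<le> 1"
      and Y: "\<forall>s. (Y has_vector_derivative - (\<sigma> *\<^sub>R S (Y s) + \<epsilon> *\<^sub>R C (Y s))) (at s)"
    have contC: "continuous_on A (\<lambda>s. C (Y s))" for A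
      by (rule linear_continuous_on_compose[OF solution_continuous[OF Y[rule_format]] C])
    have main: "h (Y T) (Y T) \<le> (1 - \<epsilon> * c2 * T ^ (2 * k + 1)) * h (Y 0) (Y 0)" if T: "0 < T" "T \<le> T0" for T
    proof -
      have "(c0 * T ^ (k + 1) * norm (Y 0))\<^sup>2 \<le> (integral {0..T} (\<lambda>s. norm (C (Y s))))\<^sup>2"
        using *[OF \<sigma> \<epsilon> Y T] c0 T by (intro power_mono) auto
      also have "\<dots> \<le> T * integral {0..T} (\<lambda>s. (norm (C (Y s)))\<^sup>2)"
        by (rule square_integral_le) (auto intro!: continuous_intros contC T)
      also have "(c0 * T ^ (k + 1) * norm (Y 0))\<^sup>2 = T * (c0\<^sup>2 * T ^ (2 * k + 1) * (norm (Y 0))\<^sup>2)"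
        by (simp add: power_mult_distrib power_add mult_2 power2_eq_square)
      finally have "c0\<^sup>2 * T ^ (2 * k + 1) * (norm (Y 0))\<^sup>2 \<le> integral {0..T} (\<lambda>s. (norm (C (Y s)))\<^sup>2)"
        using T by (subst (asm) mult_le_cancel_left_pos) auto
      then have i1: "2 * \<epsilon> * c * (c0\<^sup>2 * T ^ (2 * k + 1) * (norm (Y 0))\<^sup>2) \<le> 2 * \<epsilon> * c * integral {0..T} (\<lambda>s. (norm (C (Y s)))\<^sup>2)"
        using \<epsilon> c by (intro mult_left_mono) auto
      have i2: "2 * \<epsilon> * c * integral {0..T} (\<lambda>s. (norm (C (Y s)))\<^sup>2) \<le> h (Y 0) (Y 0) - h (Y T) (Y T)"
      proof (rule has_integral_le)
        show "((\<lambda>s. 2 * \<epsilon> * c * (norm (C (Y s)))\<^sup>2) has_integral 2 * \<epsilon> * c * integral {0..T} (\<lambda>s. (norm (C (Y s)))\<^sup>2)) {0..T}"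
          by (intro has_integral_mult_right integrable_integral integrable_continuous_real continuous_intros contC)
        show "((\<lambda>s. 2 * \<epsilon> * h (C (Y s)) (Y s)) has_integral (h (Y 0) (Y 0) - h (Y T) (Y T))) {0..T}"
          using T by (intro energy_integral[OF Y[rule_format]]) auto
        show "2 * \<epsilon> * c * (norm (C (Y s)))\<^sup>2 \<le> 2 * \<epsilon> * h (C (Y s)) (Y s)" for s
          using mult_left_mono[OF coercive[of "Y s"], of "2 * \<epsilon>"] \<epsilon> by (simp add: mult.assoc)
      qed
      have "\<epsilon> * c2 * T ^ (2 * k + 1) * h (Y 0) (Y 0) \<le> \<epsilon> * (2 * c * c0\<^sup>2 / \<beta>) * T ^ (2 * k + 1) * (\<beta> * (norm (Y 0))\<^sup>2)"
        using \<epsilon> T c \<beta> c2 by (intro mult_mono upper h_nonneg mult_nonneg_nonneg) (auto simp: c2_def)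
      also have "\<dots> = 2 * \<epsilon> * c * (c0\<^sup>2 * T ^ (2 * k + 1) * (norm (Y 0))\<^sup>2)"
        using \<beta> by (simp add: field_simps)
      finally show ?thesis using i1 i2 by (simp add: algebra_simps)
    qed
    show "h (Y T) (Y T) \<le> (1 - \<epsilon> * c1 * T ^ (2 * k + 1)) * h (Y 0) (Y 0)"
    proof (cases "T = 0 \<or> T > T0")
      case False
      then have "h (Y T) (Y T) \<le> (1 - \<epsilon> * c2 * T ^ (2 * k + 1)) * h (Y 0) (Y 0)" using main T by auto
      also have "\<dots> \<le> (1 - \<epsilon> * c1 * T ^ (2 * k + 1)) * h (Y 0) (Y 0)"
        using c12 \<epsilon> T by (intro mult_right_mono h_nonneg diff_left_mono mult_left_mono) auto
      finally show ?thesis .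
    next
      case True
      then show ?thesis
      proof
        assume "T > T0"
        then have "h (Y T) (Y T) \<le> h (Y T0) (Y T0)" using energy_antimono[OF Y[rule_format], of T0 T] \<epsilon> by simp
        also have "\<dots> \<le> (1 - \<epsilon> * c2 * T0 ^ (2 * k + 1)) * h (Y 0) (Y 0)" using main T0 by auto
        also have "\<dots> \<le> (1 - \<epsilon> * c1 * T ^ (2 * k + 1)) * h (Y 0) (Y 0)"
        proof (intro mult_right_mono h_nonneg diff_left_mono)
          have "T ^ (2 * k + 1) \<le> 1" using T by (intro power_le_one) auto
          then have "\<epsilon> * c1 * T ^ (2 * k + 1) \<le> \<epsilon> * c1 * 1"
            using \<epsilon> \<open>c1 > 0\<close> by (intro mult_left_mono) auto
          then show "\<epsilon> * c1 * T ^ (2 * k + 1) \<le> \<epsilon> * c2 * T0 ^ (2 * k + 1)" by (simp add: c1_def)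
        qed
        finally show ?thesis .
      qed simp
    qed
  qed
qed

text \<open>The equation is autonomous, so every unit time interval contributes the same
  factor.\<close>

lemma long_time_decay:
  assumes c1: "0 < c1" "c1 \<le> 1" and \<epsilon>: "0 \<le> \<epsilon>" "\<epsilon> \<le> 1" and \<sigma>: "\<bar>\<sigma>\<bar> = 1"
    and short: "\<And>Y. (\<forall>s. (Y has_vector_derivative - (\<sigma> *\<^sub>R S (Y s) + \<epsilon> *\<^sub>R C (Y s))) (at s)) \<Longrightarrow>
      h (Y 1) (Y 1) \<le> (1 - \<epsilon> * c1) * h (Y 0) (Y 0)"
    and Y: "\<forall>s. (Y has_vector_derivative - (\<sigma> *\<^sub>R S (Y s) + \<epsilon> *\<^sub>R C (Y s))) (at s)"
  shows "h (Y (real N)) (Y (real N)) \<le> (1 - \<epsilon> * c1) ^ N * h (Y 0) (Y 0)"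
proof (induction N)
  case (Suc N)
  have "\<forall>s. ((\<lambda>s. Y (s + real N)) has_vector_derivative - (\<sigma> *\<^sub>R S (Y (s + real N)) + \<epsilon> *\<^sub>R C (Y (s + real N)))) (at s)"
  proof
    fix s
    have "(Y \<circ> (\<lambda>s. s + real N) has_vector_derivative 1 *\<^sub>R - (\<sigma> *\<^sub>R S (Y (s + real N)) + \<epsilon> *\<^sub>R C (Y (s + real N)))) (at s)"
      by (rule vector_diff_chain_at) (use Y in \<open>auto intro!: derivative_eq_intros\<close>)
    then show "((\<lambda>s. Y (s + real N)) has_vector_derivative - (\<sigma> *\<^sub>R S (Y (s + real N)) + \<epsilon> *\<^sub>R C (Y (s + real N)))) (at s)"
      by (simp add: o_def)
  qed
  from short[OF this] have "h (Y (real (Suc N))) (Y (real (Suc N))) \<le> (1 - \<epsilon> * c1) * h (Y (real N)) (Y (real N))"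
    by (simp add: add.commute)
  also have "\<dots> \<le> (1 - \<epsilon> * c1) * ((1 - \<epsilon> * c1) ^ N * h (Y 0) (Y 0))"
    using Suc \<epsilon> c1 mult_le_one[of \<epsilon> c1] by (intro mult_left_mono) auto
  finally show ?case by (simp add: mult.assoc)
qed simp

text \<open>In the time |m| t the equation has \<epsilon> = 1/|m|. If |m| t \<le> 1, the loss is c1
  |m|^(2k) t^(2k+1), at least c1 t^(2k+1). Otherwise there are N \<ge> |m| t / 2 unit steps, each
  with factor 1 - c1/|m|; the product is at most exp(-c1 t / 2) \<le> 1 - c1 t / 4, and t \<ge>
  t^(2k+1) on [0, 1]. The second case dictates the constant c1 / 4.\<close>

theorem mode_decay:
  "\<exists>c2>0. c2 \<le> 1 \<and> (\<forall>m y t. m \<noteq> (0::int) \<longrightarrow>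
     (\<forall>s. (y has_vector_derivative - (of_int m *\<^sub>R S (y s) + C (y s))) (at s)) \<longrightarrow> 0 \<le> t \<longrightarrow> t \<le> 1 \<longrightarrow>
     h (y t) (y t) \<le> (1 - c2 * t ^ (2 * k + 1)) * h (y 0) (y 0))"
proof -
  obtain c1 where c1: "c1 > 0" "c1 \<le> 1" and short: "\<And>\<sigma> \<epsilon> Y T. \<bar>\<sigma>\<bar> = 1 \<Longrightarrow> 0 \<le> \<epsilon> \<Longrightarrow> \<epsilon> \<le> 1 \<Longrightarrow>
     (\<forall>s. (Y has_vector_derivative - (\<sigma> *\<^sub>R S (Y s) + \<epsilon> *\<^sub>R C (Y s))) (at s)) \<Longrightarrow> 0 \<le> T \<Longrightarrow> T \<le> 1 \<Longrightarrow>
     h (Y T) (Y T) \<le> (1 - \<epsilon> * c1 * T ^ (2 * k + 1)) * h (Y 0) (Y 0)"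
    using short_time_decay by blast
  show ?thesis
  proof (intro exI[of _ "c1 / 4"] conjI allI impI)
    fix m :: int and y and t :: real
    assume m: "m \<noteq> 0" and t: "0 \<le> t" "t \<le> 1"
      and y: "\<forall>s. (y has_vector_derivative - (of_int m *\<^sub>R S (y s) + C (y s))) (at s)"
    define \<mu> where "\<mu> = real_of_int \<bar>m\<bar>"
    define \<sigma> where "\<sigma> = real_of_int (sgn m)"
    have \<mu>: "\<mu> \<ge> 1" using m unfolding \<mu>_def by linarith
    have \<sigma>: "\<bar>\<sigma>\<bar> = 1" using m by (simp add: \<sigma>_def sgn_if)
    have m\<mu>: "real_of_int m = \<mu> * \<sigma>" unfolding \<mu>_def \<sigma>_def of_int_mult[symmetric] by (simp only: abs_mult_sgn)
    define Y where "Y s = y (s / \<mu>)" for s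
    have Y: "\<forall>s. (Y has_vector_derivative - (\<sigma> *\<^sub>R S (Y s) + (1 / \<mu>) *\<^sub>R C (Y s))) (at s)"
    proof
      fix s
      have "(y \<circ> (\<lambda>s. s / \<mu>) has_vector_derivative (1 / \<mu>) *\<^sub>R - (of_int m *\<^sub>R S (y (s / \<mu>)) + C (y (s / \<mu>)))) (at s)"
        by (rule vector_diff_chain_at) (use y \<mu> in \<open>auto intro!: derivative_eq_intros simp: has_real_derivative_iff_has_vector_derivative[symmetric]\<close>)
      moreover have "(1 / \<mu>) *\<^sub>R - (of_int m *\<^sub>R S (y (s / \<mu>)) + C (y (s / \<mu>))) = - (\<sigma> *\<^sub>R S (Y s) + (1 / \<mu>) *\<^sub>R C (Y s))"
        using \<mu> by (simp add: m\<mu> Y_def scaleR_diff_right)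
      ultimately show "(Y has_vector_derivative - (\<sigma> *\<^sub>R S (Y s) + (1 / \<mu>) *\<^sub>R C (Y s))) (at s)"
        by (simp add: Y_def[abs_def] o_def)
    qed
    have yY: "y t = Y (\<mu> * t)" "y 0 = Y 0" using \<mu> by (auto simp: Y_def)
    have e: "0 \<le> 1 / \<mu>" "1 / \<mu> \<le> 1" using \<mu> by auto
    show "h (y t) (y t) \<le> (1 - c1 / 4 * t ^ (2 * k + 1)) * h (y 0) (y 0)"
    proof (cases "\<mu> * t \<le> 1")
      case True
      have "h (y t) (y t) \<le> (1 - 1 / \<mu> * c1 * (\<mu> * t) ^ (2 * k + 1)) * h (y 0) (y 0)"
        unfolding yY by (rule short[OF \<sigma> e Y]) (use True t \<mu> in auto)
      also have "\<dots> \<le> (1 - c1 / 4 * t ^ (2 * k + 1)) * h (y 0) (y 0)"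
      proof (intro mult_right_mono h_nonneg diff_left_mono)
        have "c1 / 4 * t ^ (2 * k + 1) \<le> c1 * t ^ (2 * k + 1) * 1"
          using c1 t by (simp add: mult_right_mono)
        also have "\<dots> \<le> c1 * t ^ (2 * k + 1) * \<mu> ^ (2 * k)"
          using c1 t \<mu> by (intro mult_left_mono one_le_power) auto
        also have "\<dots> = 1 / \<mu> * c1 * (\<mu> * t) ^ (2 * k + 1)"
          using \<mu> by (simp add: power_mult_distrib)
        finally show "c1 / 4 * t ^ (2 * k + 1) \<le> 1 / \<mu> * c1 * (\<mu> * t) ^ (2 * k + 1)" .
      qed
      finally show ?thesis .
    next
      case False
      define N where "N = nat \<lfloor>\<mu> * t\<rfloor>"
      have N: "real N \<le> \<mu> * t" "\<mu> * t \<le> 2 * real N"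
      proof -
        have "real N = of_int \<lfloor>\<mu> * t\<rfloor>" using False by (simp add: N_def)
        moreover have "\<lfloor>\<mu> * t\<rfloor> \<ge> 1" using False by linarith
        ultimately show "real N \<le> \<mu> * t" "\<mu> * t \<le> 2 * real N" by linarith+
      qed
      define x where "x = 1 / \<mu> * c1"
      have x: "0 \<le> x" "x \<le> 1" using e c1 mult_le_one[of "1 / \<mu>" c1] by (auto simp: x_def)
      have "h (y t) (y t) \<le> h (Y (real N)) (Y (real N))"
        unfolding yY by (rule energy_antimono[OF Y[rule_format] N(1) e(1)])
      also have "\<dots> \<le> (1 - 1 / \<mu> * c1) ^ N * h (Y 0) (Y 0)"
        by (rule long_time_decay[OF c1 e \<sigma> _ Y]) (use short[OF \<sigma> e, of _ 1] in auto)
      also have "\<dots> \<le> (1 - c1 / 4 * t ^ (2 * k + 1)) * h (y 0) (y 0)"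
        unfolding yY(2)
      proof (rule mult_right_mono[OF _ h_nonneg])
        have "1 - x \<le> exp (- x)" using exp_ge_add_one_self[of "- x"] by simp
        then have "(1 - x) ^ N \<le> exp (- x) ^ N" using x by (intro power_mono) auto
        also have "\<dots> = exp (- (real N * x))" by (simp add: exp_of_nat_mult[symmetric])
        also have "\<dots> \<le> exp (- (c1 * t / 2))"
        proof -
          have "c1 / \<mu> * (\<mu> * t) \<le> c1 / \<mu> * (2 * real N)" using N c1 \<mu> by (intro mult_left_mono) auto
          then have "c1 * t / 2 \<le> real N * x" using \<mu> by (simp add: x_def field_simps)
          then show ?thesis by simp
        qed
        also have "\<dots> \<le> 1 - c1 * t / 4"
          using exp_minus_le[of "c1 * t / 2"] c1 t mult_le_one[of c1 t] by simp
        also have "\<dots> \<le> 1 - c1 / 4 * t ^ (2 * k + 1)"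
        proof -
          have "t ^ (2 * k + 1) \<le> t ^ 1" using t by (intro power_decreasing) auto
          then have "c1 / 4 * t ^ (2 * k + 1) \<le> c1 / 4 * t" using c1 by (intro mult_left_mono) auto
          then show ?thesis by simp
        qed
        finally show "(1 - 1 / \<mu> * c1) ^ N \<le> 1 - c1 / 4 * t ^ (2 * k + 1)" by (simp add: x_def)
      qed
      finally show ?thesis .
    qed
  qed (use c1 in auto)
qed

text \<open>The weights cancel the growth of the powers: with C_m = |m| B the summands become h(C
  B^j x, B^j x), for which \<open>uniform_kernel\<close> and \<open>coercive\<close> give a bound
  free of m. Cauchy-Schwarz over the k+1 summands passes from a sum of norms to a sum of
  squares.\<close>

lemma weighted_form_coercive:
  "\<exists>\<gamma>>0. \<forall>m x. m \<noteq> (0::int) \<longrightarrow>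
     \<gamma> * (norm x)\<^sup>2 \<le> (\<Sum>j\<le>k. 1 / of_int m ^ (2 * j) *
       h (C (((\<lambda>v. of_int m *\<^sub>R S v + C v) ^^ j) x)) (((\<lambda>v. of_int m *\<^sub>R S v + C v) ^^ j) x))"
proof -
  obtain K where K: "K > 0" and ker: "\<And>\<sigma> \<epsilon> x. \<bar>\<sigma>\<bar> = 1 \<Longrightarrow> \<bar>\<epsilon>\<bar> \<le> 1 \<Longrightarrow>
     norm x \<le> K * (\<Sum>j\<le>k. norm (C (((\<lambda>v. \<sigma> *\<^sub>R S v + \<epsilon> *\<^sub>R C v) ^^ j) x)))"
    using uniform_kernel by blast
  show ?thesis
  proof (intro exI[of _ "c / (K\<^sup>2 * (real k + 1))"] conjI allI impI)
    show "c / (K\<^sup>2 * (real k + 1)) > 0" using c K by simp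
    fix m :: int and x assume m: "m \<noteq> 0"
    define \<mu> where "\<mu> = real_of_int \<bar>m\<bar>"
    define \<sigma> where "\<sigma> = real_of_int (sgn m)"
    have \<mu>: "\<mu> \<ge> 1" using m unfolding \<mu>_def by linarith
    have \<sigma>: "\<bar>\<sigma>\<bar> = 1" using m by (simp add: \<sigma>_def sgn_if)
    have m\<mu>: "real_of_int m = \<mu> * \<sigma>" unfolding \<mu>_def \<sigma>_def of_int_mult[symmetric] by (simp only: abs_mult_sgn)
    define B where "B = (\<lambda>v. \<sigma> *\<^sub>R S v + (1 / \<mu>) *\<^sub>R C v)"
    have B: "linear B" unfolding B_def by (intro linear_compose_add linear_compose_scale_right S C)
    let ?w = "\<lambda>j. (B ^^ j) x"
    have pow: "((\<lambda>v. of_int m *\<^sub>R S v + C v) ^^ j) x = \<mu> ^ j *\<^sub>R ?w j" for j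
    proof (induction j)
      case (Suc j)
      have "of_int m *\<^sub>R S v + C v = \<mu> *\<^sub>R B v" for v
        using \<mu> by (simp add: B_def m\<mu> scaleR_add_right)
      then show ?case using Suc by (simp add: linear_scale[OF B] mult.commute)
    qed simp
    have m2: "real_of_int m ^ (2 * j) = \<mu> ^ (2 * j)" for j by (simp add: \<mu>_def power_mult)
    have summand: "1 / of_int m ^ (2 * j) * h (C (\<mu> ^ j *\<^sub>R ?w j)) (\<mu> ^ j *\<^sub>R ?w j) = h (C (?w j)) (?w j)" for j
      unfolding m2 using \<mu>
      by (simp add: linear_scale[OF C] h.scaleR_left h.scaleR_right mult_2 power_add)
    let ?D = "\<Sum>j\<le>k. norm (C (?w j))"
    have "norm x \<le> K * ?D" unfolding B_def by (rule ker) (use \<sigma> \<mu> in auto)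
    then have "(norm x)\<^sup>2 \<le> (K * ?D)\<^sup>2" by (intro power_mono) auto
    also have "\<dots> = K\<^sup>2 * ?D\<^sup>2" by (simp add: power_mult_distrib)
    also have "?D\<^sup>2 \<le> (\<Sum>j\<le>k. (norm (C (?w j)))\<^sup>2) * (real k + 1)"
      using Cauchy_Schwarz_ineq_sum[of "\<lambda>j. norm (C (?w j))" "\<lambda>_. 1" "{..k}"] by (simp add: add.commute)
    finally have le: "(norm x)\<^sup>2 \<le> K\<^sup>2 * (real k + 1) * (\<Sum>j\<le>k. (norm (C (?w j)))\<^sup>2)"
      using K by (simp add: mult_left_mono mult_ac)
    define P where "P = K\<^sup>2 * (real k + 1)"
    have P: "P > 0" using K by (simp add: P_def)
    from le have "c * (norm x)\<^sup>2 \<le> c * (P * (\<Sum>j\<le>k. (norm (C (?w j)))\<^sup>2))"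
      using c unfolding P_def by (intro mult_left_mono) auto
    then have "c / (K\<^sup>2 * (real k + 1)) * (norm x)\<^sup>2 \<le> c * (\<Sum>j\<le>k. (norm (C (?w j)))\<^sup>2)"
      using P unfolding P_def[symmetric] by (simp add: pos_divide_le_eq mult_ac)
    also have "\<dots> \<le> (\<Sum>j\<le>k. h (C (?w j)) (?w j))"
      unfolding sum_distrib_left by (intro sum_mono coercive)
    finally show "c / (K\<^sup>2 * (real k + 1)) * (norm x)\<^sup>2 \<le> (\<Sum>j\<le>k. 1 / of_int m ^ (2 * j) *
       h (C (((\<lambda>v. of_int m *\<^sub>R S v + C v) ^^ j) x)) (((\<lambda>v. of_int m *\<^sub>R S v + C v) ^^ j) x))"
      unfolding pow summand .
  qed
qed

text \<open>\<open>C\<close> is injective on the \<open>h\<close>-orthogonal complement of its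
  kernel, hence bounded below there by finite dimension; \<open>coercive\<close> turns this into a
  bound for the form.\<close>

lemma coercive_on_complement:
  "\<exists>\<gamma>>0. \<forall>x. (\<forall>v. C v = 0 \<longrightarrow> h v x = 0) \<longrightarrow> \<gamma> * (norm x)\<^sup>2 \<le> h (C x) x"
proof -
  let ?U = "{x. \<forall>v. C v = 0 \<longrightarrow> h v x = 0}"
  have sub: "subspace ?U" by (auto simp: subspace_def h.zero_right h.add_right h.scaleR_right)
  have "\<exists>e>0. \<forall>x\<in>?U. e * norm x \<le> norm (C x)"
  proof (rule injective_imp_isometric)
    show "closed ?U" using sub by (rule closed_subspace)
    show "subspace ?U" by (rule sub)
    show "bounded_linear C" using C by (simp add: linear_conv_bounded_linear)
    show "\<forall>x\<in>?U. C x = 0 \<longrightarrow> x = 0"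
    proof (intro ballI impI)
      fix x assume "x \<in> ?U" "C x = 0"
      then have "h x x = 0" by blast
      then show "x = 0" using lower[of x] \<alpha> by (simp add: mult_le_0_iff)
    qed
  qed
  then obtain e where e: "e > 0" and le: "\<And>x. x \<in> ?U \<Longrightarrow> e * norm x \<le> norm (C x)" by blast
  show ?thesis
  proof (intro exI[of _ "c * e\<^sup>2"] conjI allI impI)
    fix x assume "\<forall>v. C v = 0 \<longrightarrow> h v x = 0"
    then have "(e * norm x)\<^sup>2 \<le> (norm (C x))\<^sup>2" using le[of x] e by (intro power_mono) auto
    then have "c * (e * norm x)\<^sup>2 \<le> c * (norm (C x))\<^sup>2" using c by (intro mult_left_mono) auto
    then show "c * e\<^sup>2 * (norm x)\<^sup>2 \<le> h (C x) x"
      using coercive[of x] by (simp add: power_mult_distrib mult.assoc)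
  qed (use c e in auto)
qed

section \<open>Self-adjoint \<open>C\<close>: the zero mode and optimality of the exponent\<close>

context
  assumes symC: "h (C x) y = h x (C y)"
begin

lemma zero_mode_orthogonal:
  assumes y: "\<And>s. (y has_vector_derivative - C (y s)) (at s)" and v: "C v = 0" and "h v (y 0) = 0"
  shows "h v (y t) = 0"
proof -
  have "((\<lambda>s. h v (y s)) has_derivative (\<lambda>_. 0)) (at s within UNIV)" for s
  proof -
    have "((\<lambda>s. h v (y s)) has_vector_derivative (h v (- C (y s)) + h 0 (y s))) (at s)"
      by (rule h.has_vector_derivative[OF has_vector_derivative_const y])
    then have "((\<lambda>s. h v (y s)) has_vector_derivative 0) (at s)"
      by (simp add: h.minus_right h.zero_left symC[symmetric] v)
    then show ?thesis by (simp add: has_vector_derivative_def)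
  qed
  from has_derivative_zero_constant[OF convex_UNIV this] obtain a where "\<And>s. h v (y s) = a" by blast
  then show ?thesis using assms(3) by metis
qed

text \<open>Off the kernel there is plain exponential decay, i.e. a loss linear in t. It is weakened
  to t^(2k+1) to match the other modes.\<close>

lemma zero_mode_decay:
  "\<exists>c2>0. c2 \<le> 1 \<and> (\<forall>y t. (\<forall>s. (y has_vector_derivative - C (y s)) (at s)) \<longrightarrow>
     (\<forall>v. C v = 0 \<longrightarrow> h v (y 0) = 0) \<longrightarrow> 0 \<le> t \<longrightarrow> t \<le> 1 \<longrightarrow>
     h (y t) (y t) \<le> (1 - c2 * t ^ (2 * k + 1)) * h (y 0) (y 0))"
proof -
  obtain \<gamma> where \<gamma>: "\<gamma> > 0" and coer: "\<And>x. (\<forall>v. C v = 0 \<longrightarrow> h v x = 0) \<Longrightarrow> \<gamma> * (norm x)\<^sup>2 \<le> h (C x) x"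
    using coercive_on_complement by blast
  \<comment> \<open>2 \<gamma> / \<beta> is a decay rate of the energy; the bound by 1 keeps g t
    within the range of \<open>exp_minus_le\<close>.\<close>
  define g where "g = min 1 (2 * \<gamma> / \<beta>)"
  have g: "0 < g" "g \<le> 1" "g \<le> 2 * \<gamma> / \<beta>" using \<gamma> \<beta> by (auto simp: g_def)
  show ?thesis
  proof (intro exI[of _ "g / 2"] conjI allI impI)
    fix y and t :: real
    assume y: "\<forall>s. (y has_vector_derivative - C (y s)) (at s)" and y0: "\<forall>v. C v = 0 \<longrightarrow> h v (y 0) = 0"
      and t: "0 \<le> t" "t \<le> 1"
    let ?f = "\<lambda>s. exp (g * s) * h (y s) (y s)"
    have "?f t \<le> ?f 0"
    proof (rule DERIV_nonpos_imp_nonincreasing[OF t(1)])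
      fix s
      have "(y has_vector_derivative - (0 *\<^sub>R S (y s) + 1 *\<^sub>R C (y s))) (at s)" using y by simp
      note d = energy_derivative[OF this]
      have "(?f has_real_derivative (exp (g * s) * (g * h (y s) (y s) - 2 * h (C (y s)) (y s)))) (at s)"
        by (rule derivative_eq_intros d refl)+ (simp add: algebra_simps)
      moreover have "g * h (y s) (y s) \<le> 2 * h (C (y s)) (y s)"
      proof -
        have "\<gamma> * (norm (y s))\<^sup>2 \<le> h (C (y s)) (y s)"
          by (rule coer) (use zero_mode_orthogonal[OF y[rule_format]] y0 in blast)
        moreover have "g * h (y s) (y s) \<le> 2 * \<gamma> / \<beta> * (\<beta> * (norm (y s))\<^sup>2)"
          using g \<beta> \<gamma> by (intro mult_mono upper h_nonneg) auto
        ultimately show ?thesis using \<beta> by simp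
      qed
      ultimately show "\<exists>d. (?f has_real_derivative d) (at s) \<and> d \<le> 0"
        by (intro exI conjI) (auto simp: mult_le_0_iff)
    qed
    then have "h (y t) (y t) \<le> exp (- (g * t)) * h (y 0) (y 0)"
      by (simp add: exp_minus field_simps)
    also have "\<dots> \<le> (1 - g / 2 * t ^ (2 * k + 1)) * h (y 0) (y 0)"
    proof (intro mult_right_mono h_nonneg)
      have "exp (- (g * t)) \<le> 1 - g * t / 2" using exp_minus_le[of "g * t"] g t mult_le_one[of g t] by simp
      also have "\<dots> \<le> 1 - g / 2 * t ^ (2 * k + 1)"
      proof -
        have "t ^ (2 * k + 1) \<le> t ^ 1" using t by (intro power_decreasing) auto
        then have "g / 2 * t ^ (2 * k + 1) \<le> g / 2 * t" using g by (intro mult_left_mono) auto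
        then show ?thesis by simp
      qed
      finally show "exp (- (g * t)) \<le> 1 - g / 2 * t ^ (2 * k + 1)" .
    qed
    finally show "h (y t) (y t) \<le> (1 - g / 2 * t ^ (2 * k + 1)) * h (y 0) (y 0)" .
  qed (use g in auto)
qed

text \<open>Up to order k the iterates of -(S + C) on z are those of -S, so C kills the Taylor
  polynomial w of y of degree below k. With r = y - w = O(t^k) the dissipation is h(C r, r) =
  O(t^(2k)), and integration in time gives t^(2k+1).\<close>

lemma short_time_lower_bound:
  assumes z: "\<And>j. j < k \<Longrightarrow> C ((S ^^ j) z) = 0"
  shows "\<exists>K>0. \<forall>y t. (\<forall>s. (y has_vector_derivative - (S (y s) + C (y s))) (at s)) \<longrightarrow> y 0 = z \<longrightarrow>
     0 \<le> t \<longrightarrow> t \<le> 1 \<longrightarrow> h z z - K * t ^ (2 * k + 1) \<le> h (y t) (y t)"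
proof -
  define B where "B = (\<lambda>v. (- 1) *\<^sub>R S v + (- 1) *\<^sub>R C v)"
  have B: "linear B" unfolding B_def by (intro linear_compose_add linear_compose_scale_right S C)
  obtain Kb where Kb: "\<And>v. norm (B v) \<le> Kb * norm v" "Kb > 0"
    using linear_bounded_pos[OF B] by blast
  obtain Kc where Kc: "\<And>v. norm (C v) \<le> Kc * norm v" "Kc > 0"
    using linear_bounded_pos[OF C] by blast
  obtain Kh where Kh: "\<And>v w. norm (h v w) \<le> norm v * norm w * Kh" "Kh > 0"
    using h.pos_bounded by blast
  have powB: "(B ^^ j) z = (- 1) ^ j *\<^sub>R (S ^^ j) z" if "j \<le> k" for j
    using that
  proof (induction j)
    case (Suc j)
    then have "(B ^^ Suc j) z = (- 1) ^ j *\<^sub>R B ((S ^^ j) z)" by (simp add: linear_scale[OF B])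
    also have "B ((S ^^ j) z) = - S ((S ^^ j) z)" using Suc.prems z[of j] by (simp add: B_def)
    finally show ?case by simp
  qed simp
  define K0 where "K0 = Kb ^ k * (sqrt (\<beta> / \<alpha>) * norm z)"
  have K0: "K0 \<ge> 0" using Kb \<alpha> \<beta> by (simp add: K0_def)
  define K where "K = 2 * (Kc * Kh * K0\<^sup>2) + 1"
  show ?thesis
  proof (intro exI[of _ K] conjI allI impI)
    show "K > 0" using Kc Kh by (simp add: K_def add_nonneg_pos)
    fix y and t :: real
    assume y: "\<forall>s. (y has_vector_derivative - (S (y s) + C (y s))) (at s)" and y0: "y 0 = z"
      and t: "0 \<le> t" "t \<le> 1"
    have y': "(y has_vector_derivative - (1 *\<^sub>R S (y s) + 1 *\<^sub>R C (y s))) (at s)" for s using y by simp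
    have yB: "(y has_vector_derivative B (y s)) (at s)" for s using y by (simp add: B_def)
    have le: "2 * 1 * h (C (y s)) (y s) \<le> K * t ^ (2 * k)" if s: "s \<in> {0..t}" for s
    proof -
      define w where "w = (\<Sum>j<k. (s ^ j / fact j) *\<^sub>R (B ^^ j) (y 0))"
      have Cw: "C w = 0"
        unfolding w_def y0 by (auto simp: linear_sum[OF C] linear_scale[OF C] powB z intro!: sum.neutral)
      define r where "r = y s - w"
      have "norm r \<le> Kb ^ k * (sqrt (\<beta> / \<alpha>) * norm z) * s ^ k"
        unfolding r_def w_def
        by (rule norm_taylor_remainder_le[OF B Kb(1) yB _ s])
          (use solution_norm_le[OF y'] Kb y0 in auto)
      also have "\<dots> \<le> K0 * t ^ k"
        unfolding K0_def using s K0 by (intro mult_left_mono power_mono) (auto simp: K0_def)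
      finally have r: "norm r \<le> K0 * t ^ k" .
      have "h (C (y s)) (y s) = h (C r) r"
      proof -
        have "C r = C (y s)" by (simp add: r_def linear_diff[OF C] Cw)
        moreover have "h (C r) (y s) = h (C r) r + h (C r) w" by (simp add: r_def h.diff_right)
        \<comment> \<open>Symmetry moves C onto w and removes the cross term, which by size alone
          would only be O(t^k).\<close>
        moreover have "h (C r) w = 0" by (simp add: symC Cw h.zero_right)
        ultimately show ?thesis by simp
      qed
      also have "\<dots> \<le> norm (C r) * norm r * Kh" using Kh(1)[of "C r" r] by simp
      also have "\<dots> \<le> (Kc * (K0 * t ^ k)) * (K0 * t ^ k) * Kh"
        using order_trans[OF Kc(1)[of r] mult_left_mono[OF r]] r Kc Kh K0 t
        by (intro mult_right_mono mult_mono) auto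
      also have "\<dots> = Kc * Kh * K0\<^sup>2 * t ^ (2 * k)" by (simp add: power2_eq_square mult_2 power_add)
      finally have "2 * 1 * h (C (y s)) (y s) \<le> 2 * (Kc * Kh * K0\<^sup>2) * t ^ (2 * k)" by simp
      also have "\<dots> \<le> K * t ^ (2 * k)" using t by (intro mult_right_mono) (auto simp: K_def)
      finally show ?thesis .
    qed
    have "h (y 0) (y 0) - h (y t) (y t) \<le> t * (K * t ^ (2 * k))"
    proof (rule has_integral_le[OF energy_integral[OF y' t(1)] _ le])
      show "((\<lambda>s. K * t ^ (2 * k)) has_integral t * (K * t ^ (2 * k))) {0..t}"
        using has_integral_const_real[of "K * t ^ (2 * k)" 0 t] t by simp
    qed
    then show "h z z - K * t ^ (2 * k + 1) \<le> h (y t) (y t)" by (simp add: y0 algebra_simps)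
  qed
qed

end

end

section \<open>The Hilbert space of square integrable functions\<close>

lemma l2_eq_refl: "l2_eq f f \<longleftrightarrow> square_integrable f"
  by (simp add: l2_eq_def)

lemma l2_cases:
  obtains f where "square_integrable f" "x = class_l2 f"
  using l2.abs_induct[of "\<lambda>x. \<exists>f. square_integrable f \<and> x = class_l2 f" x] l2_eq_refl by blast

lemmas l2_class_simps =
  plus_l2.abs_eq[unfolded l2_eq_refl] scaleR_l2.abs_eq[unfolded l2_eq_refl]
  uminus_l2.abs_eq[unfolded l2_eq_refl] l2_inner.abs_eq[unfolded l2_eq_refl]
  scaleC_l2.abs_eq[unfolded l2_eq_refl] mult_l2.abs_eq[unfolded l2_eq_refl]

lemma class_l2_eq_iff:
  "square_integrable f \<Longrightarrow> square_integrable g \<Longrightarrow>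
     class_l2 f = class_l2 g \<longleftrightarrow> (AE t in period_measure. f t = g t)"
  using Quotient_rel[OF Quotient_l2, of f g] by (simp add: l2_eq_def)

lemma square_integrable_diff:
  assumes "square_integrable f" "square_integrable g"
  shows "square_integrable (\<lambda>t. f t - g t)"
  using square_integrable_add[OF assms(1) square_integrable_uminus[OF assms(2)]] by simp

lemma class_l2_diff:
  assumes "square_integrable f" "square_integrable g"
  shows "class_l2 f - class_l2 g = class_l2 (\<lambda>t. f t - g t)"
  unfolding minus_l2_def
  by (simp add: l2_class_simps assms square_integrable_uminus)

lemma square_integrable_zero: "square_integrable (\<lambda>t. 0)"
  by (intro square_integrable_continuous continuous_intros)

lemma integrable_bilinear:
  fixes b :: "complex^'n \<Rightarrow> complex^'n \<Rightarrow> 'b::euclidean_space"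
  assumes f: "square_integrable f" and g: "square_integrable g" and b: "bounded_bilinear b"
  shows "integrable period_measure (\<lambda>t. b (f t) (g t))"
proof -
  interpret b: bounded_bilinear b by (rule b)
  obtain K where K: "\<And>v w. norm (b v w) \<le> norm v * norm w * K" "K > 0"
    using b.pos_bounded by blast
  have m: "(\<lambda>t. b (f t) (g t)) \<in> borel_measurable period_measure"
    using f g b.continuous_on[OF continuous_on_fst[OF continuous_on_id] continuous_on_snd[OF continuous_on_id]]
      borel_measurable_continuous_on[of "\<lambda>p. b (fst p) (snd p)" "\<lambda>t. (f t, g t)" period_measure]
    by (simp add: square_integrable_def borel_measurable_Pair)
  have "integrable period_measure (\<lambda>t. K * ((norm (f t))\<^sup>2 + (norm (g t))\<^sup>2))"
    using f g unfolding square_integrable_def by auto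
  then show ?thesis
  proof (rule Bochner_Integration.integrable_bound[OF _ m], intro AE_I2)
    fix t
    have "norm (f t) * norm (g t) \<le> (norm (f t))\<^sup>2 + (norm (g t))\<^sup>2"
      using sum_squares_bound[of "norm (f t)" "norm (g t)"]
        mult_nonneg_nonneg[OF norm_ge_zero[of "f t"] norm_ge_zero[of "g t"]]
      by linarith
    from mult_right_mono[OF this less_imp_le[OF K(2)]] have "norm (f t) * norm (g t) * K \<le> ((norm (f t))\<^sup>2 + (norm (g t))\<^sup>2) * K"
      .
    with K(1)[of "f t" "g t"] have "norm (b (f t) (g t)) \<le> ((norm (f t))\<^sup>2 + (norm (g t))\<^sup>2) * K"
      by (rule order_trans)
    also have "\<dots> = norm (K * ((norm (f t))\<^sup>2 + (norm (g t))\<^sup>2))"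
      using K(2) by (simp add: abs_mult mult.commute)
    finally show "norm (b (f t) (g t)) \<le> norm (K * ((norm (f t))\<^sup>2 + (norm (g t))\<^sup>2))" .
  qed
qed

lemma integrable_inner:
  "square_integrable f \<Longrightarrow> square_integrable g \<Longrightarrow> integrable period_measure (\<lambda>t. f t \<bullet> g t)"
  by (rule integrable_bilinear[OF _ _ bounded_bilinear_inner])

text \<open>The class inner product is real and unweighted. It opens \<open>'n l2\<close> to the
  general theory of limits, sums and complete spaces; the weighted product \<open>l2_inner H\<close>
  is tied to it later by equivalence of norms.\<close>

instantiation l2 :: (finite) real_inner
begin

lift_definition inner_l2 :: "'a l2 \<Rightarrow> 'a l2 \<Rightarrow> real" is "\<lambda>f g. integral\<^sup>L period_measure (\<lambda>t. f t \<bullet> g t)"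
proof -
  fix f f' g g' :: "real \<Rightarrow> complex^'a"
  assume *: "l2_eq f f'" "l2_eq g g'"
  then have "AE t in period_measure. f t = f' t" "AE t in period_measure. g t = g' t"
    by (auto simp: l2_eq_def)
  then have "AE t in period_measure. f t \<bullet> g t = f' t \<bullet> g' t"
    by eventually_elim simp
  with * show "integral\<^sup>L period_measure (\<lambda>t. f t \<bullet> g t) = integral\<^sup>L period_measure (\<lambda>t. f' t \<bullet> g' t)"
    by (intro integral_cong_AE borel_measurable_integrable[OF integrable_inner]) (auto simp: l2_eq_def)
qed

definition norm_l2 :: "'a l2 \<Rightarrow> real" where "norm_l2 x = sqrt (inner x x)"
definition sgn_l2 :: "'a l2 \<Rightarrow> 'a l2" where "sgn_l2 x = x /\<^sub>R norm x"
definition dist_l2 :: "'a l2 \<Rightarrow> 'a l2 \<Rightarrow> real" where "dist_l2 x y = norm (x - y)"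
definition uniformity_l2 :: "('a l2 \<times> 'a l2) filter" where
  "uniformity_l2 = (INF e\<in>{0 <..}. principal {(x, y). dist x y < e})"
definition open_l2 :: "'a l2 set \<Rightarrow> bool" where
  "open_l2 U \<longleftrightarrow> (\<forall>x\<in>U. eventually (\<lambda>(x', y). x' = x \<longrightarrow> y \<in> U) uniformity)"

lemma inner_class_l2:
  "square_integrable f \<Longrightarrow> square_integrable g \<Longrightarrow>
    inner (class_l2 f) (class_l2 g) = integral\<^sup>L period_measure (\<lambda>t. f t \<bullet> g t)"
  by (simp add: inner_l2.abs_eq l2_eq_refl)

instance
proof
  fix x y z :: "'a l2" and r :: real
  obtain f where f: "square_integrable f" "x = class_l2 f" by (rule l2_cases)
  obtain g where g: "square_integrable g" "y = class_l2 g" by (rule l2_cases)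
  obtain h where h: "square_integrable h" "z = class_l2 h" by (rule l2_cases)
  show "dist x y = norm (x - y)" by (rule dist_l2_def)
  show "sgn x = x /\<^sub>R norm x" by (rule sgn_l2_def)
  show "(uniformity :: ('a l2 \<times> 'a l2) filter) = (INF e\<in>{0 <..}. principal {(x, y). dist x y < e})"
    by (rule uniformity_l2_def)
  show "open U \<longleftrightarrow> (\<forall>x\<in>U. eventually (\<lambda>(x', y). x' = x \<longrightarrow> y \<in> U) uniformity)" for U :: "'a l2 set"
    by (rule open_l2_def)
  show "norm x = sqrt (inner x x)" by (rule norm_l2_def)
  show "inner x y = inner y x" using f g by (simp add: inner_class_l2 inner_commute)
  show "inner (x + y) z = inner x z + inner y z"
    using f g h by (simp add: inner_class_l2 l2_class_simps square_integrable_add inner_add_left integrable_inner)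
  show "inner (r *\<^sub>R x) y = r * inner x y"
    using f g by (simp add: inner_class_l2 l2_class_simps square_integrable_scaleR)
  show "inner x x \<ge> 0"
    using f by (simp add: inner_class_l2)
  show "inner x x = 0 \<longleftrightarrow> x = 0"
  proof -
    have "inner x x = 0 \<longleftrightarrow> (AE t in period_measure. f t \<bullet> f t = 0)"
      using f by (simp add: inner_class_l2 integral_nonneg_eq_0_iff_AE integrable_inner)
    also have "\<dots> \<longleftrightarrow> x = class_l2 (\<lambda>t. 0)"
      using f by (simp add: class_l2_eq_iff square_integrable_zero)
    finally show ?thesis by (simp add: zero_l2_def)
  qed
qed

end

lemma power2_norm_class_l2:
  "square_integrable f \<Longrightarrow> (norm (class_l2 f))\<^sup>2 = integral\<^sup>L period_measure (\<lambda>t. (norm (f t))\<^sup>2)"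
  by (simp add: power2_norm_eq_inner inner_class_l2)

lemma sum_class_l2:
  assumes "\<And>k. k \<in> A \<Longrightarrow> square_integrable (f k)"
  shows "square_integrable (\<lambda>t. \<Sum>k\<in>A. f k t) \<and> (\<Sum>k\<in>A. class_l2 (f k)) = class_l2 (\<lambda>t. \<Sum>k\<in>A. f k t)"
  using assms
proof (induction A rule: infinite_finite_induct)
  case (insert k A)
  then show ?case by (auto simp: l2_class_simps square_integrable_add)
qed (auto simp: square_integrable_zero zero_l2_def)

text \<open>The weights \<open>2\<^sup>k\<close> turn the triangle inequality for the partial sums into a Cauchy--Schwarz
  estimate by one integrable function \<open>G\<close>.\<close>

lemma geometric_series_converges_l2:
  fixes u :: "nat \<Rightarrow> 'n::finite l2"
  assumes u: "\<And>k. norm (u k) \<le> (1/2) ^ k"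
  shows "\<exists>s. (\<lambda>n. \<Sum>k<n. u k) \<longlonglongrightarrow> s"
proof -
  have "\<exists>f. square_integrable f \<and> u k = class_l2 f" for k by (metis l2_cases)
  then obtain f where f: "\<And>k. square_integrable (f k)" "\<And>k. u k = class_l2 (f k)" by metis
  have f_meas [measurable]: "f k \<in> borel_measurable period_measure" for k
    using f by (simp add: square_integrable_def)
  have f_int: "integrable period_measure (\<lambda>t. (norm (f k t))\<^sup>2)" for k
    using f by (simp add: square_integrable_def)
  let ?g = "\<lambda>k t. 2 ^ k * (norm (f k t))\<^sup>2"
  have g_int: "integral\<^sup>L period_measure (?g k) \<le> (1/2) ^ k" for k
  proof -
    have "integral\<^sup>L period_measure (?g k) = 2 ^ k * (norm (u k))\<^sup>2"
      using f power2_norm_class_l2[of "f k"] by simp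
    also have "\<dots> \<le> 2 ^ k * ((1/2) ^ k)\<^sup>2" by (intro mult_left_mono power_mono u) auto
    also have "\<dots> = (1/2) ^ k" by (induction k) (simp_all add: power2_eq_square)
    finally show ?thesis .
  qed
  have "(\<integral>\<^sup>+ t. (\<Sum>k. ennreal (?g k t)) \<partial>period_measure) = (\<Sum>k. \<integral>\<^sup>+ t. ennreal (?g k t) \<partial>period_measure)"
    by (rule nn_integral_suminf) measurable
  also have "\<dots> = (\<Sum>k. ennreal (integral\<^sup>L period_measure (?g k)))"
    by (intro suminf_cong nn_integral_eq_integral) (auto simp: f_int)
  also have "\<dots> \<le> (\<Sum>k. ennreal ((1/2) ^ k))"
    by (intro suminf_le ennreal_leI g_int) auto
  also have "\<dots> = ennreal (\<Sum>k. (1/2) ^ k)"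
    by (rule suminf_ennreal2) (simp_all add: summable_geometric)
  also have "\<dots> < \<infinity>" by simp
  finally have fin: "(\<integral>\<^sup>+ t. (\<Sum>k. ennreal (?g k t)) \<partial>period_measure) < \<infinity>"
    .
  have "AE t in period_measure. (\<Sum>k. ennreal (?g k t)) \<noteq> \<infinity>"
    using fin by (intro nn_integral_PInf_AE) auto
  then have sumg: "AE t in period_measure. summable (\<lambda>k. ?g k t)"
    by eventually_elim (rule summable_suminf_not_top, auto)
  define G where "G t = (\<Sum>k. ?g k t)" for t
  have G_int: "integrable period_measure G"
    unfolding G_def
  proof (rule integrable_suminf)
    show "integrable period_measure (?g k)" for k using f_int by simp
    show "AE t in period_measure. summable (\<lambda>k. norm (?g k t))" using sumg by simp
    show "summable (\<lambda>k. LINT t|period_measure. norm (?g k t))"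
      by (rule summable_comparison_test'[of "\<lambda>k. (1/2) ^ k" 0]) (use g_int in \<open>simp_all add: summable_geometric\<close>)
  qed
  define s where "s t = (\<Sum>k. f k t)" for t
  have s_meas [measurable]: "s \<in> borel_measurable period_measure" unfolding s_def by measurable
  \<comment> \<open>This pointwise estimate serves twice: n = 0 makes s square integrable, general n
    gives the rate of convergence in norm.\<close>
  have tail: "(norm (s t - (\<Sum>k<n. f k t)))\<^sup>2 \<le> 2 * (1/2) ^ n * G t" if t: "summable (\<lambda>k. ?g k t)" for n t
  proof -
    \<comment> \<open>Arithmetic-geometric mean with weights 2^(-k) and 2^k; it gives absolute
      convergence wherever the dominating series converges.\<close>
    have "norm (f k t) \<le> (1/2) ^ k + ?g k t" for k
    proof -
      have "0 \<le> (1/2) ^ k * ((1::real) - 2 ^ k * norm (f k t))\<^sup>2" by simp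
      also have "\<dots> = (1/2) ^ k - 2 * norm (f k t) + ?g k t"
        by (simp add: power2_diff power2_eq_square algebra_simps power_divide)
      finally show ?thesis using norm_ge_zero[of "f k t"] zero_le_power[of "1/2::real" k] by (smt (verit) norm_ge_zero)
    qed
    then have "norm (norm (f k t)) \<le> (1/2) ^ k + ?g k t" if "k \<ge> 0" for k by simp
    moreover have "summable (\<lambda>k. (1/2) ^ k + ?g k t)"
      by (rule summable_add[OF summable_geometric t]) simp
    ultimately have "summable (\<lambda>k. norm (f k t))"
      by (rule summable_comparison_test'[rotated])
    then have lim: "(\<lambda>m. \<Sum>k<m. f k t) \<longlonglongrightarrow> s t"
      unfolding s_def by (rule summable_LIMSEQ[OF summable_norm_cancel])
    have "(norm ((\<Sum>k<m. f k t) - (\<Sum>k<n. f k t)))\<^sup>2 \<le> 2 * (1/2) ^ n * G t" if m: "n \<le> m" for m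
    proof -
      have "(\<Sum>k<m. f k t) - (\<Sum>k<n. f k t) = (\<Sum>k=n..<m. f k t)"
        using m by (simp add: sum_diff_nat_ivl[of 0 n m, unfolded atLeast0LessThan, symmetric])
      then have "(norm ((\<Sum>k<m. f k t) - (\<Sum>k<n. f k t)))\<^sup>2 \<le> (\<Sum>k=n..<m. norm (f k t))\<^sup>2"
        by (intro power_mono) (auto intro: norm_sum)
      also have "\<dots> = (\<Sum>k=n..<m. sqrt ((1/2) ^ k) * (sqrt (2 ^ k) * norm (f k t)))\<^sup>2"
        by (simp add: mult.assoc[symmetric] real_sqrt_mult[symmetric] power_mult_distrib[symmetric])
      also have "\<dots> \<le> (\<Sum>k=n..<m. (sqrt ((1/2) ^ k))\<^sup>2) * (\<Sum>k=n..<m. (sqrt (2 ^ k) * norm (f k t))\<^sup>2)"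
        by (rule Cauchy_Schwarz_ineq_sum)
      also have "\<dots> = (\<Sum>k=n..<m. (1/2) ^ k) * (\<Sum>k=n..<m. ?g k t)"
        by (simp add: power_mult_distrib)
      also have "\<dots> \<le> (2 * (1/2) ^ n) * G t"
      proof (intro mult_mono)
        have "(\<Sum>k=n..<m. (1/2::real) ^ k) = 2 * ((1/2) ^ n - (1/2) ^ m)"
          using m sum_gp0[of "1/2::real"] by (induction rule: dec_induct) (auto simp: algebra_simps)
        then show "(\<Sum>k=n..<m. (1/2::real) ^ k) \<le> 2 * (1/2) ^ n" by simp
        show "(\<Sum>k=n..<m. ?g k t) \<le> G t"
          unfolding G_def by (intro sum_le_suminf t) auto
      qed (auto intro!: sum_nonneg)
      finally show ?thesis .
    qed
    then have "\<forall>\<^sub>F m in sequentially. (norm ((\<Sum>k<m. f k t) - (\<Sum>k<n. f k t)))\<^sup>2 \<le> 2 * (1/2) ^ n * G t"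
      by (auto simp: eventually_sequentially)
    then show ?thesis
      by (intro tendsto_upperbound[OF _ _ sequentially_bot]) (auto intro!: tendsto_intros lim)
  qed
  have s: "square_integrable s"
    unfolding square_integrable_def
  proof
    show "integrable period_measure (\<lambda>t. (norm (s t))\<^sup>2)"
    proof (rule Bochner_Integration.integrable_bound)
      show "integrable period_measure (\<lambda>t. 2 * G t)" using G_int by simp
      show "AE t in period_measure. norm ((norm (s t))\<^sup>2) \<le> norm (2 * G t)"
        using sumg
      proof eventually_elim
        case (elim t)
        with tail[OF elim, of 0] show ?case by simp
      qed
    qed simp
  qed simp
  have "(\<lambda>n. (norm ((\<Sum>k<n. u k) - class_l2 s))\<^sup>2) \<longlonglongrightarrow> 0"
  proof (rule tendsto_sandwich[OF _ _ tendsto_const])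
    have le: "(norm ((\<Sum>k<n. u k) - class_l2 s))\<^sup>2 \<le> 2 * (1/2) ^ n * integral\<^sup>L period_measure G" for n
    proof -
      note S = sum_class_l2[of "{..<n}" f, OF f(1)]
      have "(norm ((\<Sum>k<n. u k) - class_l2 s))\<^sup>2 = (norm (class_l2 (\<lambda>t. s t - (\<Sum>k<n. f k t))))\<^sup>2"
        using S s by (subst norm_minus_commute) (simp add: f(2) class_l2_diff)
      also have "\<dots> = integral\<^sup>L period_measure (\<lambda>t. (norm (s t - (\<Sum>k<n. f k t)))\<^sup>2)"
        using S s by (intro power2_norm_class_l2 square_integrable_diff) auto
      also have "\<dots> \<le> integral\<^sup>L period_measure (\<lambda>t. 2 * (1/2) ^ n * G t)"
      proof (rule integral_mono_AE)
        show "integrable period_measure (\<lambda>t. (norm (s t - (\<Sum>k<n. f k t)))\<^sup>2)"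
          using square_integrable_diff[OF s conjunct1[OF S]] by (simp add: square_integrable_def)
        show "AE t in period_measure. (norm (s t - (\<Sum>k<n. f k t)))\<^sup>2 \<le> 2 * (1/2) ^ n * G t"
          using sumg by eventually_elim (rule tail)
      qed (use G_int in simp)
      finally show ?thesis by simp
    qed
    show "\<forall>\<^sub>F n in sequentially. (norm ((\<Sum>k<n. u k) - class_l2 s))\<^sup>2 \<le> 2 * (1/2) ^ n * integral\<^sup>L period_measure G"
      by (intro always_eventually allI le)
    show "(\<lambda>n. 2 * (1/2) ^ n * integral\<^sup>L period_measure G) \<longlonglongrightarrow> 0"
      by (auto intro!: tendsto_eq_intros LIMSEQ_power_zero)
  qed auto
  then have "(\<lambda>n. norm ((\<Sum>k<n. u k) - class_l2 s)) \<longlonglongrightarrow> 0"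
    using tendsto_real_sqrt by fastforce
  then have "(\<lambda>n. \<Sum>k<n. u k) \<longlonglongrightarrow> class_l2 s"
    using Lim_null tendsto_norm_zero_iff by blast
  then show ?thesis by blast
qed

instance l2 :: (finite) banach
proof
  fix X :: "nat \<Rightarrow> 'a l2"
  assume X: "Cauchy X"
  have "\<exists>M. \<forall>i\<ge>M. \<forall>j\<ge>M. dist (X i) (X j) < (1/2) ^ n" for n
    using X by (intro metric_CauchyD) auto
  then obtain M where M: "\<And>n i j. i \<ge> M n \<Longrightarrow> j \<ge> M n \<Longrightarrow> dist (X i) (X j) < (1/2) ^ n"
    by metis
  \<comment> \<open>Summing all thresholds so far puts r n beyond both n and M n, and r (n+1) beyond
    M n, with no recursive choice; consecutive terms of the subsequence then differ by less than
    (1/2)^n.\<close>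
  define r where "r n = n + (\<Sum>k\<le>n. M k)" for n
  have rM: "r n \<ge> M n" "r (Suc n) \<ge> M n" "r n \<ge> n" for n
    unfolding r_def using member_le_sum[of n "{..n}" M] member_le_sum[of n "{..Suc n}" M] by auto
  have "norm (X (r (Suc k)) - X (r k)) \<le> (1/2) ^ k" for k
    using M[OF rM(2) rM(1), of k] by (simp add: dist_norm)
  then obtain s where "(\<lambda>n. \<Sum>k<n. X (r (Suc k)) - X (r k)) \<longlonglongrightarrow> s"
    using geometric_series_converges_l2[of "\<lambda>k. X (r (Suc k)) - X (r k)"] by blast
  then have "(\<lambda>n. X (r n) - X (r 0)) \<longlonglongrightarrow> s" by (simp only: sum_lessThan_telescope[of "\<lambda>n. X (r n)"])
  from tendsto_add[OF this tendsto_const[of "X (r 0)"]]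
  have lim: "(\<lambda>n. X (r n)) \<longlonglongrightarrow> s + X (r 0)" by simp
  have "X \<longlonglongrightarrow> s + X (r 0)"
  proof (rule metric_LIMSEQ_I)
    fix e :: real assume e: "e > 0"
    obtain N where N: "\<And>i j. i \<ge> N \<Longrightarrow> j \<ge> N \<Longrightarrow> dist (X i) (X j) < e / 2"
      using metric_CauchyD[OF X, of "e / 2"] e by auto
    obtain N' where N': "\<And>n. n \<ge> N' \<Longrightarrow> dist (X (r n)) (s + X (r 0)) < e / 2"
      using metric_LIMSEQ_D[OF lim, of "e / 2"] e by auto
    have "dist (X n) (s + X (r 0)) < e" if "n \<ge> max N N'" for n
      using dist_triangle[of "X n" "s + X (r 0)" "X (r n)"] N[of n "r n"] N'[of n] that rM(3)[of n] by auto
    then show "\<exists>N. \<forall>n\<ge>N. dist (X n) (s + X (r 0)) < e" by blast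
  qed
  then show "convergent X" by (auto simp: convergent_def)
qed

section \<open>Completeness of the exponentials and of the test functions\<close>

lemma integrable_bounded_mult:
  fixes h \<phi> :: "'a \<Rightarrow> complex"
  assumes h: "integrable M h" and \<phi>: "\<phi> \<in> borel_measurable M" and B: "\<And>t. t \<in> space M \<Longrightarrow> norm (\<phi> t) \<le> B"
  shows "integrable M (\<lambda>t. \<phi> t * h t)"
proof (rule Bochner_Integration.integrable_bound)
  show "integrable M (\<lambda>t. B * norm (h t))" using h by simp
  show "(\<lambda>t. \<phi> t * h t) \<in> borel_measurable M" using h \<phi> by measurable
  show "AE t in M. norm (\<phi> t * h t) \<le> norm (B * norm (h t))"
  proof (rule AE_I2)
    fix t assume t: "t \<in> space M"
    have "norm (\<phi> t * h t) \<le> B * norm (h t)"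
      using B[OF t] by (simp add: norm_mult mult_right_mono)
    also have "\<dots> \<le> norm (B * norm (h t))" by simp
    finally show "norm (\<phi> t * h t) \<le> norm (B * norm (h t))" .
  qed
qed

lemma continuous_period_measurable:
  fixes f :: "real \<Rightarrow> 'a::euclidean_space"
  assumes "continuous_on UNIV f"
  shows "f \<in> borel_measurable period_measure"
  using assms by (intro continuous_imp_measurable_on_sets_lebesgue) (auto intro: continuous_on_subset)

lemma AE_period_not_in:
  assumes "negligible N"
  shows "AE t in period_measure. t \<notin> N"
proof -
  have "AE t in lebesgue. t \<notin> N"
    using assms by (simp add: negligible_iff_null_sets AE_not_in)
  then show ?thesis by (auto simp: AE_restrict_space_iff elim: eventually_mono)
qed

definition cexp :: "int \<Rightarrow> real \<Rightarrow> complex" where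
  "cexp m t = exp (\<i> * of_int m * of_real t)"

lemma cexp_add: "cexp (m + n) t = cexp m t * cexp n t"
  by (simp add: cexp_def exp_add[symmetric] algebra_simps)

lemma norm_cexp [simp]: "norm (cexp m t) = 1"
  by (simp add: cexp_def)

lemma continuous_on_cexp [continuous_intros]: "continuous_on A (cexp m)"
  unfolding cexp_def by (intro continuous_intros)

lemma cexp_measurable [measurable]: "cexp m \<in> borel_measurable period_measure"
  by (intro continuous_period_measurable continuous_intros)

lemma integrable_cexp_mult: "integrable period_measure h \<Longrightarrow> integrable period_measure (\<lambda>t. cexp m t * h t)"
  by (rule integrable_bounded_mult[where B = 1]) auto

text \<open>All Fourier coefficients vanish. Only integrability is demanded; what matters is
  stability under multiplication by exponentials, hence by trigonometric polynomials.\<close>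

definition fourier_null :: "(real \<Rightarrow> complex) \<Rightarrow> bool" where
  "fourier_null h \<longleftrightarrow> integrable period_measure h \<and> (\<forall>m. integral\<^sup>L period_measure (\<lambda>t. cexp m t * h t) = 0)"

lemma fourier_null_integral: "fourier_null h \<Longrightarrow> integral\<^sup>L period_measure h = 0"
  unfolding fourier_null_def by (auto simp: cexp_def dest: spec[of _ 0])

lemma fourier_null_add: "fourier_null g \<Longrightarrow> fourier_null h \<Longrightarrow> fourier_null (\<lambda>t. g t + h t)"
  unfolding fourier_null_def by (simp add: distrib_left integrable_cexp_mult)

lemma fourier_null_cmult: "fourier_null h \<Longrightarrow> fourier_null (\<lambda>t. c * h t)"
  unfolding fourier_null_def by (simp add: mult.left_commute[of _ c])

lemma fourier_null_cexp: "fourier_null h \<Longrightarrow> fourier_null (\<lambda>t. cexp m t * h t)"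
  unfolding fourier_null_def
  by (simp add: integrable_cexp_mult mult.assoc[symmetric] cexp_add[symmetric])

text \<open>Polynomials on the circle are trigonometric polynomials: a real-linear f has f(cis t) =
  a e^(it) + b e^(-it). The function \<open>h\<close> is arbitrary in the induction, so a product is
  handled by applying the two hypotheses one after the other.\<close>

lemma fourier_null_real_polynomial:
  fixes p :: "complex \<Rightarrow> real"
  assumes "real_polynomial_function p" "fourier_null h"
  shows "fourier_null (\<lambda>t. of_real (p (cis t)) * h t)"
  using assms
proof (induction arbitrary: h)
  case (linear f)
  interpret bounded_linear f by fact
  define a b where "a = (of_real (f 1) - \<i> * of_real (f \<i>)) / 2" and "b = (of_real (f 1) + \<i> * of_real (f \<i>)) / 2"
  have "of_real (f (cis t)) = a * cexp 1 t + b * cexp (- 1) t" for t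
  proof -
    have "cis t = cos t *\<^sub>R 1 + sin t *\<^sub>R \<i>" by (simp add: complex_eq_iff)
    then have "f (cis t) = cos t * f 1 + sin t * f \<i>" by (metis add scaleR real_scaleR_def)
    moreover have "cexp 1 t = cis t" "cexp (- 1) t = cis (- t)" by (simp_all add: cexp_def cis_conv_exp)
    ultimately show ?thesis by (simp add: a_def b_def complex_eq_iff field_simps)
  qed
  then have "(\<lambda>t. of_real (f (cis t)) * h t) = (\<lambda>t. a * (cexp 1 t * h t) + b * (cexp (- 1) t * h t))"
    by (simp add: algebra_simps)
  then show ?case
    using linear.prems by (auto intro!: fourier_null_add fourier_null_cmult fourier_null_cexp)
next
  case (const c)
  then show ?case by (intro fourier_null_cmult)
next
  case (add f g)
  then show ?case by (simp add: distrib_right fourier_null_add)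
next
  case (mult f g)
  then show ?case by (simp add: mult.assoc)
qed

text \<open>Stone-Weierstrass on the unit circle, where continuity encodes periodicity. A uniform
  error e costs e times the L^1 norm \<open>J\<close>.\<close>

lemma fourier_null_circle_integral:
  fixes F :: "complex \<Rightarrow> complex"
  assumes h: "fourier_null h" and F: "continuous_on (sphere 0 1) F"
  shows "integral\<^sup>L period_measure (\<lambda>t. F (cis t) * h t) = 0"
proof -
  have h_int: "integrable period_measure h" using h by (simp add: fourier_null_def)
  define J where "J = integral\<^sup>L period_measure (\<lambda>t. norm (h t))"
  have J: "J \<ge> 0" by (simp add: J_def)
  have le: "norm (integral\<^sup>L period_measure (\<lambda>t. F (cis t) * h t)) \<le> e * J" if e: "e > 0" for e
  proof -
    obtain p where p: "polynomial_function p" "\<forall>x\<in>sphere 0 1. norm (F x - p x) < e"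
      using Stone_Weierstrass_polynomial_function[OF compact_sphere F e] by blast
    have poly: "real_polynomial_function (\<lambda>x. Re (p x))" "real_polynomial_function (\<lambda>x. Im (p x))"
      using p(1) bounded_linear_Re bounded_linear_Im unfolding polynomial_function_def o_def by blast+
    have "fourier_null (\<lambda>t. of_real (Re (p (cis t))) * h t + \<i> * (of_real (Im (p (cis t))) * h t))"
      by (intro fourier_null_add fourier_null_cmult fourier_null_real_polynomial[of "\<lambda>x. Re (p x)"]
          fourier_null_real_polynomial[of "\<lambda>x. Im (p x)"] h poly)
    moreover have "of_real (Re z) * w + \<i> * (of_real (Im z) * w) = z * w" for z w
      by (metis complex_eq distrib_right mult.assoc)
    ultimately have pn: "fourier_null (\<lambda>t. p (cis t) * h t)" by simp
    have circ: "cis t \<in> sphere 0 1" for t by simp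
    have "bounded (F ` sphere 0 1)" by (intro compact_imp_bounded compact_continuous_image F) auto
    then obtain B where B: "\<forall>x\<in>F ` sphere 0 1. norm x \<le> B" using bounded_iff by blast
    have int_F: "integrable period_measure (\<lambda>t. F (cis t) * h t)"
    proof (rule integrable_bounded_mult[OF h_int])
      show "(\<lambda>t. F (cis t)) \<in> borel_measurable period_measure"
        by (intro continuous_period_measurable continuous_on_compose2[OF F]) (auto intro!: continuous_intros)
      show "norm (F (cis t)) \<le> B" for t using circ B by blast
    qed
    have int_p: "integrable period_measure (\<lambda>t. p (cis t) * h t)" using pn by (simp add: fourier_null_def)
    have "integral\<^sup>L period_measure (\<lambda>t. F (cis t) * h t) = integral\<^sup>L period_measure (\<lambda>t. F (cis t) * h t - p (cis t) * h t)"
      using fourier_null_integral[OF pn] int_F int_p by simp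
    also have "norm \<dots> \<le> integral\<^sup>L period_measure (\<lambda>t. e * norm (h t))"
    proof (rule Bochner_Integration.integral_norm_bound_integral)
      fix t
      have "norm (F (cis t) - p (cis t)) \<le> e" using p(2) circ by (meson less_imp_le)
      then show "norm (F (cis t) * h t - p (cis t) * h t) \<le> e * norm (h t)"
        by (simp add: left_diff_distrib[symmetric] norm_mult mult_right_mono)
    qed (use h_int int_F int_p in auto)
    finally show ?thesis by (simp add: J_def)
  qed
  show ?thesis
  proof (rule ccontr)
    assume "\<not> ?thesis"
    then have pos: "norm (integral\<^sup>L period_measure (\<lambda>t. F (cis t) * h t)) > 0" (is "?n > 0") by simp
    \<comment> \<open>The choice of e makes e J smaller than the norm; J + 1 covers the case J =
      0.\<close>
    have "?n \<le> ?n / (2 * (J + 1)) * J" using pos J by (intro le) auto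
    also have "\<dots> = ?n * (J / (2 * (J + 1)))" by simp
    also have "\<dots> < ?n * 1" using J by (intro mult_strict_left_mono pos) (simp add: divide_less_eq)
    finally show False by simp
  qed
qed

text \<open>The factor \<open>1 - cos t\<close> makes \<open>\<phi>\<close> periodic and only vanishes on a null set.\<close>

lemma fourier_null_weighted_integral:
  assumes h: "fourier_null h" and \<phi>: "continuous_on UNIV \<phi>" and B: "\<And>t. norm (\<phi> t) \<le> B"
  shows "integral\<^sup>L period_measure (\<lambda>t. \<phi> t * of_real (1 - cos t) * h t) = 0"
proof -
  define F where "F w = \<phi> (Arg2pi w) * of_real (1 - Re w)" for w
  have F: "continuous_on (sphere 0 1) F"
  proof (intro continuous_at_imp_continuous_on ballI)
    fix w :: complex assume w: "w \<in> sphere 0 1"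
    show "isCont F w"
    proof (cases "w = 1")
      case True
      have "(F \<longlongrightarrow> 0) (at 1)"
      proof (rule Lim_null_comparison)
        have "norm (F x) \<le> B * \<bar>1 - Re x\<bar>" for x
          by (simp only: F_def norm_mult norm_of_real) (intro mult_right_mono B, simp)
        then show "\<forall>\<^sub>F x in at 1. norm (F x) \<le> B * \<bar>1 - Re x\<bar>" by simp
        have "((\<lambda>x. B * \<bar>1 - Re x\<bar>) \<longlongrightarrow> B * \<bar>1 - Re 1\<bar>) (at 1)" by (intro tendsto_intros)
        then show "((\<lambda>x. B * \<bar>1 - Re x\<bar>) \<longlongrightarrow> 0) (at 1)" by simp
      qed
      then show ?thesis unfolding True isCont_def by (simp add: F_def)
    next
      case False
      then have "w \<notin> \<real>\<^sub>\<ge>\<^sub>0" using w by (auto simp: complex_nonneg_Reals_iff cmod_def complex_eq_iff power2_eq_1_iff)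
      then have "isCont Arg2pi w" by (rule continuous_at_Arg2pi)
      moreover have "isCont \<phi> x" for x using \<phi> by (simp add: continuous_on_eq_continuous_at)
      ultimately have "isCont (\<lambda>w. \<phi> (Arg2pi w)) w" using isCont_o2 by blast
      then show ?thesis unfolding F_def by (intro continuous_intros isCont_Re)
    qed
  qed
  have "integral\<^sup>L period_measure (\<lambda>t. F (cis t) * h t) = integral\<^sup>L period_measure (\<lambda>t. \<phi> t * of_real (1 - cos t) * h t)"
  proof (rule Bochner_Integration.integral_cong[OF refl])
    fix t assume "t \<in> space period_measure"
    then have t: "0 \<le> t" "t \<le> 2 * pi" by (auto simp: space_restrict_space)
    show "F (cis t) * h t = \<phi> t * of_real (1 - cos t) * h t"
    \<comment> \<open>At this end point \<open>Arg2pi\<close> jumps back to 0, but the factor 1 -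
      cos t vanishes on both sides.\<close>
    proof (cases "t = 2 * pi")
      case False
      then have "Arg2pi (cis t) = t" using t by (intro Arg2pi_unique[of 1]) (auto simp: cis_conv_exp mult.commute)
      then show ?thesis by (simp add: F_def)
    qed (simp add: F_def)
  qed
  with fourier_null_circle_integral[OF h F] show ?thesis by simp
qed

text \<open>Testing with \<psi> = cnj h / (1 + |h|) yields the integral of a nonnegative function
  that vanishes only where h or 1 - cos t does.\<close>

theorem fourier_null_AE_zero:
  assumes h: "fourier_null h"
  shows "AE t in period_measure. h t = 0"
proof -
  have h_int: "integrable period_measure h" using h by (simp add: fourier_null_def)
  then have h_meas [measurable]: "h \<in> borel_measurable period_measure" by simp
  \<comment> \<open>The denominator bounds the test function by 1; with the plain conjugate the
    integrand |h|^2 might fail to be integrable.\<close>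
  define \<psi> where "\<psi> t = cnj (h t) / of_real (1 + norm (h t))" for t
  have cnj_meas: "(\<lambda>t. cnj (h t)) \<in> borel_measurable period_measure"
    by (rule borel_measurable_continuous_on[OF _ h_meas]) (intro continuous_intros)
  have \<psi>_meas [measurable]: "\<psi> \<in> borel_measurable period_measure"
    unfolding \<psi>_def using cnj_meas by measurable
  have \<psi>1: "norm (\<psi> t) \<le> 1" for t
  proof -
    have "norm (\<psi> t) = norm (h t) / (1 + norm (h t))"
      unfolding \<psi>_def norm_divide norm_of_real by simp
    then show ?thesis by (simp add: divide_le_eq add_pos_nonneg)
  qed
  have "\<psi> measurable_on {0..2 * pi}"
    using \<psi>_meas by (simp add: measurable_on_iff_borel_measurable)
  then obtain N g where N: "negligible N" and g: "\<And>n. continuous_on UNIV (g n)"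
    and lim: "\<And>t. t \<notin> N \<Longrightarrow> (\<lambda>n. g n t) \<longlonglongrightarrow> (if t \<in> {0..2 * pi} then \<psi> t else 0)"
    unfolding measurable_on_def by blast
  \<comment> \<open>\<open>\<psi>\<close> is only measurable. The continuous g n converge to it
    almost everywhere but may be unbounded; radial truncation to the unit ball keeps continuity,
    keeps the limit because |\<psi>| \<le> 1, and permits dominated convergence.\<close>
  define G where "G n t = g n t / of_real (max 1 (norm (g n t)))" for n t
  have G: "continuous_on UNIV (G n)" for n
    unfolding G_def by (intro continuous_intros g) (auto simp: max_def)
  have G1: "norm (G n t) \<le> 1" for n t
    unfolding G_def norm_divide norm_of_real by (simp add: divide_le_eq)
  have AEN: "AE t in period_measure. t \<notin> N"
    by (rule AE_period_not_in[OF N])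
  have int0: "integral\<^sup>L period_measure (\<lambda>t. \<psi> t * of_real (1 - cos t) * h t) = 0"
  proof (rule LIMSEQ_unique)
    show "(\<lambda>n. integral\<^sup>L period_measure (\<lambda>t. G n t * of_real (1 - cos t) * h t))
        \<longlonglongrightarrow> integral\<^sup>L period_measure (\<lambda>t. \<psi> t * of_real (1 - cos t) * h t)"
    proof (rule integral_dominated_convergence[where w = "\<lambda>t. 2 * norm (h t)"])
      show "(\<lambda>t. \<psi> t * of_real (1 - cos t) * h t) \<in> borel_measurable period_measure"
        by (intro borel_measurable_times \<psi>_meas h_meas continuous_period_measurable continuous_intros)
      show "(\<lambda>t. G n t * of_real (1 - cos t) * h t) \<in> borel_measurable period_measure" for n
        by (intro borel_measurable_times h_meas continuous_period_measurable continuous_intros G)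
      show "integrable period_measure (\<lambda>t. 2 * norm (h t))" using h_int by simp
      show "AE t in period_measure. (\<lambda>n. G n t * of_real (1 - cos t) * h t) \<longlonglongrightarrow> \<psi> t * of_real (1 - cos t) * h t"
        using AEN AE_space
      proof eventually_elim
        case (elim t)
        then have "(\<lambda>n. g n t) \<longlonglongrightarrow> \<psi> t" using lim[of t] by (simp add: space_restrict_space)
        then have "(\<lambda>n. G n t) \<longlonglongrightarrow> \<psi> t / of_real (max 1 (norm (\<psi> t)))"
          unfolding G_def by (intro tendsto_intros) (auto simp: max_def)
        then have "(\<lambda>n. G n t) \<longlonglongrightarrow> \<psi> t" using \<psi>1[of t] by (simp add: max_absorb1)
        then show ?case by (intro tendsto_intros)
      qed
      show "AE t in period_measure. norm (G n t * of_real (1 - cos t) * h t) \<le> 2 * norm (h t)" for n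
      proof (rule AE_I2)
        fix t :: real
        have c: "\<bar>1 - cos t\<bar> \<le> 2" using cos_ge_minus_one[of t] cos_le_one[of t] by linarith
        have "norm (G n t) * \<bar>1 - cos t\<bar> \<le> 1 * 2" by (intro mult_mono G1 c) auto
        then show "norm (G n t * of_real (1 - cos t) * h t) \<le> 2 * norm (h t)"
          unfolding norm_mult norm_of_real by (intro mult_right_mono) auto
      qed
    qed
    show "(\<lambda>n. integral\<^sup>L period_measure (\<lambda>t. G n t * of_real (1 - cos t) * h t)) \<longlonglongrightarrow> 0"
      using fourier_null_weighted_integral[OF h G G1] by simp
  qed
  define q where "q t = (norm (h t))\<^sup>2 / (1 + norm (h t)) * (1 - cos t)" for t
  have q_eq: "\<psi> t * of_real (1 - cos t) * h t = of_real (q t)" for t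
  proof -
    have "cnj (h t) * h t = of_real ((norm (h t))\<^sup>2)" by (metis complex_norm_square mult.commute of_real_power)
    then show ?thesis by (simp add: \<psi>_def q_def field_simps)
  qed
  have "integrable period_measure (\<lambda>t. of_real (q t) :: complex)"
    unfolding q_eq[symmetric]
  proof (rule integrable_bounded_mult[OF h_int, where B = 2])
    show "(\<lambda>t. \<psi> t * of_real (1 - cos t)) \<in> borel_measurable period_measure"
      by (intro borel_measurable_times \<psi>_meas continuous_period_measurable continuous_intros)
    fix t :: real
    have c: "\<bar>1 - cos t\<bar> \<le> 2" using cos_ge_minus_one[of t] cos_le_one[of t] by linarith
    have "norm (\<psi> t) * \<bar>1 - cos t\<bar> \<le> 1 * 2" by (intro mult_mono \<psi>1 c) auto
    then show "norm (\<psi> t * of_real (1 - cos t)) \<le> 2" unfolding norm_mult norm_of_real by simp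
  qed
  then have q_int: "integrable period_measure q" by (simp add: complex_of_real_integrable_eq)
  have "integral\<^sup>L period_measure q = 0"
    using int0 unfolding q_eq by simp
  moreover have "q t \<ge> 0" for t by (simp add: q_def)
  ultimately have "AE t in period_measure. q t = 0"
    using integral_nonneg_eq_0_iff_AE[OF q_int] by simp
  moreover have "AE t in period_measure. t \<notin> {0, 2 * pi}"
    by (rule AE_period_not_in) simp
  ultimately show ?thesis using AE_space
  proof eventually_elim
    case (elim t)
    then have "0 < t" "t < 2 * pi" by (auto simp: space_restrict_space less_le)
    then have "cos t \<noteq> 1"
      using cos_one_2pi_int[of t] by (auto simp: mult_less_cancel_right2 zero_less_mult_iff)
    moreover have "1 + norm (h t) > 0" by (simp add: add_pos_nonneg)
    ultimately show ?case using elim(1) by (simp add: q_def)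
  qed
qed

text \<open>Test functions are required to be C1 only, so squares of positive parts are smooth
  enough to build cutoffs.\<close>

lemma C1_square_max: "(\<lambda>t. (max 0 (a * t + b))\<^sup>2) C1_differentiable_on UNIV"
  unfolding C1_differentiable_on_def
proof (intro exI[of _ "\<lambda>t. 2 * max 0 (a * t + b) * a"] conjI ballI)
  have *: "((\<lambda>u. (max 0 u)\<^sup>2) has_real_derivative 2 * max 0 u) (at u)" for u :: real
  proof -
    consider "u > 0" | "u < 0" | "u = 0" by linarith
    then show ?thesis
    proof cases
      case 1
      have "((\<lambda>u. u\<^sup>2) has_real_derivative 2 * max 0 u) (at u)"
        using 1 by (auto intro!: derivative_eq_intros)
      then show ?thesis
        by (rule has_field_derivative_transform_within_open[of _ _ _ "{0<..}"]) (use 1 in auto)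
    next
      case 2
      have "((\<lambda>u. 0) has_real_derivative 2 * max 0 u) (at u)"
        using 2 by (auto intro!: derivative_eq_intros)
      then show ?thesis
        by (rule has_field_derivative_transform_within_open[of _ _ _ "{..<0}"]) (use 2 in auto)
    next
      case 3
      have "((\<lambda>v::real. (max 0 v)\<^sup>2 / v) \<longlongrightarrow> 0) (at 0)"
      proof (rule Lim_null_comparison)
        show "\<forall>\<^sub>F v in at (0::real). norm ((max 0 v)\<^sup>2 / v) \<le> \<bar>v\<bar>"
          by (auto simp: max_def power2_eq_square intro!: always_eventually)
        show "((\<lambda>v::real. \<bar>v\<bar>) \<longlongrightarrow> 0) (at 0)" by (auto intro!: tendsto_eq_intros)
      qed
      then show ?thesis unfolding 3 by (simp add: has_field_derivative_iff)
    qed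
  qed
  fix t
  have "((\<lambda>t. (max 0 (a * t + b))\<^sup>2) has_real_derivative 2 * max 0 (a * t + b) * a) (at t)"
    by (rule DERIV_chain2[OF *]) (auto intro!: derivative_eq_intros)
  then show "((\<lambda>t. (max 0 (a * t + b))\<^sup>2) has_vector_derivative 2 * max 0 (a * t + b) * a) (at t)"
    by (simp add: has_real_derivative_iff_has_vector_derivative)
qed (intro continuous_intros)

lemma C1_cos: "(\<lambda>t. cos (c * t)) C1_differentiable_on (UNIV :: real set)"
  unfolding C1_differentiable_on_def
  by (rule exI[of _ "\<lambda>t. - (sin (c * t)) * c"])
    (auto intro!: derivative_eq_intros continuous_intros simp: has_real_derivative_iff_has_vector_derivative[symmetric])

lemma C1_sin: "(\<lambda>t. sin (c * t)) C1_differentiable_on (UNIV :: real set)"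
  unfolding C1_differentiable_on_def
  by (rule exI[of _ "\<lambda>t. cos (c * t) * c"])
    (auto intro!: derivative_eq_intros continuous_intros simp: has_real_derivative_iff_has_vector_derivative[symmetric])

text \<open>Zero outside the interval from e to 2 pi - e and of second order at its ends, hence C1.
  For e > 0 it makes a test function out of any C1 factor; e = 0 is the limit, positive on the whole
  open interval.\<close>

definition cutoff :: "real \<Rightarrow> real \<Rightarrow> real" where
  "cutoff e t = (max 0 (t - e))\<^sup>2 * (max 0 (2 * pi - e - t))\<^sup>2"

lemma test_function_cutoff:
  assumes "e > 0" and p: "p C1_differentiable_on UNIV"
  shows "test_function (\<lambda>t. cutoff e t * p t)"
  unfolding test_function_def
proof
  show "(\<lambda>t. cutoff e t * p t) C1_differentiable_on UNIV"
    unfolding cutoff_def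
    using C1_square_max[of 1 "- e"] C1_square_max[of "- 1" "2 * pi - e"] p
    by (intro C1_differentiable_on_mult) (simp_all add: algebra_simps)
  have "closure {t. cutoff e t * p t \<noteq> 0} \<subseteq> {e..2 * pi - e}"
    by (rule closure_minimal) (auto simp: cutoff_def max_def split: if_splits)
  also have "\<dots> \<subseteq> {0<..<2 * pi}" using assms(1) by auto
  finally show "closure {t. cutoff e t * p t \<noteq> 0} \<subseteq> {0<..<2 * pi}" .
qed

lemma cutoff_nonneg: "0 \<le> cutoff e t" by (simp add: cutoff_def)

lemma cutoff_le:
  assumes "e \<ge> 0" "t \<in> {0..2 * pi}"
  shows "cutoff e t \<le> (2 * pi)\<^sup>2 * (2 * pi)\<^sup>2"
  unfolding cutoff_def using assms by (intro mult_mono power_mono) auto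

text \<open>Reduction to the exponentials: testing with \<open>cutoff e\<close> times cosines and
  sines and letting e tend to 0 shows that \<open>cutoff 0\<close> times g has vanishing Fourier
  coefficients, and \<open>cutoff 0\<close> is nonzero away from the end points.\<close>

theorem test_functions_AE_zero:
  fixes g :: "real \<Rightarrow> complex"
  assumes g: "integrable period_measure g"
    and test: "\<And>\<phi>. test_function \<phi> \<Longrightarrow> integral\<^sup>L period_measure (\<lambda>t. of_real (\<phi> t) * g t) = 0"
  shows "AE t in period_measure. g t = 0"
proof -
  have g_meas [measurable]: "g \<in> borel_measurable period_measure" using g by simp
  have cut_cont: "continuous_on UNIV (cutoff e)" for e
    unfolding cutoff_def by (intro continuous_intros)
  have lim0: "integral\<^sup>L period_measure (\<lambda>t. of_real (cutoff 0 t * p t) * g t) = 0"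
    if p: "p C1_differentiable_on UNIV" and p1: "\<And>t. \<bar>p t\<bar> \<le> 1" for p
  proof (rule LIMSEQ_unique)
    have p_cont: "continuous_on UNIV p" using p by (rule C1_differentiable_imp_continuous_on)
    define e where "e n = inverse (real (Suc n))" for n
    have e: "e n > 0" "e \<longlonglongrightarrow> 0" for n
      unfolding e_def using LIMSEQ_inverse_real_of_nat by auto
    show "(\<lambda>n. integral\<^sup>L period_measure (\<lambda>t. of_real (cutoff (e n) t * p t) * g t)) \<longlonglongrightarrow> 0"
      using test[OF test_function_cutoff[OF e(1) p]] by simp
    show "(\<lambda>n. integral\<^sup>L period_measure (\<lambda>t. of_real (cutoff (e n) t * p t) * g t))
       \<longlonglongrightarrow> integral\<^sup>L period_measure (\<lambda>t. of_real (cutoff 0 t * p t) * g t)"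
    proof (rule integral_dominated_convergence[where w = "\<lambda>t. (2 * pi)\<^sup>2 * (2 * pi)\<^sup>2 * norm (g t)"])
      show "(\<lambda>t. of_real (cutoff 0 t * p t) * g t) \<in> borel_measurable period_measure"
        "(\<lambda>t. of_real (cutoff (e n) t * p t) * g t) \<in> borel_measurable period_measure" for n
        by (intro borel_measurable_times g_meas continuous_period_measurable continuous_intros cut_cont p_cont)+
      show "integrable period_measure (\<lambda>t. (2 * pi)\<^sup>2 * (2 * pi)\<^sup>2 * norm (g t))" using g by simp
      show "AE t in period_measure. (\<lambda>n. of_real (cutoff (e n) t * p t) * g t) \<longlonglongrightarrow> of_real (cutoff 0 t * p t) * g t"
        unfolding cutoff_def by (intro always_eventually allI tendsto_intros e)
      show "AE t in period_measure. norm (of_real (cutoff (e n) t * p t) * g t) \<le> (2 * pi)\<^sup>2 * (2 * pi)\<^sup>2 * norm (g t)" for n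
      proof (rule AE_I2)
        fix t assume "t \<in> space period_measure"
        then have t: "t \<in> {0..2 * pi}" by (simp add: space_restrict_space)
        have "\<bar>cutoff (e n) t\<bar> * \<bar>p t\<bar> \<le> ((2 * pi)\<^sup>2 * (2 * pi)\<^sup>2) * 1"
          using cutoff_le[OF less_imp_le[OF e(1)] t] cutoff_nonneg p1 by (intro mult_mono) auto
        then show "norm (of_real (cutoff (e n) t * p t) * g t) \<le> (2 * pi)\<^sup>2 * (2 * pi)\<^sup>2 * norm (g t)"
          unfolding norm_mult norm_of_real abs_mult by (intro mult_right_mono) auto
      qed
    qed
  qed
  define h where "h t = of_real (cutoff 0 t) * g t" for t
  have h_int: "integrable period_measure h"
    unfolding h_def
  proof (rule integrable_bounded_mult[OF g, where B = "(2 * pi)\<^sup>2 * (2 * pi)\<^sup>2"])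
    show "(\<lambda>t. of_real (cutoff 0 t) :: complex) \<in> borel_measurable period_measure"
      by (intro continuous_period_measurable continuous_intros cut_cont)
  qed (use cutoff_le cutoff_nonneg in \<open>auto simp: space_restrict_space\<close>)
  have bm: "(\<lambda>t. complex_of_real (f (of_int m * t))) \<in> borel_measurable period_measure"
    if "continuous_on UNIV f" for f m
    by (intro continuous_period_measurable continuous_intros continuous_on_compose2[OF that]) auto
  have "fourier_null h"
    unfolding fourier_null_def
  proof (intro conjI allI h_int)
    fix m
    have "(\<lambda>t. cexp m t * h t) = (\<lambda>t. of_real (cos (of_int m * t)) * h t + \<i> * (of_real (sin (of_int m * t)) * h t))"
    proof
      fix t
      have "cexp m t = of_real (cos (of_int m * t)) + \<i> * of_real (sin (of_int m * t))"
        using cis_conv_exp[of "of_int m * t"] by (simp add: cexp_def complex_eq_iff mult.assoc)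
      then show "cexp m t * h t = of_real (cos (of_int m * t)) * h t + \<i> * (of_real (sin (of_int m * t)) * h t)"
        by (simp add: algebra_simps)
    qed
    moreover have "integral\<^sup>L period_measure (\<lambda>t. of_real (cos (of_int m * t)) * h t) = 0"
      using lim0[OF C1_cos, of "of_int m"] by (simp add: h_def mult_ac)
    moreover have "integral\<^sup>L period_measure (\<lambda>t. of_real (sin (of_int m * t)) * h t) = 0"
      using lim0[OF C1_sin, of "of_int m"] by (simp add: h_def mult_ac)
    moreover have "integrable period_measure (\<lambda>t. of_real (cos (of_int m * t)) * h t)"
      "integrable period_measure (\<lambda>t. of_real (sin (of_int m * t)) * h t)"
      by (rule integrable_bounded_mult[OF h_int, where B = 1]; (intro bm continuous_intros)?; simp)+
    ultimately show "integral\<^sup>L period_measure (\<lambda>t. cexp m t * h t) = 0" by simp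
  qed
  from fourier_null_AE_zero[OF this] have "AE t in period_measure. h t = 0" .
  moreover have "AE t in period_measure. t \<notin> {0, 2 * pi}"
    by (rule AE_period_not_in) simp
  ultimately show ?thesis using AE_space
  proof eventually_elim
    case (elim t)
    then have "cutoff 0 t \<noteq> 0" by (auto simp: cutoff_def space_restrict_space max_def)
    then show ?case using elim(1) by (simp add: h_def)
  qed
qed

section \<open>Fourier coefficients\<close>

lemma cdot_commute: "cnj (cdot v w) = cdot w v"
  by (simp add: cdot_def mult.commute)

lemma Re_cdot: "Re (cdot v w) = v \<bullet> w"
  by (simp add: cdot_def inner_vec_def inner_complex_def)

lemma cdot_scale_right: "cdot v (c *s w) = c * cdot v w"
  by (simp add: cdot_def sum_distrib_left mult_ac)

lemma cdot_scale_left: "cdot (c *s v) w = cnj c * cdot v w"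
  by (simp add: cdot_def sum_distrib_left mult_ac)

lemma cdot_self: "cdot v v = of_real ((norm v)\<^sup>2)"
proof (rule complex_eqI)
  show "Re (cdot v v) = Re (of_real ((norm v)\<^sup>2))" by (simp add: Re_cdot power2_norm_eq_inner)
  have "cnj (cdot v v) = cdot v v" by (rule cdot_commute)
  then show "Im (cdot v v) = Im (of_real ((norm v)\<^sup>2))" by (simp add: complex_eq_iff)
qed

lemma bounded_bilinear_cdot: "bounded_bilinear (cdot :: complex^'n \<Rightarrow> complex^'n \<Rightarrow> complex)"
  unfolding bilinear_conv_bounded_bilinear[symmetric] bilinear_def linear_iff
  by (simp add: cdot_def algebra_simps sum.distrib scaleR_sum_right)

lemma bounded_bilinear_hdot: "bounded_bilinear (hdot H)"
  for H :: "complex^'n^'n"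
  unfolding hdot_def
  by (rule bounded_bilinear.comp[OF bounded_bilinear_cdot bounded_linear_ident linear_conv_bounded_linear[THEN iffD1, OF linear_matrix_vector]])

lemma matrix_vector_scale: "M *v (c *s v) = c *s (M *v v)"
  for M :: "complex^'n^'n"
  by (simp add: vec_eq_iff matrix_vector_mult_def sum_distrib_left mult_ac)

lemma hdot_scale_right: "hdot H v (c *s w) = c * hdot H v w"
  by (simp add: hdot_def matrix_vector_scale cdot_scale_right)

lemma hdot_scale_left: "hdot H (c *s v) w = cnj c * hdot H v w"
  by (simp add: hdot_def cdot_scale_left)

lemma hdot_mat_1: "hdot (mat 1) v w = cdot v w"
  by (simp add: hdot_def)

lemma norm_vector_scale: "norm (c *s v) = norm c * norm v"
  for v :: "complex^'n"
  by (simp add: norm_vec_def L2_set_def norm_mult power_mult_distrib sum_distrib_left[symmetric] real_sqrt_mult)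

lemma cdot_hermitian:
  assumes "hermitian M"
  shows "cdot v (M *v w) = cdot (M *v v) w"
proof -
  have "cdot v (M *v w) = (\<Sum>i\<in>UNIV. \<Sum>j\<in>UNIV. cnj (v $ i) * (M $ i $ j * w $ j))"
    by (simp add: cdot_def matrix_vector_mult_def sum_distrib_left)
  also have "\<dots> = (\<Sum>j\<in>UNIV. \<Sum>i\<in>UNIV. cnj (v $ i) * (M $ i $ j * w $ j))"
    by (rule sum.swap)
  also have "\<dots> = (\<Sum>j\<in>UNIV. \<Sum>i\<in>UNIV. cnj (M $ j $ i * v $ i) * w $ j)"
    using assms unfolding hermitian_def by (intro sum.cong refl) (metis (no_types, lifting) complex_cnj_mult mult.assoc mult.commute)
  also have "\<dots> = cdot (M *v v) w"
    by (simp add: cdot_def matrix_vector_mult_def sum_distrib_right)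
  finally show ?thesis .
qed

lemma hdot_commute: "hermitian H \<Longrightarrow> cnj (hdot H v w) = hdot H w v"
  unfolding hdot_def by (simp add: cdot_commute cdot_hermitian[symmetric])

text \<open>The lower constant is the minimum of the form on the compact unit sphere, extended by
  homogeneity.\<close>

lemma pos_def_bounds:
  fixes H :: "complex^'n^'n"
  assumes "pos_def H"
  obtains \<alpha> \<beta> where "\<alpha> > 0" "\<beta> > 0"
    "\<And>v. \<alpha> * (norm v)\<^sup>2 \<le> Re (hdot H v v)" "\<And>v. Re (hdot H v v) \<le> \<beta> * (norm v)\<^sup>2"
proof -
  interpret h: bounded_bilinear "hdot H" by (rule bounded_bilinear_hdot)
  obtain K where K: "\<And>v w. norm (hdot H v w) \<le> norm v * norm w * K" "K > 0"
    using h.pos_bounded by blast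
  obtain b :: "complex^'n" where b: "b \<in> Basis" using nonempty_Basis by blast
  have "\<exists>x\<in>sphere 0 1. \<forall>y\<in>sphere 0 1. Re (hdot H x x) \<le> Re (hdot H y y)"
    by (rule continuous_attains_inf) (use b in \<open>auto intro!: continuous_intros h.continuous_on exI[of _ b]\<close>)
  then obtain x where x: "norm x = 1" "\<And>y. norm y = 1 \<Longrightarrow> Re (hdot H x x) \<le> Re (hdot H y y)" by auto
  have "x \<noteq> 0" using x(1) by auto
  then have "Re (hdot H x x) > 0" using assms by (auto simp: pos_def_def hdot_def)
  moreover have "Re (hdot H x x) * (norm v)\<^sup>2 \<le> Re (hdot H v v)" for v
  proof (cases "v = 0")
    case False
    have "Re (hdot H x x) \<le> Re (hdot H (v /\<^sub>R norm v) (v /\<^sub>R norm v))" by (rule x(2)) (use False in simp)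
    also have "\<dots> = Re (hdot H v v) / (norm v)\<^sup>2"
      by (simp add: h.scaleR_left h.scaleR_right power2_eq_square divide_inverse)
    finally show ?thesis using False by (simp add: field_simps)
  qed (simp add: h.zero_left)
  moreover have "Re (hdot H v v) \<le> K * (norm v)\<^sup>2" for v
    using complex_Re_le_cmod[of "hdot H v v"] K(1)[of v v] by (simp add: power2_eq_square mult_ac)
  ultimately show ?thesis using that K(2) by blast
qed

lemma square_integrable_cexp_mult:
  fixes f :: "real \<Rightarrow> complex^'n"
  assumes "square_integrable f"
  shows "square_integrable (\<lambda>t. cexp m t *s f t)"
  unfolding square_integrable_def
proof
  have "bounded_bilinear (\<lambda>c (v :: complex^'n). c *s v)"
    unfolding bilinear_conv_bounded_bilinear[symmetric] bilinear_def linear_iff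
    by (simp add: vec_eq_iff algebra_simps)
  then have "continuous_on UNIV (\<lambda>p :: complex \<times> (complex^'n). fst p *s snd p)"
    by (rule bounded_bilinear.continuous_on) (intro continuous_intros)+
  from borel_measurable_continuous_on[OF this, of "\<lambda>t. (cexp m t, f t)" period_measure]
  show "(\<lambda>t. cexp m t *s f t) \<in> borel_measurable period_measure"
    using assms by (simp add: square_integrable_def borel_measurable_Pair cexp_measurable)
  show "integrable period_measure (\<lambda>t. (norm (cexp m t *s f t))\<^sup>2)"
    using assms by (simp add: norm_vector_scale square_integrable_def)
qed

lemma finite_measure_period: "finite_measure period_measure"
  by (rule finite_measure_lebesgue_on) simp

lemma square_integrable_integrable:
  assumes "square_integrable f"
  shows "integrable period_measure f"
proof (rule Bochner_Integration.integrable_bound)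
  interpret finite_measure period_measure by (rule finite_measure_period)
  show "integrable period_measure (\<lambda>t. 1 + (norm (f t))\<^sup>2)"
    using assms by (simp add: square_integrable_def)
  show "f \<in> borel_measurable period_measure" using assms by (simp add: square_integrable_def)
  show "AE t in period_measure. norm (f t) \<le> norm (1 + (norm (f t))\<^sup>2)"
  proof (rule AE_I2)
    fix t
    have "0 \<le> (norm (f t) - 1)\<^sup>2" by simp
    then have "2 * norm (f t) \<le> 1 + (norm (f t))\<^sup>2" by (simp add: power2_diff)
    then have "norm (f t) \<le> 1 + (norm (f t))\<^sup>2" using norm_ge_zero[of "f t"] by linarith
    then show "norm (f t) \<le> norm (1 + (norm (f t))\<^sup>2)" by simp
  qed
qed

lemma cnj_cexp: "cnj (cexp m t) = cexp (- m) t"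
  by (simp add: cexp_def exp_cnj)

lemma integral_cexp: "integral\<^sup>L period_measure (cexp m) = (if m = 0 then 2 * pi else 0)"
proof (cases "m = 0")
  case True
  have "cexp 0 = (\<lambda>t. 1)" by (simp add: cexp_def fun_eq_iff)
  then show ?thesis using True by (simp add: measure_restrict_space scaleR_conv_of_real)
next
  case False
  define F where "F t = cexp m t / (\<i> * of_int m)" for t
  have "(cexp m has_integral (F (2 * pi) - F 0)) {0..2 * pi}"
  proof (rule fundamental_theorem_of_calculus)
    fix t :: real
    have "((\<lambda>t. cexp m t) has_vector_derivative (\<i> * of_int m * cexp m t)) (at t within {0..2 * pi})"
      unfolding cexp_def
      by (rule has_vector_derivative_real_field) (auto intro!: derivative_eq_intros)
    from has_vector_derivative_divide[OF this, of "\<i> * of_int m"]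
    show "(F has_vector_derivative cexp m t) (at t within {0..2 * pi})"
      unfolding F_def[abs_def] using False by simp
  qed simp
  moreover have "F (2 * pi) = F 0"
  proof -
    have "cexp m (2 * pi) = exp (2 * of_int m * of_real pi * \<i>)" by (simp add: cexp_def mult_ac)
    then show ?thesis using exp_integer_2pi[of "of_int m"] by (simp add: F_def) (simp add: cexp_def)
  qed
  moreover have "integrable period_measure (cexp m)"
    using integrable_cexp_mult[of "\<lambda>t. 1" m] finite_measure.integrable_const[OF finite_measure_period] by simp
  ultimately show ?thesis
    using False by (simp add: lebesgue_integral_eq_integral integral_unique)
qed

lemma fourier_mode_class: "fourier_mode m v = class_l2 (\<lambda>t. cexp m t *s v)"
  by (simp add: fourier_mode.abs_eq cexp_def)

lemma square_integrable_const: "square_integrable (\<lambda>t. v)"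
  by (intro square_integrable_continuous continuous_intros)

lemma square_integrable_mode: "square_integrable (\<lambda>t. cexp m t *s v)"
  by (intro square_integrable_cexp_mult square_integrable_const)

lemma l2_inner_class:
  "square_integrable f \<Longrightarrow> square_integrable g \<Longrightarrow>
     l2_inner H (class_l2 f) (class_l2 g) = integral\<^sup>L period_measure (\<lambda>t. hdot H (f t) (g t))"
  by (simp add: l2_class_simps)

lemma integrable_hdot:
  "square_integrable f \<Longrightarrow> square_integrable g \<Longrightarrow> integrable period_measure (\<lambda>t. hdot H (f t) (g t))"
  by (rule integrable_bilinear[OF _ _ bounded_bilinear_hdot])

section \<open>The weighted inner product\<close>

lemma l2_inner_add_left: "l2_inner H (x + y) z = l2_inner H x z + l2_inner H y z"
proof -
  interpret h: bounded_bilinear "hdot H" by (rule bounded_bilinear_hdot)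
  obtain f where f: "square_integrable f" "x = class_l2 f" by (rule l2_cases)
  obtain g where g: "square_integrable g" "y = class_l2 g" by (rule l2_cases)
  obtain k where k: "square_integrable k" "z = class_l2 k" by (rule l2_cases)
  show ?thesis
    using f g k by (simp add: l2_class_simps square_integrable_add h.add_left integrable_hdot)
qed

lemma l2_inner_add_right: "l2_inner H z (x + y) = l2_inner H z x + l2_inner H z y"
proof -
  interpret h: bounded_bilinear "hdot H" by (rule bounded_bilinear_hdot)
  obtain f where f: "square_integrable f" "x = class_l2 f" by (rule l2_cases)
  obtain g where g: "square_integrable g" "y = class_l2 g" by (rule l2_cases)
  obtain k where k: "square_integrable k" "z = class_l2 k" by (rule l2_cases)
  show ?thesis
    using f g k by (simp add: l2_class_simps square_integrable_add h.add_right integrable_hdot)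
qed

lemma l2_inner_scaleC_left: "l2_inner H (scaleC_l2 c x) y = cnj c * l2_inner H x y"
proof -
  obtain f where f: "square_integrable f" "x = class_l2 f" by (rule l2_cases)
  obtain g where g: "square_integrable g" "y = class_l2 g" by (rule l2_cases)
  show ?thesis
    using f g by (simp add: l2_class_simps square_integrable_vector_scalar hdot_scale_left)
qed

lemma l2_inner_scaleC_right: "l2_inner H x (scaleC_l2 c y) = c * l2_inner H x y"
proof -
  obtain f where f: "square_integrable f" "x = class_l2 f" by (rule l2_cases)
  obtain g where g: "square_integrable g" "y = class_l2 g" by (rule l2_cases)
  show ?thesis
    using f g by (simp add: l2_class_simps square_integrable_vector_scalar hdot_scale_right)
qed

lemma scaleC_of_real:
  fixes x :: "'n::finite l2"
  shows "scaleC_l2 (of_real r) x = r *\<^sub>R x"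
proof -
  obtain f where f: "square_integrable f" "x = class_l2 f" by (rule l2_cases)
  have "of_real r *s v = r *\<^sub>R v" for v :: "complex^'n" by (simp add: vec_eq_iff complex_eq_iff)
  then show ?thesis using f by (simp add: l2_class_simps)
qed

lemma l2_inner_commute:
  assumes "hermitian H"
  shows "cnj (l2_inner H x y) = l2_inner H y x"
proof -
  obtain f where f: "square_integrable f" "x = class_l2 f" by (rule l2_cases)
  obtain g where g: "square_integrable g" "y = class_l2 g" by (rule l2_cases)
  have "cnj (l2_inner H x y) = integral\<^sup>L period_measure (\<lambda>t. cnj (hdot H (f t) (g t)))"
    using f g by (simp add: l2_class_simps)
  then show ?thesis using f g by (simp add: l2_class_simps hdot_commute[OF assms])
qed

lemma Re_l2_inner: "Re (l2_inner (mat 1) x y) = inner x y"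
proof -
  obtain f where f: "square_integrable f" "x = class_l2 f" by (rule l2_cases)
  obtain g where g: "square_integrable g" "y = class_l2 g" by (rule l2_cases)
  show ?thesis
    using f g integral_Re[OF integrable_hdot[of f g "mat 1"]]
    by (simp add: l2_class_simps inner_class_l2 hdot_mat_1 Re_cdot)
qed

lemma l2_inner_mult: "l2_inner H x y = l2_inner (mat 1) x (mult_l2 H y)"
proof -
  obtain f where f: "square_integrable f" "x = class_l2 f" by (rule l2_cases)
  obtain g where g: "square_integrable g" "y = class_l2 g" by (rule l2_cases)
  show ?thesis
    using f g by (simp add: l2_class_simps square_integrable_matrix_vector hdot_def)
qed

lemma norm_l2_le:
  assumes "\<And>t. norm (f t) \<le> K * norm (g t)" "square_integrable f" "square_integrable g"
  shows "norm (class_l2 f) \<le> \<bar>K\<bar> * norm (class_l2 g)"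
proof -
  have "(norm (class_l2 f))\<^sup>2 = integral\<^sup>L period_measure (\<lambda>t. (norm (f t))\<^sup>2)"
    by (rule power2_norm_class_l2[OF assms(2)])
  also have "\<dots> \<le> integral\<^sup>L period_measure (\<lambda>t. K\<^sup>2 * (norm (g t))\<^sup>2)"
  proof (rule Bochner_Integration.integral_mono)
    show "(norm (f t))\<^sup>2 \<le> K\<^sup>2 * (norm (g t))\<^sup>2" for t
      using power_mono[OF assms(1)[of t] norm_ge_zero, of 2] by (simp add: power_mult_distrib)
  qed (use assms in \<open>simp_all add: square_integrable_def\<close>)
  also have "\<dots> = (\<bar>K\<bar> * norm (class_l2 g))\<^sup>2"
    using power2_norm_class_l2[OF assms(3)] by (simp add: power_mult_distrib)
  finally show ?thesis by (rule power2_le_imp_le) simp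
qed

lemma mult_l2_bounded:
  fixes M :: "complex^'n^'n"
  shows "\<exists>K. \<forall>x. norm (mult_l2 M x) \<le> K * norm x"
proof -
  obtain K where K: "\<And>v. norm (M *v v) \<le> K * norm v" "K > 0"
    using linear_bounded_pos[OF linear_matrix_vector] by blast
  show ?thesis
  proof (intro exI allI)
    fix x :: "'n l2"
    obtain f where f: "square_integrable f" "x = class_l2 f" by (rule l2_cases)
    show "norm (mult_l2 M x) \<le> \<bar>K\<bar> * norm x"
      using f norm_l2_le[OF K(1)] by (simp add: l2_class_simps square_integrable_matrix_vector)
  qed
qed

text \<open>Cauchy-Schwarz in the class inner product bounds the real part once \<open>H\<close> has
  been moved onto the second argument. The imaginary part is, up to sign, the real part with the
  second argument multiplied by i.\<close>

lemma bounded_bilinear_l2_inner: "bounded_bilinear (l2_inner H)"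
proof
  fix a a' b b' :: "'a l2" and r :: real
  show "l2_inner H (a + a') b = l2_inner H a b + l2_inner H a' b" by (rule l2_inner_add_left)
  show "l2_inner H a (b + b') = l2_inner H a b + l2_inner H a b'" by (rule l2_inner_add_right)
  show "l2_inner H (r *\<^sub>R a) b = r *\<^sub>R l2_inner H a b"
    by (simp add: scaleC_of_real[symmetric] l2_inner_scaleC_left scaleR_conv_of_real)
  show "l2_inner H a (r *\<^sub>R b) = r *\<^sub>R l2_inner H a b"
    by (simp add: scaleC_of_real[symmetric] l2_inner_scaleC_right scaleR_conv_of_real)
  obtain K where K: "\<And>x. norm (mult_l2 H x) \<le> K * norm x" using mult_l2_bounded by blast
  have re: "\<bar>Re (l2_inner H x y)\<bar> \<le> norm x * (K * norm y)" for x y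
  proof -
    have "Re (l2_inner H x y) = inner x (mult_l2 H y)" by (subst l2_inner_mult) (rule Re_l2_inner)
    also have "\<bar>\<dots>\<bar> \<le> norm x * norm (mult_l2 H y)" by (rule Cauchy_Schwarz_ineq2)
    also have "\<dots> \<le> norm x * (K * norm y)" by (intro mult_left_mono K) auto
    finally show ?thesis .
  qed
  have "norm (l2_inner H x y) \<le> norm x * norm y * (2 * K)" for x y
  proof -
    have n: "norm (scaleC_l2 \<i> y) \<le> norm y"
    proof -
      obtain f where f: "square_integrable f" "y = class_l2 f" by (rule l2_cases)
      have "norm (\<i> *s f t) \<le> 1 * norm (f t)" for t by (simp add: norm_vector_scale)
      from norm_l2_le[OF this square_integrable_vector_scalar[OF f(1)] f(1)] f show ?thesis
        by (simp add: l2_class_simps)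
    qed
    have "\<bar>Im (l2_inner H x y)\<bar> = \<bar>Re (l2_inner H x (scaleC_l2 \<i> y))\<bar>"
      by (simp add: l2_inner_scaleC_right)
    also have "\<dots> \<le> norm x * (K * norm (scaleC_l2 \<i> y))" by (rule re)
    also have "\<dots> \<le> norm x * (K * norm y)"
    proof (cases "y = 0")
      case False
      then have "K \<ge> 0" using order_trans[OF norm_ge_zero K[of y]] by (simp add: zero_le_mult_iff)
      then show ?thesis by (intro mult_left_mono n) auto
    qed (use n in simp)
    moreover have "norm x * norm y * (2 * K) = 2 * (norm x * (K * norm y))" by simp
    ultimately show ?thesis using cmod_le[of "l2_inner H x y"] re[of x y] by linarith
  qed
  then show "\<exists>K. \<forall>a b. norm (l2_inner H a b) \<le> norm a * norm b * K" by blast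
qed

lemma l2_inner_bounds:
  assumes "\<And>v. \<alpha> * (norm v)\<^sup>2 \<le> Re (hdot H v v)" "\<And>v. Re (hdot H v v) \<le> \<beta> * (norm v)\<^sup>2"
  shows "\<alpha> * (norm x)\<^sup>2 \<le> Re (l2_inner H x x)" "Re (l2_inner H x x) \<le> \<beta> * (norm x)\<^sup>2"
proof -
  obtain f where f: "square_integrable f" "x = class_l2 f" by (rule l2_cases)
  have f2: "integrable period_measure (\<lambda>t. (norm (f t))\<^sup>2)" using f by (simp add: square_integrable_def)
  have i: "integrable period_measure (\<lambda>t. Re (hdot H (f t) (f t)))"
    using integrable_hdot[OF f(1) f(1)] by simp
  have eq: "Re (l2_inner H x x) = integral\<^sup>L period_measure (\<lambda>t. Re (hdot H (f t) (f t)))"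
    using f integral_Re[OF integrable_hdot[of f f H]] by (simp add: l2_class_simps)
  have n: "c * (norm x)\<^sup>2 = integral\<^sup>L period_measure (\<lambda>t. c * (norm (f t))\<^sup>2)" for c
    using f power2_norm_class_l2[of f] by simp
  show "\<alpha> * (norm x)\<^sup>2 \<le> Re (l2_inner H x x)"
    unfolding eq n by (intro Bochner_Integration.integral_mono) (use f2 i assms in auto)
  show "Re (l2_inner H x x) \<le> \<beta> * (norm x)\<^sup>2"
    unfolding eq n by (intro Bochner_Integration.integral_mono) (use f2 i assms in auto)
qed

text \<open>Taken coordinatewise with the unweighted product, so the coefficients are independent of
  \<open>H\<close>. The weight enters only through the finite-dimensional form, as in
  \<open>l2_inner_mode\<close> and \<open>parseval\<close>.\<close>

definition fcoeff :: "'n::finite l2 \<Rightarrow> int \<Rightarrow> complex^'n" where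
  "fcoeff x m = (\<chi> i. l2_inner (mat 1) (fourier_mode m (axis i 1)) x / (2 * pi))"

lemma bounded_linear_vec_nth: "bounded_linear (\<lambda>v :: complex^'n. v $ i)"
  unfolding linear_conv_bounded_linear[symmetric] by (simp add: linear_iff)

lemma fcoeff_class:
  assumes f: "square_integrable f"
  shows "fcoeff (class_l2 f) m = (1 / (2 * pi)) *\<^sub>R integral\<^sup>L period_measure (\<lambda>t. cexp (- m) t *s f t)"
proof (subst vec_eq_iff, intro allI)
  fix i
  have ax: "cdot (axis i 1) v = v $ i" for v :: "complex^'a"
    by (simp add: cdot_def axis_def if_distrib[of cnj] mult_delta_left cong: if_cong)
  have "l2_inner (mat 1) (fourier_mode m (axis i 1)) (class_l2 f)
      = integral\<^sup>L period_measure (\<lambda>t. (cexp (- m) t *s f t) $ i)"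
    by (simp add: fourier_mode_class l2_inner_class square_integrable_mode f hdot_mat_1 cdot_scale_left ax cnj_cexp)
  also have "\<dots> = (integral\<^sup>L period_measure (\<lambda>t. cexp (- m) t *s f t)) $ i"
    by (rule integral_bounded_linear[OF bounded_linear_vec_nth square_integrable_integrable[OF square_integrable_cexp_mult[OF f]]])
  finally show "fcoeff (class_l2 f) m $ i = ((1 / (2 * pi)) *\<^sub>R integral\<^sup>L period_measure (\<lambda>t. cexp (- m) t *s f t)) $ i"
    unfolding fcoeff_def vec_lambda_beta vector_scaleR_component by (simp add: scaleR_conv_of_real)
qed

lemma l2_inner_mode: "l2_inner H (fourier_mode m v) x = 2 * pi * hdot H v (fcoeff x m)"
proof -
  interpret h: bounded_bilinear "hdot H" by (rule bounded_bilinear_hdot)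
  obtain f where f: "square_integrable f" "x = class_l2 f" by (rule l2_cases)
  have "l2_inner H (fourier_mode m v) x = integral\<^sup>L period_measure (\<lambda>t. hdot H v (cexp (- m) t *s f t))"
    using f by (simp add: fourier_mode_class l2_inner_class square_integrable_mode hdot_scale_left hdot_scale_right cnj_cexp)
  also have "\<dots> = hdot H v (integral\<^sup>L period_measure (\<lambda>t. cexp (- m) t *s f t))"
    by (rule integral_bounded_linear[OF h.bounded_linear_right square_integrable_integrable[OF square_integrable_cexp_mult[OF f(1)]]])
  finally show ?thesis
    unfolding f(2) fcoeff_class[OF f(1)] h.scaleR_right by (simp add: scaleR_conv_of_real)
qed

lemma fcoeff_mode: "fcoeff (fourier_mode m v) k = (if k = m then v else 0)"
proof -
  have bl: "bounded_linear (\<lambda>c. c *s v)"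
    unfolding linear_conv_bounded_linear[symmetric] by (simp add: linear_iff vec_eq_iff algebra_simps)
  have int: "integrable period_measure (cexp (m - k))"
    using integrable_cexp_mult[of "\<lambda>t. 1" "m - k"] finite_measure.integrable_const[OF finite_measure_period] by simp
  have "integral\<^sup>L period_measure (\<lambda>t. cexp (- k) t *s (cexp m t *s v)) = integral\<^sup>L period_measure (\<lambda>t. cexp (m - k) t *s v)"
    by (simp add: vector_smult_assoc cexp_add[symmetric])
  also have "\<dots> = (integral\<^sup>L period_measure (cexp (m - k))) *s v"
    by (rule integral_bounded_linear[OF bl int])
  also have "\<dots> = (if k = m then (2 * pi) *\<^sub>R v else 0)"
    by (simp add: integral_cexp vec_eq_iff complex_eq_iff)
  finally show ?thesis
    by (simp add: fourier_mode_class fcoeff_class square_integrable_mode)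
qed

lemma fcoeff_add: "fcoeff (x + y) m = fcoeff x m + fcoeff y m"
  by (simp add: fcoeff_def vec_eq_iff l2_inner_add_right add_divide_distrib)

lemma fcoeff_scaleC: "fcoeff (scaleC_l2 c x) m = c *s fcoeff x m"
  by (simp add: fcoeff_def vec_eq_iff l2_inner_scaleC_right)

lemma bounded_linear_fcoeff: "bounded_linear (\<lambda>x. fcoeff x m)"
proof -
  interpret bounded_bilinear "l2_inner (mat 1 :: complex^'a^'a)" by (rule bounded_bilinear_l2_inner)
  have "bounded_linear (\<lambda>x :: 'a l2. \<Sum>i\<in>UNIV. axis i (l2_inner (mat 1) (fourier_mode m (axis i 1)) x / (2 * pi)))"
  proof (rule bounded_linear_sum)
    fix i :: 'a
    have "linear (axis i :: complex \<Rightarrow> complex^'a)"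
      by (simp add: linear_iff vec_eq_iff axis_def)
    then have "bounded_linear (axis i :: complex \<Rightarrow> complex^'a)"
      by (simp add: linear_conv_bounded_linear)
    from bounded_linear_compose[OF this bounded_linear_compose[OF bounded_linear_divide bounded_linear_right]]
    show "bounded_linear (\<lambda>x :: 'a l2. axis i (l2_inner (mat 1) (fourier_mode m (axis i 1)) x / (2 * pi)))" .
  qed
  moreover have "fcoeff x m = (\<Sum>i\<in>UNIV. axis i (l2_inner (mat 1) (fourier_mode m (axis i 1)) x / (2 * pi)))" for x :: "'a l2"
    by (simp add: fcoeff_def vec_eq_iff axis_def if_distrib cong: if_cong)
  ultimately show ?thesis by simp
qed

lemmas fcoeff_linear = bounded_linear.linear[OF bounded_linear_fcoeff]
lemmas fcoeff_diff = linear_diff[OF fcoeff_linear]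
lemmas fcoeff_zero = linear_0[OF fcoeff_linear]
lemmas fcoeff_scaleR = linear_scale[OF fcoeff_linear]

lemma fcoeff_partial_sum:
  "finite F \<Longrightarrow> fcoeff (\<Sum>m\<in>F. fourier_mode m (z m)) k = (if k \<in> F then z k else 0)"
  by (simp add: linear_sum[OF fcoeff_linear] fcoeff_mode)

theorem fcoeff_eq_zero:
  assumes "\<And>m. fcoeff x m = 0"
  shows "x = 0"
proof -
  obtain f where f: "square_integrable f" "x = class_l2 f" by (rule l2_cases)
  have "AE t in period_measure. f t $ i = 0" for i
  proof (rule fourier_null_AE_zero)
    have int: "integrable period_measure (\<lambda>t. cexp m t *s f t)" for m
      using f by (intro square_integrable_integrable square_integrable_cexp_mult)
    have "integral\<^sup>L period_measure (\<lambda>t. cexp m t *s f t) = 0" for m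
      using assms[of "- m"] f by (simp add: fcoeff_class)
    then have "integral\<^sup>L period_measure (\<lambda>t. (cexp m t *s f t) $ i) = 0" for m
      using integral_bounded_linear[OF bounded_linear_vec_nth int] by simp
    moreover have "integrable period_measure (\<lambda>t. f t $ i)"
      by (rule integrable_bounded_linear[OF bounded_linear_vec_nth square_integrable_integrable[OF f(1)]])
    ultimately show "fourier_null (\<lambda>t. f t $ i)"
      by (simp add: fourier_null_def)
  qed
  then have "AE t in period_measure. \<forall>i. f t $ i = 0"
    by (simp add: AE_all_countable)
  then have "AE t in period_measure. f t = 0"
    by eventually_elim (simp add: vec_eq_iff)
  then show ?thesis
    using f by (simp add: zero_l2_def class_l2_eq_iff square_integrable_zero)
qed

lemma fcoeff_inject: "(\<And>m. fcoeff x m = fcoeff y m) \<Longrightarrow> x = y"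
  using fcoeff_eq_zero[of "x - y"] by (simp add: fcoeff_diff)

section \<open>Bessel, Riesz-Fischer and Parseval\<close>

lemma inner_mode: "inner (fourier_mode m v) x = 2 * pi * inner v (fcoeff x m)"
  using l2_inner_mode[of "mat 1" m v x] by (simp add: Re_l2_inner[symmetric] hdot_mat_1 Re_cdot)

lemma norm_partial_sum:
  assumes "finite F"
  shows "(norm (\<Sum>m\<in>F. fourier_mode m (z m)))\<^sup>2 = 2 * pi * (\<Sum>m\<in>F. (norm (z m))\<^sup>2)"
proof -
  let ?S = "\<Sum>m\<in>F. fourier_mode m (z m)"
  have "(norm ?S)\<^sup>2 = inner ?S ?S" by (rule power2_norm_eq_inner)
  also have "\<dots> = (\<Sum>m\<in>F. inner (fourier_mode m (z m)) ?S)" by (rule inner_sum_left)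
  also have "\<dots> = (\<Sum>m\<in>F. 2 * pi * (norm (z m))\<^sup>2)"
    by (intro sum.cong refl) (simp add: inner_mode fcoeff_partial_sum[OF assms] power2_norm_eq_inner)
  finally show ?thesis by (simp add: sum_distrib_left)
qed

lemma norm_remainder:
  assumes "finite F"
  shows "(norm (x - (\<Sum>m\<in>F. fourier_mode m (fcoeff x m))))\<^sup>2 = (norm x)\<^sup>2 - 2 * pi * (\<Sum>m\<in>F. (norm (fcoeff x m))\<^sup>2)"
proof -
  let ?S = "\<Sum>m\<in>F. fourier_mode m (fcoeff x m)"
  have "inner ?S x = 2 * pi * (\<Sum>m\<in>F. (norm (fcoeff x m))\<^sup>2)"
    by (simp add: inner_sum_left inner_mode sum_distrib_left power2_norm_eq_inner[symmetric])
  moreover have "(norm (x - ?S))\<^sup>2 = (norm x)\<^sup>2 - 2 * inner ?S x + (norm ?S)\<^sup>2"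
    by (simp add: power2_norm_eq_inner inner_diff_left inner_diff_right inner_commute)
  ultimately show ?thesis by (simp add: norm_partial_sum[OF assms])
qed

lemma bessel:
  assumes "finite F"
  shows "2 * pi * (\<Sum>m\<in>F. (norm (fcoeff x m))\<^sup>2) \<le> (norm x)\<^sup>2"
  using norm_remainder[OF assms, of x] zero_le_power2[of "norm (x - (\<Sum>m\<in>F. fourier_mode m (fcoeff x m)))"]
  by linarith

text \<open>Riesz-Fischer: the squared distance of two symmetric partial sums is a multiple of an
  increment of the bounded increasing sequence \<open>P\<close>, so they form a Cauchy sequence.
  Continuity of \<open>fcoeff\<close> identifies the coefficients of the limit.\<close>

lemma fourier_synthesis_sequence:
  fixes z :: "int \<Rightarrow> complex^'n"
  assumes bdd: "\<And>F. finite F \<Longrightarrow> (\<Sum>m\<in>F. (norm (z m))\<^sup>2) \<le> B"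
  shows "\<exists>x. (\<forall>m. fcoeff x m = z m) \<and> (\<lambda>N. \<Sum>m\<in>{- int N..int N}. fourier_mode m (z m)) \<longlonglongrightarrow> x"
proof -
  define P where "P N = (\<Sum>m\<in>{- int N..int N}. (norm (z m))\<^sup>2)" for N
  define S where "S N = (\<Sum>m\<in>{- int N..int N}. fourier_mode m (z m))" for N
  have "incseq P" unfolding P_def by (intro incseq_SucI sum_mono2) auto
  moreover have "\<And>N. \<bar>P N\<bar> \<le> B" unfolding P_def using bdd by (simp add: sum_nonneg)
  then have "bounded (range P)" by (auto simp: bounded_iff)
  ultimately have CP: "Cauchy P"
    by (intro LIMSEQ_imp_Cauchy[OF LIMSEQ_incseq_SUP] bounded_imp_bdd_above)
  have diff: "(norm (S N - S M))\<^sup>2 = 2 * pi * (P N - P M)" if "M \<le> N" for M N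
  proof -
    have sub: "{- int M..int M} \<subseteq> {- int N..int N}" using that by auto
    show ?thesis
      unfolding S_def P_def sum_diff[OF _ sub, symmetric, OF finite_atLeastAtMost_int]
      by (rule norm_partial_sum) simp
  qed
  have "Cauchy S"
  proof (rule metric_CauchyI)
    fix e :: real assume e: "e > 0"
    obtain M where M: "\<And>i j. i \<ge> M \<Longrightarrow> j \<ge> M \<Longrightarrow> dist (P i) (P j) < e\<^sup>2 / (2 * pi)"
      using metric_CauchyD[OF CP, of "e\<^sup>2 / (2 * pi)"] e by auto
    have *: "dist (S i) (S j) < e" if "i \<ge> j" "j \<ge> M" for i j
    proof -
      have "(norm (S i - S j))\<^sup>2 = 2 * pi * (P i - P j)" by (rule diff[OF that(1)])
      also have "P i - P j < e\<^sup>2 / (2 * pi)"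
        using M[of i j] that abs_ge_self[of "P i - P j"] by (simp add: dist_real_def)
      then have "2 * pi * (P i - P j) < e\<^sup>2" by (simp add: field_simps)
      finally show ?thesis using e by (simp add: dist_norm power2_less_imp_less)
    qed
    have "dist (S i) (S j) < e" if "i \<ge> M" "j \<ge> M" for i j
      using *[of i j] *[of j i] that by (cases "i \<ge> j") (auto simp: dist_commute)
    then show "\<exists>M. \<forall>i\<ge>M. \<forall>j\<ge>M. dist (S i) (S j) < e" by blast
  qed
  then obtain x where x: "S \<longlonglongrightarrow> x" by (auto simp: Cauchy_convergent_iff convergent_def)
  have "fcoeff x k = z k" for k
  proof (rule LIMSEQ_unique)
    show "(\<lambda>N. fcoeff (S N) k) \<longlonglongrightarrow> fcoeff x k"
      by (rule bounded_linear.tendsto[OF bounded_linear_fcoeff x])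
    have "\<forall>\<^sub>F N in sequentially. z k = fcoeff (S N) k"
      unfolding eventually_sequentially
      by (rule exI[of _ "nat \<bar>k\<bar>"]) (auto simp: S_def fcoeff_partial_sum)
    then show "(\<lambda>N. fcoeff (S N) k) \<longlonglongrightarrow> z k"
      by (rule tendsto_eventually[OF eventually_mono]) simp
  qed
  with x show ?thesis unfolding S_def by blast
qed

theorem fourier_synthesis:
  fixes z :: "int \<Rightarrow> complex^'n"
  assumes "\<And>F. finite F \<Longrightarrow> (\<Sum>m\<in>F. (norm (z m))\<^sup>2) \<le> B"
  obtains x where "\<And>m. fcoeff x m = z m"
  using fourier_synthesis_sequence[OF assms] by blast

text \<open>Symmetric partial sums converge to an element with the coefficients of x, which is x by
  completeness of the exponentials. By \<open>norm_remainder\<close> the error decreases as the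
  finite set grows, and this upgrades the convergence to all finite sets.\<close>

theorem fourier_expansion:
  "((\<lambda>m. fourier_mode m (fcoeff x m)) has_sum x) UNIV"
proof -
  let ?S = "\<lambda>F. \<Sum>m\<in>F. fourier_mode m (fcoeff x m)"
  have "(\<Sum>m\<in>F. (norm (fcoeff x m))\<^sup>2) \<le> (norm x)\<^sup>2 / (2 * pi)" if "finite F" for F
    using bessel[OF that, of x] by (simp add: field_simps)
  from fourier_synthesis_sequence[OF this] obtain y
    where y: "\<And>m. fcoeff y m = fcoeff x m" "(\<lambda>N. ?S {- int N..int N}) \<longlonglongrightarrow> y" by blast
  have "y = x" by (rule fcoeff_inject) (rule y)
  with y have lim: "(\<lambda>N. ?S {- int N..int N}) \<longlonglongrightarrow> x" by simp
  show ?thesis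
    unfolding has_sum_def
  proof (rule tendstoI)
    fix e :: real assume e: "e > 0"
    obtain N where N: "dist (?S {- int N..int N}) x < e"
      using metric_LIMSEQ_D[OF lim e] by blast
    have "dist (?S F) x < e" if F: "finite F" "{- int N..int N} \<subseteq> F" for F
    proof -
      have "(\<Sum>m\<in>{- int N..int N}. (norm (fcoeff x m))\<^sup>2) \<le> (\<Sum>m\<in>F. (norm (fcoeff x m))\<^sup>2)"
        using F by (intro sum_mono2) auto
      then have "(norm (x - ?S F))\<^sup>2 \<le> (norm (x - ?S {- int N..int N}))\<^sup>2"
        using norm_remainder[OF F(1), of x] norm_remainder[of "{- int N..int N}" x] by simp
      then have "norm (x - ?S F) \<le> norm (x - ?S {- int N..int N})"
        by (rule power2_le_imp_le) simp
      then show ?thesis using N by (simp add: dist_norm norm_minus_commute)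
    qed
    then show "\<forall>\<^sub>F F in finite_subsets_at_top UNIV. dist (?S F) x < e"
      unfolding eventually_finite_subsets_at_top by (intro exI[of _ "{- int N..int N}"]) auto
  qed
qed

theorem parseval: "((\<lambda>m. 2 * pi * hdot H (fcoeff x m) (fcoeff y m)) has_sum l2_inner H x y) UNIV"
proof -
  interpret bounded_bilinear "l2_inner H" by (rule bounded_bilinear_l2_inner)
  have "((\<lambda>m. l2_inner H (fourier_mode m (fcoeff x m)) y) has_sum l2_inner H x y) UNIV"
    using has_sum_bounded_linear[OF bounded_linear_left fourier_expansion] by (simp add: o_def)
  then show ?thesis by (simp add: l2_inner_mode)
qed

lemma ip_norm_bounds:
  fixes H :: "complex^'n^'n"
  assumes "pos_def H"
  obtains a b where "a > 0" "b > 0" "\<And>x. norm x \<le> a * ip_norm (l2_inner H) x" "\<And>x. ip_norm (l2_inner H) x \<le> b * norm x"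
proof -
  obtain \<alpha> \<beta> where *: "\<alpha> > 0" "\<beta> > 0"
    "\<And>v. \<alpha> * (norm v)\<^sup>2 \<le> Re (hdot H v v)" "\<And>v. Re (hdot H v v) \<le> \<beta> * (norm v)\<^sup>2"
    using pos_def_bounds[OF assms] by blast
  note b = l2_inner_bounds[OF *(3,4)]
  have "norm x \<le> 1 / sqrt \<alpha> * ip_norm (l2_inner H) x" for x :: "'n l2"
    using real_sqrt_le_mono[OF b(1)[of x]] *(1) by (simp add: real_sqrt_mult ip_norm_def field_simps)
  moreover have "ip_norm (l2_inner H) x \<le> sqrt \<beta> * norm x" for x :: "'n l2"
    using real_sqrt_le_mono[OF b(2)[of x]] by (simp add: real_sqrt_mult ip_norm_def)
  ultimately show ?thesis using that[of "1 / sqrt \<alpha>" "sqrt \<beta>"] * by auto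
qed

text \<open>Lets every limit stated in the weighted norm, for the semigroup, its generator and the
  expansions, be treated as a limit in the class topology.\<close>

lemma ip_norm_tendsto_iff:
  assumes "pos_def H"
  shows "((\<lambda>i. ip_norm (l2_inner H) (f i)) \<longlongrightarrow> 0) F \<longleftrightarrow> (f \<longlongrightarrow> 0) F"
proof -
  obtain a b where ab: "a > 0" "b > 0" "\<And>x. norm x \<le> a * ip_norm (l2_inner H) x" "\<And>x. ip_norm (l2_inner H) x \<le> b * norm x"
    using ip_norm_bounds[OF assms] by blast
  show ?thesis
  proof
    assume "((\<lambda>i. ip_norm (l2_inner H) (f i)) \<longlongrightarrow> 0) F"
    from tendsto_mult_right_zero[OF this, of a] show "(f \<longlongrightarrow> 0) F"
      by (rule Lim_null_comparison[rotated]) (simp add: ab)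
  next
    assume "(f \<longlongrightarrow> 0) F"
    from tendsto_mult_right_zero[OF tendsto_norm_zero[OF this], of b]
    show "((\<lambda>i. ip_norm (l2_inner H) (f i)) \<longlongrightarrow> 0) F"
    proof (rule Lim_null_comparison[rotated], intro always_eventually allI)
      fix i
      have "0 \<le> a * ip_norm (l2_inner H) (f i)" using ab(3)[of "f i"] norm_ge_zero order_trans by blast
      then have "0 \<le> ip_norm (l2_inner H) (f i)" using ab(1) by (simp add: zero_le_mult_iff)
      then show "norm (ip_norm (l2_inner H) (f i)) \<le> b * norm (f i)" using ab(4) by simp
    qed
  qed
qed

text \<open>Expansions exist and are unique, so the description that defines \<open>op_P\<close>
  becomes a statement about coefficients.\<close>

lemma has_fourier_expansion_iff:
  assumes "pos_def H"
  shows "has_fourier_expansion H x z \<longleftrightarrow> (\<forall>m. fcoeff x m = z m)"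
proof
  assume "has_fourier_expansion H x z"
  then have lim: "((\<lambda>F. x - (\<Sum>m\<in>F. fourier_mode m (z m))) \<longlongrightarrow> 0) (finite_subsets_at_top UNIV)"
    unfolding has_fourier_expansion_def ip_norm_tendsto_iff[OF assms] .
  show "\<forall>m. fcoeff x m = z m"
  proof
    fix k
    have "((\<lambda>F. fcoeff (x - (\<Sum>m\<in>F. fourier_mode m (z m))) k) \<longlongrightarrow> fcoeff 0 k) (finite_subsets_at_top UNIV)"
      by (rule bounded_linear.tendsto[OF bounded_linear_fcoeff lim])
    moreover have "\<forall>\<^sub>F F in finite_subsets_at_top UNIV. fcoeff (x - (\<Sum>m\<in>F. fourier_mode m (z m))) k = fcoeff x k - z k"
      unfolding eventually_finite_subsets_at_top
      by (intro exI[of _ "{k}"]) (auto simp: fcoeff_diff fcoeff_partial_sum)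
    ultimately have "((\<lambda>F :: int set. fcoeff x k - z k) \<longlongrightarrow> fcoeff 0 k) (finite_subsets_at_top UNIV)"
      by (rule Lim_transform_eventually)
    then have "fcoeff 0 k = fcoeff x k - z k"
      by (intro tendsto_unique[OF _ _ tendsto_const]) auto
    then show "fcoeff x k = z k" by (simp add: fcoeff_zero)
  qed
next
  assume "\<forall>m. fcoeff x m = z m"
  then have "((\<lambda>F. \<Sum>m\<in>F. fourier_mode m (z m)) \<longlongrightarrow> x) (finite_subsets_at_top UNIV)"
    using fourier_expansion[of x] by (simp add: has_sum_def)
  from tendsto_diff[OF tendsto_const this, of x] show "has_fourier_expansion H x z"
    unfolding has_fourier_expansion_def ip_norm_tendsto_iff[OF assms] by simp
qed

section \<open>The operator on the Fourier modes\<close>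

lemma integrable_continuous_scaleR:
  fixes f :: "real \<Rightarrow> complex^'n"
  assumes "square_integrable f" "continuous_on UNIV \<psi>"
  shows "integrable period_measure (\<lambda>t. \<psi> t *\<^sub>R f t)"
proof -
  have "compact (\<psi> ` {0..2 * pi})"
    by (intro compact_continuous_image continuous_on_subset[OF assms(2)]) auto
  then obtain B where B: "\<And>t. t \<in> {0..2 * pi} \<Longrightarrow> \<bar>\<psi> t\<bar> \<le> B"
    using compact_imp_bounded bounded_iff by (metis imageI real_norm_def)
  show ?thesis
  proof (rule Bochner_Integration.integrable_bound)
    show "integrable period_measure (\<lambda>t. B * norm (f t))"
      using square_integrable_integrable[OF assms(1)] by simp
    show "(\<lambda>t. \<psi> t *\<^sub>R f t) \<in> borel_measurable period_measure"
      using continuous_period_measurable[OF assms(2)] assms(1) by (auto simp: square_integrable_def)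
    show "AE t in period_measure. norm (\<psi> t *\<^sub>R f t) \<le> norm (B * norm (f t))"
    proof (rule AE_I2)
      fix t assume "t \<in> space period_measure"
      then have "\<bar>\<psi> t\<bar> * norm (f t) \<le> B * norm (f t)"
        by (intro mult_right_mono B) (auto simp: space_restrict_space)
      then show "norm (\<psi> t *\<^sub>R f t) \<le> norm (B * norm (f t))"
        using abs_ge_self[of "B * norm (f t)"] by simp
    qed
  qed
qed

lemma has_weak_deriv_class:
  "square_integrable f \<Longrightarrow> square_integrable g \<Longrightarrow>
     has_weak_deriv (class_l2 f) (class_l2 g) \<longleftrightarrow>
       (\<forall>\<phi>. test_function \<phi> \<longrightarrow> integral\<^sup>L period_measure (\<lambda>t. deriv \<phi> t *\<^sub>R f t) =
         - integral\<^sup>L period_measure (\<lambda>t. \<phi> t *\<^sub>R g t))"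
  by (simp add: has_weak_deriv.abs_eq l2_eq_refl)

text \<open>Gives meaning to the definite description in \<open>weak_deriv\<close>: the difference
  of two candidates integrates to zero against all test functions.\<close>

lemma has_weak_deriv_unique:
  assumes "has_weak_deriv x y" "has_weak_deriv x y'"
  shows "y = y'"
proof -
  obtain f where f: "square_integrable f" "x = class_l2 f" by (rule l2_cases)
  obtain g where g: "square_integrable g" "y = class_l2 g" by (rule l2_cases)
  obtain g' where g': "square_integrable g'" "y' = class_l2 g'" by (rule l2_cases)
  let ?d = "\<lambda>t. g t - g' t"
  have d: "square_integrable ?d" by (rule square_integrable_diff[OF g(1) g'(1)])
  have "integral\<^sup>L period_measure (\<lambda>t. \<phi> t *\<^sub>R ?d t) = 0" if \<phi>: "test_function \<phi>" for \<phi>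
    using assms \<phi> f g g' integrable_continuous_scaleR[OF g(1) test_function_continuous(1)[OF \<phi>]]
      integrable_continuous_scaleR[OF g'(1) test_function_continuous(1)[OF \<phi>]]
    by (simp add: has_weak_deriv_class scaleR_diff_right)
  then have test: "integral\<^sup>L period_measure (\<lambda>t. of_real (\<phi> t) * (?d t $ i)) = 0" if \<phi>: "test_function \<phi>" for \<phi> i
    using integral_bounded_linear[OF bounded_linear_vec_nth[of i] integrable_continuous_scaleR[OF d test_function_continuous(1)[OF \<phi>]]] \<phi>
    by (simp add: scaleR_conv_of_real[where 'a=complex])
  have "AE t in period_measure. ?d t $ i = 0" for i
    by (rule test_functions_AE_zero[OF integrable_bounded_linear[OF bounded_linear_vec_nth square_integrable_integrable[OF d]] test])
  then have "AE t in period_measure. \<forall>i. ?d t $ i = 0"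
    by (simp add: AE_all_countable)
  then have "AE t in period_measure. g t = g' t"
    by eventually_elim (simp add: vec_eq_iff)
  then show ?thesis using g g' by (simp add: class_l2_eq_iff)
qed

lemma cexp_has_derivative: "(cexp m has_vector_derivative \<i> * of_int m * cexp m t) (at t within A)"
  unfolding cexp_def[abs_def]
  by (rule has_vector_derivative_real_field) (auto intro!: derivative_eq_intros)

lemma has_weak_deriv_mode: "has_weak_deriv (fourier_mode m v) (fourier_mode m ((\<i> * of_int m) *s v))"
  unfolding fourier_mode_class
proof (subst has_weak_deriv_class[OF square_integrable_mode square_integrable_mode], intro allI impI)
  fix \<phi> assume \<phi>: "test_function \<phi>"
  let ?f = "\<lambda>t. cexp m t *s v" and ?g = "\<lambda>t. cexp m t *s ((\<i> * of_int m) *s v)"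
  have "\<phi> differentiable (at t)" for t
    using \<phi> unfolding test_function_def C1_differentiable_on_eq by auto
  then have d\<phi>: "(\<phi> has_real_derivative deriv \<phi> t) (at t)" for t
    by (simp add: DERIV_deriv_iff_real_differentiable)
  have supp: "\<phi> t = 0" if "t \<notin> {0<..<2 * pi}" for t
    using \<phi> closure_subset[of "{t. \<phi> t \<noteq> 0}"] that unfolding test_function_def by blast
  have "((\<lambda>t. \<phi> t *\<^sub>R ?f t) has_vector_derivative (\<phi> t *\<^sub>R ?g t + deriv \<phi> t *\<^sub>R ?f t)) (at t within {0..2 * pi})" for t
  proof -
    have bl: "bounded_linear (\<lambda>c. c *s v)"
      unfolding linear_conv_bounded_linear[symmetric] by (simp add: linear_iff vec_eq_iff algebra_simps)
    have "(?f has_vector_derivative (\<i> * of_int m * cexp m t) *s v) (at t within {0..2 * pi})"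
      by (rule bounded_linear.has_vector_derivative[OF bl cexp_has_derivative])
    then have "(?f has_vector_derivative ?g t) (at t within {0..2 * pi})"
      by (simp add: vector_smult_assoc mult.commute)
    from has_vector_derivative_scaleR[OF has_field_derivative_at_within[OF d\<phi>] this]
    show ?thesis .
  qed
  then have "((\<lambda>t. \<phi> t *\<^sub>R ?g t + deriv \<phi> t *\<^sub>R ?f t) has_integral (\<phi> (2 * pi) *\<^sub>R ?f (2 * pi) - \<phi> 0 *\<^sub>R ?f 0)) {0..2 * pi}"
    by (intro fundamental_theorem_of_calculus) auto
  then have "integral {0..2 * pi} (\<lambda>t. \<phi> t *\<^sub>R ?g t + deriv \<phi> t *\<^sub>R ?f t) = 0"
    using supp[of 0] supp[of "2 * pi"] by (simp add: integral_unique)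
  moreover have i: "integrable period_measure (\<lambda>t. \<phi> t *\<^sub>R ?g t)" "integrable period_measure (\<lambda>t. deriv \<phi> t *\<^sub>R ?f t)"
    by (intro integrable_continuous_scaleR square_integrable_mode test_function_continuous \<phi>)+
  then have "integrable period_measure (\<lambda>t. \<phi> t *\<^sub>R ?g t + deriv \<phi> t *\<^sub>R ?f t)" by simp
  ultimately have "integral\<^sup>L period_measure (\<lambda>t. \<phi> t *\<^sub>R ?g t + deriv \<phi> t *\<^sub>R ?f t) = 0"
    by (simp add: lebesgue_integral_eq_integral)
  then show "integral\<^sup>L period_measure (\<lambda>t. deriv \<phi> t *\<^sub>R ?f t) = - integral\<^sup>L period_measure (\<lambda>t. \<phi> t *\<^sub>R ?g t)"
    using i by (simp add: eq_neg_iff_add_eq_0 add.commute)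
qed

lemma mult_l2_mode: "mult_l2 M (fourier_mode m v) = fourier_mode m (M *v v)"
  by (simp add: fourier_mode_class l2_class_simps square_integrable_mode matrix_vector_scale)

lemma linear_fourier_mode: "linear (fourier_mode m)"
proof (rule linearI)
  fix v w :: "complex^'a" and r :: real
  show "fourier_mode m (v + w) = fourier_mode m v + fourier_mode m w"
    by (simp add: fourier_mode_class l2_class_simps square_integrable_mode vector_add_ldistrib)
  have "c *s (r *\<^sub>R v) = r *\<^sub>R (c *s v)" for c by (simp add: vec_eq_iff)
  then show "fourier_mode m (r *\<^sub>R v) = r *\<^sub>R fourier_mode m v"
    by (simp add: fourier_mode_class l2_class_simps square_integrable_mode)
qed

lemma weak_deriv_mode: "weak_deriv (fourier_mode m v) = fourier_mode m ((\<i> * of_int m) *s v)"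
  unfolding weak_deriv_def using has_weak_deriv_mode has_weak_deriv_unique by blast

lemma mode_in_domain_A: "fourier_mode m v \<in> domain_A"
  unfolding domain_A_def H1_def
proof (intro CollectI conjI exI)
  show "has_weak_deriv (fourier_mode m v) (fourier_mode m ((\<i> * of_int m) *s v))"
    by (rule has_weak_deriv_mode)
  show "class_l2 (\<lambda>t. cexp m t *s v) = fourier_mode m v" by (simp add: fourier_mode_class)
  show "continuous_on {0..2 * pi} (\<lambda>t. cexp m t *s v)"
    unfolding vector_scalar_mult_def by (intro continuous_intros)
  have "cexp m (2 * pi) = exp ((2 * of_int m * of_real pi) * \<i>)" by (simp add: cexp_def mult_ac)
  also have "\<dots> = 1" using exp_integer_2pi[of "of_int m"] by simp
  finally show "cexp m 0 *s v = cexp m (2 * pi) *s v" by (simp add: cexp_def)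
qed

lemma mat_vector: "mat c *v v = c *s v"
  for v :: "complex^'n"
  by (simp add: vec_eq_iff matrix_vector_mult_def mat_def mult_delta_left cong: if_cong)

lemma matrix_vector_uminus: "(- M) *v v = - (M *v v)"
  for v :: "complex^'n"
  by (simp add: vec_eq_iff matrix_vector_mult_def sum_negf)

lemma Cm_vector: "Cm_mat P1 R H m *v v = - ((\<i> * of_int m) *s (P1 *v (H *v v))) + R *v (H *v v)"
  by (simp add: Cm_mat_def CS_mat_def CH_mat_def matrix_vector_mult_add_rdistrib matrix_vector_mul_assoc[symmetric]
      mat_vector matrix_vector_uminus vector_smult_assoc mult.commute vec_eq_iff)

text \<open>On the mode m the operator acts as (i m P1 - R) H = - C_m, the origin of the equation y'
  = - C_m y.\<close>

lemma op_A_mode: "op_A P1 R H (fourier_mode m v) = fourier_mode m (- (Cm_mat P1 R H m *v v))"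
proof -
  have "op_A P1 R H (fourier_mode m v) = fourier_mode m (P1 *v ((\<i> * of_int m) *s (H *v v)) - R *v (H *v v))"
    by (simp add: op_A_def mult_l2_mode weak_deriv_mode linear_diff[OF linear_fourier_mode])
  then show ?thesis by (simp add: Cm_vector matrix_vector_scale)
qed

section \<open>Linear differential equations\<close>

text \<open>The exponential series of f. It is differentiated coordinatewise, where it is a scalar
  power series.\<close>

lemma linear_ode_solution:
  fixes f :: "'v::euclidean_space \<Rightarrow> 'v"
  assumes f: "linear f"
  obtains y where "y 0 = z" "\<And>s. (y has_vector_derivative f (y s)) (at s)"
proof -
  obtain K where K: "\<And>v. norm (f v) \<le> K * norm v" "K > 0" using linear_bounded_pos[OF f] by blast
  have fk: "norm ((f ^^ k) v) \<le> K ^ k * norm v" for k v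
    by (rule norm_funpow_le) (use K in auto)
  have summ: "summable (\<lambda>k. (s ^ k / fact k) *\<^sub>R (f ^^ k) v)" for s v
  proof (rule summable_comparison_test')
    show "summable (\<lambda>k. (inverse (fact k) *\<^sub>R (\<bar>s\<bar> * K) ^ k) * norm v)"
      by (intro summable_mult2 summable_exp_generic)
    fix k :: nat
    have "norm ((s ^ k / fact k) *\<^sub>R (f ^^ k) v) = \<bar>s\<bar> ^ k / fact k * norm ((f ^^ k) v)"
      by (simp add: power_abs)
    also have "\<dots> \<le> \<bar>s\<bar> ^ k / fact k * (K ^ k * norm v)" by (intro mult_left_mono fk) auto
    finally show "norm ((s ^ k / fact k) *\<^sub>R (f ^^ k) v) \<le> (inverse (fact k) *\<^sub>R (\<bar>s\<bar> * K) ^ k) * norm v"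
      by (simp add: power_mult_distrib field_simps)
  qed
  define y where "y s = (\<Sum>k. (s ^ k / fact k) *\<^sub>R (f ^^ k) z)" for s :: real
  have y: "(\<lambda>k. (s ^ k / fact k) *\<^sub>R (f ^^ k) z) sums y s" for s
    unfolding y_def by (rule summable_sums[OF summ])
  have fy: "(\<lambda>k. (s ^ k / fact k) *\<^sub>R (f ^^ Suc k) z) sums f (y s)" for s
    using bounded_linear.sums[OF linear_conv_bounded_linear[THEN iffD1, OF f] y[of s]]
    by (simp add: linear_scale[OF f])
  show ?thesis
  proof (rule that)
    have "(\<lambda>k. (0 ^ k / fact k) *\<^sub>R (f ^^ k) z) sums z"
      using sums_single[of 0 "\<lambda>_. z"] by (rule sums_cong[THEN iffD1, rotated]) auto
    then show "y 0 = z" using y sums_unique2 by blast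
    fix s
    have "((\<lambda>s. y s \<bullet> b) has_real_derivative f (y s) \<bullet> b) (at s)" for b
    proof -
      define c where "c k = ((f ^^ k) z \<bullet> b) / fact k" for k
      have ser: "(\<lambda>k. c k * u ^ k) sums (y u \<bullet> b)" for u
        using bounded_linear.sums[OF bounded_linear_inner_left y[of u], of b] by (simp add: c_def mult_ac)
      have "((\<lambda>x. \<Sum>k. c k * x ^ k) has_real_derivative (\<Sum>k. diffs c k * s ^ k)) (at s)"
        by (rule termdiffs_strong_converges_everywhere[OF sums_summable[OF ser]])
      moreover have "(\<Sum>k. c k * x ^ k) = y x \<bullet> b" for x by (rule sums_unique[OF ser, symmetric])
      moreover have "(\<Sum>k. diffs c k * s ^ k) = f (y s) \<bullet> b"
      proof (rule sums_unique[symmetric])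
        have "diffs c k = ((f ^^ Suc k) z \<bullet> b) / fact k" for k
          unfolding diffs_def c_def fact_Suc of_nat_mult by (simp del: of_nat_Suc funpow.simps)
        then have "diffs c k * s ^ k = (s ^ k / fact k) *\<^sub>R (f ^^ Suc k) z \<bullet> b" for k
          by (simp del: funpow.simps)
        then show "(\<lambda>k. diffs c k * s ^ k) sums (f (y s) \<bullet> b)"
          using bounded_linear.sums[OF bounded_linear_inner_left fy[of s], of b] by simp
      qed
      ultimately show ?thesis by simp
    qed
    then show "(y has_vector_derivative f (y s)) (at s)"
      unfolding has_vector_derivative_def has_derivative_componentwise_within[of y]
      by (simp add: has_field_derivative_def mult_commute_abs)
  qed
qed

lemma shifted_solution:
  assumes "\<And>s. (y has_vector_derivative f (y s)) (at s)"
  shows "((\<lambda>s. y (r + s)) has_vector_derivative f (y (r + s))) (at s)"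
proof -
  have "(y \<circ> (\<lambda>s. r + s) has_vector_derivative 1 *\<^sub>R f (y (r + s))) (at s)"
    by (rule vector_diff_chain_at) (use assms in \<open>auto intro!: derivative_eq_intros\<close>)
  then show ?thesis by (simp add: o_def)
qed

text \<open>Banach-Steinhaus with a time interval that may depend on x. The closed sets
  \<open>F n\<close> tie the length 1/(n+1) of the interval and the bound n to one index, so Baire
  makes both uniform at once.\<close>

lemma uniform_boundedness:
  fixes T :: "real \<Rightarrow> 'a::banach \<Rightarrow> 'b::real_normed_vector"
  assumes T: "\<And>t. t \<ge> 0 \<Longrightarrow> bounded_linear (T t)"
    and ptw: "\<And>x. \<exists>\<delta>>0. \<exists>M. \<forall>t\<in>{0..\<delta>}. norm (T t x) \<le> M"
  shows "\<exists>\<delta>>0. \<exists>M. \<forall>t\<in>{0..\<delta>}. \<forall>x. norm (T t x) \<le> M * norm x"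
proof -
  define F where "F n = {x. \<forall>t\<in>{0..1 / real (Suc n)}. norm (T t x) \<le> real n}" for n
  have closed: "closed (F n)" for n
  proof -
    have "F n = (\<Inter>t\<in>{0..1 / real (Suc n)}. {x. norm (T t x) \<le> real n})" by (auto simp: F_def)
    moreover have "closed {x. norm (T t x) \<le> real n}" if "t \<in> {0..1 / real (Suc n)}" for t
      using that T[of t] by (intro closed_Collect_le continuous_intros linear_continuous_on) auto
    ultimately show ?thesis by auto
  qed
  have "(\<Union>n. F n) = UNIV"
  proof (intro equalityI subset_UNIV subsetI)
    fix x
    obtain \<delta> M where \<delta>: "\<delta> > 0" and M: "\<And>t. t \<in> {0..\<delta>} \<Longrightarrow> norm (T t x) \<le> M" using ptw by blast
    obtain n1 where n1: "M \<le> real n1" using real_arch_simple by blast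
    obtain n2 where n2: "1 / \<delta> \<le> real n2" using real_arch_simple by blast
    have "x \<in> F (n1 + n2)"
      unfolding F_def
    proof (intro CollectI ballI)
      fix t assume t: "t \<in> {0..1 / real (Suc (n1 + n2))}"
      have "1 / \<delta> \<le> real (Suc (n1 + n2))" using n2 by simp
      then have "1 / real (Suc (n1 + n2)) \<le> \<delta>" using \<delta> by (simp add: field_simps)
      then have "norm (T t x) \<le> M" using t by (intro M) auto
      then show "norm (T t x) \<le> real (n1 + n2)" using n1 by simp
    qed
    then show "x \<in> (\<Union>n. F n)" by blast
  qed
  moreover have "interior (\<Union>n. F n) = {}" if "\<And>n. interior (F n) = {}"
    using Met_TC.metric_Baire_category_alt[of "range F"] closed that
    by (auto simp: complete_UNIV)
  ultimately obtain n where "interior (F n) \<noteq> {}" by fastforce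
  then obtain x0 r where r: "r > 0" "cball x0 r \<subseteq> F n"
    by (meson all_not_in_conv mem_interior_cball)
  show ?thesis
  proof (intro exI conjI ballI allI)
    show "1 / real (Suc n) > 0" by simp
    fix t x assume t: "t \<in> {0..1 / real (Suc n)}"
    interpret bounded_linear "T t" using T t by auto
    show "norm (T t x) \<le> (2 * real n / r) * norm x"
    proof (cases "x = 0")
      case False
      define v where "v = (r / norm x) *\<^sub>R x"
      have "norm v = r" using False r by (simp add: v_def)
      then have "x0 + v \<in> F n" "x0 \<in> F n" using r by (auto intro!: subsetD[OF r(2)] simp: dist_norm)
      then have "norm (T t (x0 + v)) \<le> real n" "norm (T t x0) \<le> real n" using t by (auto simp: F_def)
      moreover have "T t v = T t (x0 + v) - T t x0" by (simp add: add)
      ultimately have "norm (T t v) \<le> 2 * real n"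
        using norm_triangle_ineq4[of "T t (x0 + v)" "T t x0"] by simp
      moreover have "norm (T t v) = r / norm x * norm (T t x)" using r by (simp add: v_def scaleR)
      ultimately show ?thesis using r False by (simp add: field_simps)
    qed (simp add: zero)
  qed
qed

section \<open>The semigroup on the Fourier modes\<close>

locale port_hamiltonian =
  fixes P1 R H :: "complex^'n^'n" and T :: "real \<Rightarrow> 'n l2 \<Rightarrow> 'n l2"
  assumes P1: "hermitian P1" and R: "pos_semidef R" and H: "pos_def H"
    and gen: "generates_c0_semigroup scaleC_l2 (l2_inner H) domain_A (op_A P1 R H) T"
begin

abbreviation "Cm \<equiv> Cm_mat P1 R H"

lemma c0: "c0_semigroup scaleC_l2 (l2_inner H) T"
  using gen by (simp add: generates_c0_semigroup_def)

lemma T_zero: "T 0 x = x"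
  using c0 by (simp add: c0_semigroup_def)

lemma T_add: "t \<ge> 0 \<Longrightarrow> r \<ge> 0 \<Longrightarrow> T (t + r) x = T t (T r x)"
  using c0 by (simp add: c0_semigroup_def)

lemma T_bounded_linear:
  assumes "t \<ge> 0"
  shows "bounded_linear (T t)"
proof -
  have bo: "bounded_operator scaleC_l2 (l2_inner H) (T t)"
    using c0 assms by (simp add: c0_semigroup_def)
  then have lin: "Vector_Spaces.linear scaleC_l2 scaleC_l2 (T t)" by (simp add: bounded_operator_def)
  obtain K where K: "\<And>x. ip_norm (l2_inner H) (T t x) \<le> K * ip_norm (l2_inner H) x"
    using bo unfolding bounded_operator_def by blast
  obtain a b where ab: "a > 0" "b > 0" "\<And>x :: 'n l2. norm x \<le> a * ip_norm (l2_inner H) x"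
    "\<And>x :: 'n l2. ip_norm (l2_inner H) x \<le> b * norm x"
    using ip_norm_bounds[OF H] by blast
  show ?thesis
  proof
    show "T t (x + y) = T t x + T t y" for x y
      using lin by (simp add: Vector_Spaces.linear_iff)
    show "T t (r *\<^sub>R x) = r *\<^sub>R T t x" for r x
      using lin by (simp add: Vector_Spaces.linear_iff scaleC_of_real[symmetric])
    show "\<exists>K. \<forall>x. norm (T t x) \<le> norm x * K"
    proof (intro exI allI)
      fix x
      have ip0: "0 \<le> ip_norm (l2_inner H) x" using ab(1) ab(3)[of x] norm_ge_zero[of x]
        by (smt (verit) mult_pos_neg)
      have "norm (T t x) \<le> a * ip_norm (l2_inner H) (T t x)" by (rule ab)
      also have "\<dots> \<le> a * (\<bar>K\<bar> * ip_norm (l2_inner H) x)"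
        using K[of x] mult_right_mono[OF abs_ge_self[of K] ip0] ab(1) by (intro mult_left_mono) auto
      also have "\<dots> \<le> a * (\<bar>K\<bar> * (b * norm x))"
        using ab by (intro mult_left_mono) auto
      finally show "norm (T t x) \<le> norm x * (a * \<bar>K\<bar> * b)" by (simp add: mult_ac)
    qed
  qed
qed

lemma T_continuous_0: "((\<lambda>t. T t x - x) \<longlongrightarrow> 0) (at_right 0)"
  using c0 unfolding c0_semigroup_def ip_norm_tendsto_iff[OF H] by blast

lemma generator_limit:
  assumes "x \<in> domain_A"
  shows "((\<lambda>t. (1 / t) *\<^sub>R (T t x - x) - op_A P1 R H x) \<longlongrightarrow> 0) (at_right 0)"
  using gen assms unfolding generates_c0_semigroup_def has_generator_value_def ip_norm_tendsto_iff[OF H] by blast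

text \<open>Strong continuity bounds each orbit near 0, \<open>uniform_boundedness\<close> makes
  this uniform on some [0, \<delta>], and the semigroup law reaches t0 in N steps at the cost of the
  N-th power of the bound.\<close>

lemma T_locally_bounded:
  assumes "t0 \<ge> 0"
  obtains M where "M \<ge> 1" "\<And>t x. 0 \<le> t \<Longrightarrow> t \<le> t0 \<Longrightarrow> norm (T t x) \<le> M * norm x"
proof -
  have "\<exists>\<delta>>0. \<exists>M. \<forall>t\<in>{0..\<delta>}. norm (T t x) \<le> M" for x
  proof -
    have "\<forall>\<^sub>F t in at_right 0. dist (T t x - x) 0 < 1"
      by (rule tendstoD[OF T_continuous_0]) simp
    then obtain b where b: "b > 0" "\<And>t. 0 < t \<Longrightarrow> t < b \<Longrightarrow> norm (T t x - x) < 1"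
      by (auto simp: eventually_at_right_field dist_norm)
    have "norm (T t x) \<le> norm x + 1" if "t \<in> {0..b / 2}" for t
    proof (cases "t = 0")
      case False
      then have "norm (T t x - x) < 1" using that b by (intro b(2)) auto
      then show ?thesis using norm_triangle_ineq[of x "T t x - x"] by simp
    qed (simp add: T_zero)
    then show ?thesis using b(1) by (intro exI[of _ "b / 2"] exI[of _ "norm x + 1"] conjI) auto
  qed
  from uniform_boundedness[OF T_bounded_linear this] obtain \<delta> M where \<delta>: "\<delta> > 0"
    and M: "\<And>t x. t \<in> {0..\<delta>} \<Longrightarrow> norm (T t x) \<le> M * norm x" by blast
  define M' where "M' = max 1 M"
  have M': "M' \<ge> 1" "norm (T t x) \<le> M' * norm x" if "t \<in> {0..\<delta>}" for t x
    using M[OF that, of x] mult_right_mono[of M M' "norm x"] by (auto simp: M'_def)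
  have pow: "norm (T t x) \<le> M' ^ N * norm x" if "0 \<le> t" "t \<le> real N * \<delta>" for N t x
    using that
  proof (induction N arbitrary: t)
    case (Suc N)
    have M1: "1 \<le> M'" by (simp add: M'_def)
    show ?case
    proof (cases "t \<le> \<delta>")
      case True
      have "norm (T t x) \<le> M' * norm x" using M' True Suc.prems by auto
      also have "\<dots> \<le> M' ^ Suc N * norm x"
        using M1 power_increasing[of 1 "Suc N" M'] by (intro mult_right_mono) auto
      finally show ?thesis .
    next
      case False
      then have "T t x = T \<delta> (T (t - \<delta>) x)" using T_add[of \<delta> "t - \<delta>" x] \<delta> by simp
      then have "norm (T t x) \<le> M' * norm (T (t - \<delta>) x)" using M'(2)[of \<delta>] \<delta> by simp
      also have "\<dots> \<le> M' * (M' ^ N * norm x)"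
        using M1 False Suc.prems by (intro mult_left_mono Suc.IH) (auto simp: algebra_simps)
      finally show ?thesis by (simp add: mult.assoc)
    qed
  qed (simp add: T_zero)
  obtain N where "t0 / \<delta> \<le> real N" using real_arch_simple by blast
  then have N: "t0 \<le> real N * \<delta>" using \<delta> by (simp add: field_simps)
  show ?thesis
  proof (rule that)
    show "1 \<le> M' ^ N" by (intro one_le_power) (simp add: M'_def)
    show "norm (T t x) \<le> M' ^ N * norm x" if "0 \<le> t" "t \<le> t0" for t x
      using pow[of t N x] that N by auto
  qed
qed

lemma norm_mode: "norm (fourier_mode m v) = sqrt (2 * pi) * norm v"
proof -
  have "(norm (fourier_mode m v))\<^sup>2 = (sqrt (2 * pi) * norm v)\<^sup>2"
    using norm_partial_sum[of "{m}" "\<lambda>_. v"] by (simp add: power_mult_distrib)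
  then show ?thesis by (rule power2_eq_imp_eq) auto
qed

text \<open>The generator limit is taken on the finitely many basis vectors; linearity in v then
  makes the error uniform relative to |v|. This is the consistency estimate for
  \<open>T_mode\<close>.\<close>

lemma mode_local_error:
  assumes "e > 0"
  shows "\<exists>\<delta>>0. \<forall>h v. 0 < h \<longrightarrow> h < \<delta> \<longrightarrow>
    norm (T h (fourier_mode m v) - fourier_mode m v - h *\<^sub>R fourier_mode m (- (Cm m *v v))) \<le> e * h * norm v"
proof -
  let ?err = "\<lambda>h v. T h (fourier_mode m v) - fourier_mode m v - h *\<^sub>R fourier_mode m (- (Cm m *v v))"
  have "((\<lambda>h. \<Sum>b\<in>Basis. norm ((1 / h) *\<^sub>R (T h (fourier_mode m b) - fourier_mode m b) - op_A P1 R H (fourier_mode m b))) \<longlongrightarrow> (\<Sum>b\<in>(Basis::(complex^'n) set). 0)) (at_right 0)"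
    by (intro tendsto_sum tendsto_norm_zero generator_limit mode_in_domain_A)
  from tendstoD[OF this assms] have "\<forall>\<^sub>F h in at_right 0. dist (\<Sum>b\<in>(Basis::(complex^'n) set). norm ((1 / h) *\<^sub>R (T h (fourier_mode m b) - fourier_mode m b) - op_A P1 R H (fourier_mode m b))) 0 < e"
    by simp
  then obtain \<delta> where \<delta>: "\<delta> > 0" and small: "\<And>h. 0 < h \<Longrightarrow> h < \<delta> \<Longrightarrow>
      (\<Sum>b\<in>(Basis::(complex^'n) set). norm ((1 / h) *\<^sub>R (T h (fourier_mode m b) - fourier_mode m b) - op_A P1 R H (fourier_mode m b))) < e"
    by (auto simp: eventually_at_right_field sum_nonneg)
  show ?thesis
  proof (intro exI[of _ \<delta>] conjI allI impI \<delta>)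
    fix h v assume h: "0 < h" "h < \<delta>"
    interpret T: bounded_linear "T h" by (rule T_bounded_linear) (use h in simp)
    have lin: "linear (?err h)"
      by (rule linearI) (simp_all add: linear_add[OF linear_fourier_mode] linear_scale[OF linear_fourier_mode]
        linear_neg[OF linear_fourier_mode] linear_diff[OF linear_fourier_mode]
        linear_add[OF linear_matrix_vector] linear_scale[OF linear_matrix_vector] T.add T.scaleR algebra_simps)
    have b: "?err h b = h *\<^sub>R ((1 / h) *\<^sub>R (T h (fourier_mode m b) - fourier_mode m b) - op_A P1 R H (fourier_mode m b))" for b
      using h by (simp add: op_A_mode algebra_simps)
    have "?err h v = ?err h (\<Sum>b\<in>Basis. (v \<bullet> b) *\<^sub>R b)" by (simp add: euclidean_representation)
    also have "\<dots> = (\<Sum>b\<in>Basis. (v \<bullet> b) *\<^sub>R ?err h b)"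
      using linear_sum[OF lin, of "\<lambda>b. (v \<bullet> b) *\<^sub>R b" Basis] linear_scale[OF lin] by simp
    also have "norm \<dots> \<le> (\<Sum>b\<in>Basis. norm v * (h * norm ((1 / h) *\<^sub>R (T h (fourier_mode m b) - fourier_mode m b) - op_A P1 R H (fourier_mode m b))))"
    proof (rule sum_norm_le)
      fix b :: "complex^'n" assume "b \<in> Basis"
      then have "\<bar>v \<bullet> b\<bar> \<le> norm v" by (rule Basis_le_norm)
      then show "norm ((v \<bullet> b) *\<^sub>R ?err h b) \<le> norm v * (h * norm ((1 / h) *\<^sub>R (T h (fourier_mode m b) - fourier_mode m b) - op_A P1 R H (fourier_mode m b)))"
        unfolding b norm_scaleR abs_of_pos[OF h(1)] using h by (intro mult_right_mono) auto
    qed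
    also have "\<dots> = norm v * h * (\<Sum>b\<in>Basis. norm ((1 / h) *\<^sub>R (T h (fourier_mode m b) - fourier_mode m b) - op_A P1 R H (fourier_mode m b)))"
      by (simp add: sum_distrib_left mult_ac)
    also have "\<dots> \<le> norm v * h * e" using small[OF h] h by (intro mult_left_mono) auto
    finally show "norm (?err h v) \<le> e * h * norm v" by (simp add: mult_ac)
  qed
qed

text \<open>Consistency of the splitting into steps of length \<open>t / N\<close> and stability of \<open>T\<close> give
  convergence, as in the Lax equivalence theorem.\<close>

theorem T_mode:
  assumes y: "\<And>s. (y has_vector_derivative - (Cm m *v y s)) (at s)" and t: "t \<ge> 0"
  shows "T t (fourier_mode m (y 0)) = fourier_mode m (y t)"
proof (cases "t = 0")
  case False
  with t have t: "t > 0" by simp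
  obtain M where M: "M \<ge> 1" "\<And>s x. 0 \<le> s \<Longrightarrow> s \<le> t \<Longrightarrow> norm (T s x) \<le> M * norm x"
    using T_locally_bounded[of t] t by auto
  define B where "B v = - (Cm m *v v)" for v
  have B: "linear B" unfolding B_def by (intro linear_compose_neg linear_matrix_vector)
  have yB: "(y has_vector_derivative B (y s)) (at s)" for s using y by (simp add: B_def)
  obtain K where K: "\<And>v. norm (B v) \<le> K * norm v" "K > 0" using linear_bounded_pos[OF B] by blast
  have "continuous_on {0..t} y"
    using yB by (intro continuous_at_imp_continuous_on ballI has_vector_derivative_continuous)
  then have "bounded (y ` {0..t})" by (intro compact_imp_bounded compact_continuous_image) auto
  then obtain Y0 where "\<forall>x\<in>y ` {0..t}. norm x \<le> Y0" unfolding bounded_iff by blast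
  then have Y0: "\<And>s. s \<in> {0..t} \<Longrightarrow> norm (y s) \<le> Y0" by blast
  define Y where "Y = max 1 Y0"
  have Y: "Y \<ge> 1" "\<And>s. s \<in> {0..t} \<Longrightarrow> norm (y s) \<le> Y" using Y0 by (auto simp: Y_def le_max_iff_disj)
  define c where "c = sqrt (2 * pi) * (K\<^sup>2 * Y)"
  have c: "c \<ge> 0" using Y K by (simp add: c_def)
  let ?D = "\<lambda>s. fourier_mode m (y s)"
  have bound: "norm (T t (?D 0) - ?D t) \<le> e" if e: "e > 0" for e
  proof -
    \<comment> \<open>A single step may err by h e / (t M), so that N = t / h steps, each amplified
      by M, add up to e. Half is allotted to the generator error through \<open>e1\<close>, half to
      the Taylor remainder of y through \<open>d\<close>.\<close>
    define e1 where "e1 = e / (2 * t * M * Y)"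
    have e1: "e1 > 0" using e t M Y by (simp add: e1_def)
    obtain \<delta> where \<delta>: "\<delta> > 0" and err: "\<And>h v. 0 < h \<Longrightarrow> h < \<delta> \<Longrightarrow>
        norm (T h (fourier_mode m v) - fourier_mode m v - h *\<^sub>R fourier_mode m (B v)) \<le> e1 * h * norm v"
      using mode_local_error[OF e1, of m] unfolding B_def by blast
    define d where "d = min \<delta> (e / (2 * t * M * (c + 1)))"
    have d: "d > 0" using \<delta> e t M c by (simp add: d_def)
    obtain N where N: "t / d < real N" using reals_Archimedean2 by blast
    then have N0: "N > 0" using t d by (metis divide_pos_pos gr0I less_asym of_nat_0)
    define h where "h = t / real N"
    have h: "h > 0" "h < d" "real N * h = t" using N t d N0 by (auto simp: h_def field_simps)
    have local: "norm (T h (?D (real j * h)) - ?D (real (Suc j) * h)) \<le> h * (e / (t * M))" if j: "j < N" for j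
    proof -
      define s where "s = real j * h"
      have "real (Suc j) * h \<le> real N * h" using j h by (intro mult_right_mono) auto
      then have s: "s \<in> {0..t}" "s + h \<le> t" using h by (auto simp: s_def algebra_simps)
      have ys: "norm (y s) \<le> Y" by (rule Y(2)[OF s(1)])
      have a: "norm (T h (?D s) - ?D s - h *\<^sub>R fourier_mode m (B (y s))) \<le> e1 * h * norm (y s)"
        using h d by (intro err) (auto simp: d_def)
      have "norm (y (s + h) - (\<Sum>j<2. (h ^ j / fact j) *\<^sub>R (B ^^ j) (y (s + 0)))) \<le> K ^ 2 * Y * h ^ 2"
        by (rule norm_taylor_remainder_le[OF B K(1) shifted_solution[where f = B, OF yB], where T = h])
          (use Y s h K in auto)
      then have b: "norm (y (s + h) - y s - h *\<^sub>R B (y s)) \<le> K\<^sup>2 * Y * h\<^sup>2"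
        by (simp add: numeral_2_eq_2 algebra_simps)
      have b': "norm (?D (s + h) - ?D s - h *\<^sub>R fourier_mode m (B (y s))) \<le> c * h\<^sup>2"
      proof -
        have "?D (s + h) - ?D s - h *\<^sub>R fourier_mode m (B (y s)) = fourier_mode m (y (s + h) - y s - h *\<^sub>R B (y s))"
          by (simp add: linear_diff[OF linear_fourier_mode] linear_scale[OF linear_fourier_mode])
        then have "norm (?D (s + h) - ?D s - h *\<^sub>R fourier_mode m (B (y s))) = sqrt (2 * pi) * norm (y (s + h) - y s - h *\<^sub>R B (y s))"
          by (simp add: norm_mode)
        also have "\<dots> \<le> sqrt (2 * pi) * (K\<^sup>2 * Y * h\<^sup>2)" by (intro mult_left_mono b) auto
        finally show ?thesis by (simp add: c_def mult_ac)
      qed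
      have "norm (T h (?D s) - ?D (s + h)) \<le> norm (T h (?D s) - ?D s - h *\<^sub>R fourier_mode m (B (y s)))
          + norm (?D (s + h) - ?D s - h *\<^sub>R fourier_mode m (B (y s)))"
        by (rule order_trans[OF _ norm_triangle_ineq4]) simp
      also have "\<dots> \<le> e1 * h * Y + c * h\<^sup>2"
      proof -
        have "e1 * h * norm (y s) \<le> e1 * h * Y" using ys e1 h by (intro mult_left_mono) auto
        then show ?thesis using a b' by linarith
      qed
      also have "c * h\<^sup>2 \<le> (c + 1) * (h * d)"
        using c h by (simp add: power2_eq_square mult_mono)
      also have "(c + 1) * (h * d) \<le> (c + 1) * (h * (e / (2 * t * M * (c + 1))))"
        using c h by (intro mult_left_mono) (auto simp: d_def)
      also have "e1 * h * Y + (c + 1) * (h * (e / (2 * t * M * (c + 1)))) = h * (e / (t * M))"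
        using t M Y c by (simp add: e1_def divide_simps)
      finally show ?thesis by (simp add: s_def algebra_simps)
    qed
    have tel: "norm (T (real j * h) (?D 0) - ?D (real j * h)) \<le> M * (real j * (h * (e / (t * M))))" if j: "j \<le> N" for j
    proof -
      \<comment> \<open>Telescoping: the local error of step i is propagated by T over the remaining
        steps.\<close>
      have eq: "T (real j * h) (?D 0) - ?D (real j * h)
          = (\<Sum>i<j. T (real (j - Suc i) * h) (T h (?D (real i * h)) - ?D (real (Suc i) * h)))"
      proof -
        let ?g = "\<lambda>i. T (real (j - i) * h) (?D (real i * h))"
        have "(\<Sum>i<j. T (real (j - Suc i) * h) (T h (?D (real i * h)) - ?D (real (Suc i) * h))) = (\<Sum>i<j. ?g i - ?g (Suc i))"
        proof (rule sum.cong[OF refl])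
          fix i assume i: "i \<in> {..<j}"
          have step: "real (j - i) * h = real (j - Suc i) * h + h" using i by (simp add: of_nat_diff algebra_simps)
          have "?g i = T (real (j - Suc i) * h) (T h (?D (real i * h)))"
            unfolding step by (rule T_add) (use h in auto)
          moreover have "bounded_linear (T (real (j - Suc i) * h))" using h by (intro T_bounded_linear) auto
          ultimately show "T (real (j - Suc i) * h) (T h (?D (real i * h)) - ?D (real (Suc i) * h)) = ?g i - ?g (Suc i)"
            by (simp add: linear_diff[OF bounded_linear.linear])
        qed
        also have "\<dots> = ?g 0 - ?g j" by (rule sum_lessThan_telescope')
        finally show ?thesis by (simp add: T_zero)
      qed
      have "norm (\<Sum>i<j. T (real (j - Suc i) * h) (T h (?D (real i * h)) - ?D (real (Suc i) * h)))
          \<le> (\<Sum>i<j. M * (h * (e / (t * M))))"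
      proof (rule sum_norm_le)
        fix i assume i: "i \<in> {..<j}"
        have "real (j - Suc i) * h \<le> real N * h" using j h by (intro mult_right_mono) auto
        then have "norm (T (real (j - Suc i) * h) (T h (?D (real i * h)) - ?D (real (Suc i) * h)))
            \<le> M * norm (T h (?D (real i * h)) - ?D (real (Suc i) * h))"
          using h by (intro M(2)) auto
        also have "\<dots> \<le> M * (h * (e / (t * M)))"
          using M(1) i j by (intro mult_left_mono local) auto
        finally show "norm (T (real (j - Suc i) * h) (T h (?D (real i * h)) - ?D (real (Suc i) * h))) \<le> M * (h * (e / (t * M)))" .
      qed
      also have "\<dots> = M * (real j * (h * (e / (t * M))))"
        by (simp only: sum_constant card_lessThan mult.left_commute)
      finally show ?thesis unfolding eq .
    qed
    have "M * (real N * (h * (e / (t * M)))) = (real N * h) * (e / t)" using M by simp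
    also have "\<dots> = e" using h(3) t by simp
    finally show ?thesis using tel[of N] h(3) by simp
  qed
  then have "norm (T t (?D 0) - ?D t) \<le> 0" by (rule field_le_epsilon[of _ 0, simplified])
  then show ?thesis by simp
qed (simp add: T_zero)

lemma mode_solution:
  obtains y where "y 0 = z" "\<And>s. (y has_vector_derivative - (Cm m *v y s)) (at s)"
  using linear_ode_solution[of "\<lambda>v. - (Cm m *v v)" z] linear_compose_neg[OF linear_matrix_vector] by metis

text \<open>T t is continuous and maps every mode into itself, so in the expansion of x only the
  mode m contributes to the m-th coefficient.\<close>

theorem fcoeff_T:
  assumes y: "\<And>s. (y has_vector_derivative - (Cm m *v y s)) (at s)" and y0: "y 0 = fcoeff x m" and t: "t \<ge> 0"
  shows "fcoeff (T t x) m = y t"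
proof -
  have "\<exists>y. y 0 = fcoeff x k \<and> (\<forall>s. (y has_vector_derivative - (Cm k *v y s)) (at s))" for k
    using mode_solution by metis
  then obtain Y where Y: "\<And>k. Y k 0 = fcoeff x k" "\<And>k s. (Y k has_vector_derivative - (Cm k *v Y k s)) (at s)"
    by metis
  \<comment> \<open>The given y takes the place of the chosen solution for the mode m, since the
    conclusion is about y itself.\<close>
  define Z where "Z = Y(m := y)"
  have Z: "Z k 0 = fcoeff x k" "(Z k has_vector_derivative - (Cm k *v Z k s)) (at s)" for k s
    using Y y y0 by (auto simp: Z_def)
  have "((\<lambda>k. fcoeff (T t (fourier_mode k (fcoeff x k))) m) has_sum fcoeff (T t x) m) UNIV"
    using has_sum_bounded_linear[OF bounded_linear_compose[OF bounded_linear_fcoeff T_bounded_linear[OF t]] fourier_expansion[of x]]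
    by (simp add: o_def)
  moreover have "fcoeff (T t (fourier_mode k (fcoeff x k))) m = (if k = m then y t else 0)" for k
  proof -
    have "T t (fourier_mode k (fcoeff x k)) = fourier_mode k (Z k t)"
      using T_mode[where m = k and y = "Z k", OF Z(2) t] by (simp only: Z(1))
    then show ?thesis by (simp add: fcoeff_mode Z_def)
  qed
  ultimately have "((\<lambda>k. if k = m then y t else 0) has_sum fcoeff (T t x) m) UNIV" by simp
  moreover have "((\<lambda>k. if k = m then y t else 0) has_sum y t) UNIV"
    using has_sum_finite_neutralI[of "{m}" UNIV "\<lambda>k. if k = m then y t else 0"] by simp
  ultimately show ?thesis by (rule has_sum_unique)
qed

text \<open>The coefficients of the difference quotient of T are difference quotients of a solution
  of the mode equation; comparing limits takes the place of an integration by parts with boundary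
  values.\<close>

theorem fcoeff_op_A:
  assumes x: "x \<in> domain_A"
  shows "fcoeff (op_A P1 R H x) m = - (Cm m *v fcoeff x m)"
proof -
  obtain y where y: "y 0 = fcoeff x m" "\<And>s. (y has_vector_derivative - (Cm m *v y s)) (at s)"
    using mode_solution by metis
  have "((\<lambda>t. fcoeff ((1 / t) *\<^sub>R (T t x - x) - op_A P1 R H x) m) \<longlongrightarrow> fcoeff 0 m) (at_right 0)"
    by (rule bounded_linear.tendsto[OF bounded_linear_fcoeff generator_limit[OF x]])
  moreover have "\<forall>\<^sub>F t in at_right 0. fcoeff ((1 / t) *\<^sub>R (T t x - x) - op_A P1 R H x) m
      = (1 / t) *\<^sub>R (y t - y 0) - fcoeff (op_A P1 R H x) m"
    using eventually_at_right_less[of "0::real"]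
    by eventually_elim (simp add: fcoeff_diff fcoeff_scaleR fcoeff_T[OF y(2,1)] y(1))
  ultimately have "((\<lambda>t. (1 / t) *\<^sub>R (y t - y 0) - fcoeff (op_A P1 R H x) m) \<longlongrightarrow> 0) (at_right 0)"
    by (simp add: fcoeff_zero Lim_transform_eventually)
  from tendsto_add[OF this tendsto_const[of "fcoeff (op_A P1 R H x) m"]]
  have "((\<lambda>t. (1 / t) *\<^sub>R (y t - y 0)) \<longlongrightarrow> fcoeff (op_A P1 R H x) m) (at_right 0)" by simp
  moreover have "((\<lambda>t. (1 / t) *\<^sub>R (y t - y 0)) \<longlongrightarrow> - (Cm m *v y 0)) (at_right 0)"
  proof -
    have "(y has_derivative (\<lambda>h. h *\<^sub>R - (Cm m *v y 0))) (at 0 within {0<..})"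
      using y(2)[of 0] has_derivative_at_withinI unfolding has_vector_derivative_def by blast
    then have lim: "((\<lambda>t. (1 / norm (t - 0)) *\<^sub>R (y t - (y 0 + (t - 0) *\<^sub>R - (Cm m *v y 0)))) \<longlongrightarrow> 0) (at_right 0)"
      by (simp add: has_derivative_within)
    have "\<forall>\<^sub>F t in at_right 0. (1 / norm (t - 0)) *\<^sub>R (y t - (y 0 + (t - 0) *\<^sub>R - (Cm m *v y 0)))
        = (1 / t) *\<^sub>R (y t - y 0) - - (Cm m *v y 0)"
      using eventually_at_right_less[of "0::real"]
      by eventually_elim (simp add: scaleR_diff_right scaleR_add_right)
    from Lim_transform_eventually[OF lim this] show ?thesis by (subst (asm) LIM_zero_iff)
  qed
  ultimately have "fcoeff (op_A P1 R H x) m = - (Cm m *v y 0)"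
    by (rule tendsto_unique[rotated]) simp
  then show ?thesis by (simp add: y(1))
qed

end

section \<open>Hypocoercivity of the generator\<close>

context port_hamiltonian
begin

text \<open>\<open>S\<close>, \<open>C\<close> and \<open>h\<close> are destined for the parameters
  of \<open>hypocoercive_pair\<close>; for this the space \<open>complex^'n\<close> is regarded as
  real Euclidean, and \<open>h\<close> is the real part of the weighted product.\<close>

definition S :: "complex^'n \<Rightarrow> complex^'n" where "S v = CS_mat P1 H *v v"
definition C :: "complex^'n \<Rightarrow> complex^'n" where "C v = CH_mat R H *v v"
definition h :: "complex^'n \<Rightarrow> complex^'n \<Rightarrow> real" where "h v w = Re (hdot H v w)"

lemma H_hermitian: "hermitian H" and R_hermitian: "hermitian R"
  using H R by (auto simp: pos_def_def pos_semidef_def)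

lemma linear_S: "linear S" and linear_C: "linear C"
  unfolding S_def[abs_def] C_def[abs_def] by simp_all

lemma S_scale: "S (c *s v) = c *s S v" and C_scale: "C (c *s v) = c *s C v"
  by (simp_all add: S_def C_def matrix_vector_scale)

lemma S_eq: "S v = - (\<i> *s (P1 *v (H *v v)))" and C_eq: "C v = R *v (H *v v)"
  by (simp_all add: S_def C_def CS_mat_def CH_mat_def matrix_vector_uminus matrix_vector_mul_assoc[symmetric] mat_vector)

lemma Cm_eq: "Cm m *v v = of_int m *\<^sub>R S v + C v"
  by (simp add: Cm_vector S_eq C_eq vec_eq_iff complex_eq_iff)

lemma Cm_zero: "Cm 0 *v v = C v" and Cm_one: "Cm 1 *v v = S v + C v"
  by (simp_all add: Cm_eq)

sublocale hd: bounded_bilinear "hdot H" by (rule bounded_bilinear_hdot)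

lemma bounded_bilinear_h: "bounded_bilinear h"
  unfolding bilinear_conv_bounded_bilinear[symmetric] bilinear_def linear_iff
  by (simp add: h_def hd.add_left hd.add_right hd.scaleR_left hd.scaleR_right)

lemma h_sym: "h x y = h y x"
  unfolding h_def by (subst hdot_commute[OF H_hermitian, symmetric]) simp

lemma hdot_S: "hdot H (S x) y = - hdot H x (S y)"
proof -
  have "hdot H (S x) y = \<i> * cdot (P1 *v (H *v x)) (H *v y)"
    using cdot_scale_left[of \<i> "P1 *v (H *v x)" "H *v y"]
      bounded_bilinear.minus_left[OF bounded_bilinear_cdot, of "\<i> *s (P1 *v (H *v x))" "H *v y"]
    by (simp add: hdot_def S_eq)
  also have "cdot (P1 *v (H *v x)) (H *v y) = cdot x (H *v (P1 *v (H *v y)))"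
    by (simp add: cdot_hermitian[OF P1] cdot_hermitian[OF H_hermitian])
  also have "\<i> * \<dots> = - hdot H x (S y)"
    by (simp add: S_eq hd.minus_right hdot_scale_right) (simp add: hdot_def)
  finally show ?thesis .
qed

lemma hdot_C: "hdot H (C x) y = hdot H x (C y)"
  by (simp add: hdot_def C_eq cdot_hermitian[OF R_hermitian] cdot_hermitian[OF H_hermitian])

lemma h_S: "h (S x) x = 0"
  using hdot_S[of x x] hdot_commute[OF H_hermitian, of x "S x"] by (simp add: h_def complex_eq_iff)

lemma h_C: "h (C x) y = h x (C y)"
  by (simp add: h_def hdot_C)

text \<open>With w = H x and the form q of R, expanding q(w - t R w) \<ge> 0 gives t (2 - t K) |R
  w|^2 \<le> q(w), and t = 1/K is the best choice.\<close>

lemma C_coercive: "\<exists>c>0. \<forall>x. c * (norm (C x))\<^sup>2 \<le> h (C x) x"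
proof -
  obtain K where K: "\<And>v. norm (R *v v) \<le> K * norm v" "K > 0"
    using linear_bounded_pos[OF linear_matrix_vector] by blast
  interpret cd: bounded_bilinear "cdot :: complex^'n \<Rightarrow> _" by (rule bounded_bilinear_cdot)
  show ?thesis
  proof (intro exI[of _ "1 / K"] conjI allI)
    show "1 / K > 0" using K by simp
    fix x
    define w where "w = H *v x"
    define t where "t = 1 / K"
    have q: "Re (cdot u (R *v u)) \<ge> 0" for u using R by (simp add: pos_semidef_def)
    have sa: "cdot (R *v w) (R *v w) = cdot w (R *v (R *v w))" by (simp add: cdot_hermitian[OF R_hermitian])
    have "0 \<le> Re (cdot (w - t *\<^sub>R (R *v w)) (R *v (w - t *\<^sub>R (R *v w))))" by (rule q)
    also have "\<dots> = Re (cdot w (R *v w)) - 2 * t * (norm (R *v w))\<^sup>2 + t\<^sup>2 * Re (cdot (R *v w) (R *v (R *v w)))"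
      by (simp add: linear_diff[OF linear_matrix_vector] linear_scale[OF linear_matrix_vector] cd.diff_left cd.diff_right
          cd.scaleR_left cd.scaleR_right sa[symmetric] cdot_self power2_eq_square algebra_simps)
    also have "Re (cdot (R *v w) (R *v (R *v w))) \<le> K * (norm (R *v w))\<^sup>2"
    proof -
      have "Re (cdot (R *v w) (R *v (R *v w))) \<le> norm (R *v w) * norm (R *v (R *v w))"
        unfolding Re_cdot by (rule norm_cauchy_schwarz)
      also have "\<dots> \<le> norm (R *v w) * (K * norm (R *v w))" by (intro mult_left_mono K) auto
      finally show ?thesis by (simp add: power2_eq_square mult_ac)
    qed
    finally have "0 \<le> Re (cdot w (R *v w)) - 2 * t * (norm (R *v w))\<^sup>2 + t\<^sup>2 * (K * (norm (R *v w))\<^sup>2)"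
      by (simp add: mult_left_mono)
    then have "1 / K * (norm (R *v w))\<^sup>2 \<le> Re (cdot w (R *v w))"
      using K by (simp add: t_def power2_eq_square field_simps)
    moreover have "h (C x) x = Re (cdot w (R *v w))"
      by (simp add: h_def hdot_def C_eq w_def cdot_hermitian[OF R_hermitian])
    ultimately show "1 / K * (norm (C x))\<^sup>2 \<le> h (C x) x" by (simp add: C_eq w_def)
  qed
qed

lemma h_bounds:
  obtains \<alpha> \<beta> where "\<alpha> > 0" "\<beta> > 0" "\<And>v. \<alpha> * (norm v)\<^sup>2 \<le> h v v" "\<And>v. h v v \<le> \<beta> * (norm v)\<^sup>2"
  using pos_def_bounds[OF H] unfolding h_def by metis

lemma hdot_eq_zero: "hdot H u u = 0 \<Longrightarrow> u = 0"
proof -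
  obtain \<alpha> \<beta> where a: "\<alpha> > 0" "\<And>v. \<alpha> * (norm v)\<^sup>2 \<le> h v v" using h_bounds by metis
  assume "hdot H u u = 0"
  then have "\<alpha> * (norm u)\<^sup>2 \<le> 0" using a(2)[of u] by (simp add: h_def)
  then show "u = 0" using a(1) by (simp add: mult_le_0_iff)
qed

text \<open>Definiteness of the product supplies the uniqueness that the description in
  \<open>adjoint_wrt\<close> requires.\<close>

lemma adjoint_eq:
  assumes "\<And>x y. hdot H (f x) y = hdot H x (g y)"
  shows "adjoint_wrt (hdot H) f = g"
  unfolding adjoint_wrt_def
proof (rule the_equality)
  fix g' assume g': "\<forall>x y. hdot H (f x) y = hdot H x (g' y)"
  show "g' = g"
  proof
    fix y
    have "hdot H x (g' y - g y) = 0" for x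
      using g' assms by (metis hd.diff_right cancel_comm_monoid_add_class.diff_cancel)
    then show "g' y = g y" using hdot_eq_zero by (metis eq_iff_diff_eq_0)
  qed
qed (use assms in blast)

text \<open>C_m as a map. As S is skew and C self-adjoint, its adjoint is \<open>B (- m)\<close>, so
  all words in C_m and its adjoint stay in this family; the operator of the hypocoercivity
  hypothesis is \<open>B 1\<close>.\<close>

definition B :: "int \<Rightarrow> complex^'n \<Rightarrow> complex^'n" where "B m v = of_int m *\<^sub>R S v + C v"

lemma linear_B: "linear (B m)"
  unfolding B_def[abs_def] by (intro linear_compose_add linear_compose_scale_right linear_S linear_C)

lemma hdot_B: "hdot H (B m x) y = hdot H x (B (- m) y)"
  by (simp add: B_def hd.add_left hd.add_right hd.scaleR_left hd.scaleR_right hd.minus_right hd.diff_right hdot_S hdot_C)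

lemma hdot_B_funpow: "hdot H ((B m ^^ j) x) y = hdot H x ((B (- m) ^^ j) y)"
  by (induction j arbitrary: x y) (simp_all add: hdot_B funpow_swap1)

lemma Cm_B: "(*v) (Cm m) = B m"
  by (simp add: fun_eq_iff Cm_eq B_def)

lemma adjoint_B: "adjoint_wrt (hdot H) (B m) = B (- m)"
  by (rule adjoint_eq[OF hdot_B])

lemma C_mat_B: "(*v) (C_mat P1 R H) = B 1"
proof
  fix v
  have "C_mat P1 R H *v v = R *v (H *v v) - \<i> *s (P1 *v (H *v v))"
    by (simp add: C_mat_def matrix_vector_mul_assoc[symmetric] matrix_vector_mult_diff_rdistrib mat_vector)
  then show "C_mat P1 R H *v v = B 1 v" by (simp add: B_def S_eq C_eq)
qed

lemma hermitian_part_B: "hermitian_part (hdot H) (B m) = C"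
  by (simp add: fun_eq_iff hermitian_part_def adjoint_B) (simp add: B_def scaleR_add_right[symmetric] scaleR_2[symmetric])

lemma hypocoercive_with_iff:
  "hypocoercive_with (hdot H) (B 1) k \<longleftrightarrow>
     (\<exists>\<kappa>>0. \<forall>x. \<kappa> * h x x \<le> (\<Sum>j\<le>k. h (C ((B (- 1) ^^ j) x)) ((B (- 1) ^^ j) x)))"
proof -
  have "Re (hdot H (\<Sum>j\<le>k. (B 1 ^^ j) (C ((B (- 1) ^^ j) x))) x) = (\<Sum>j\<le>k. h (C ((B (- 1) ^^ j) x)) ((B (- 1) ^^ j) x))" for x
    by (simp add: hd.sum_left hdot_B_funpow h_def)
  moreover have "Re (hdot H (\<kappa> *\<^sub>R x) x) = \<kappa> * h x x" for \<kappa> x by (simp add: hd.scaleR_left h_def)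
  ultimately show ?thesis
    unfolding hypocoercive_with_def op_ge_def adjoint_B hermitian_part_B by simp
qed

text \<open>Both directions of the exchange between the adjoint of \<open>B 1\<close> and the skew
  part: B(-1) = - S + C and S = - B(-1) + C, so \<open>norm_word_le\<close> applies either
  way.\<close>

lemma norm_B_S_words:
  "\<exists>K>0. \<forall>z. norm (C ((B (- 1) ^^ j) z)) \<le> K * (\<Sum>i\<le>j. norm (C ((S ^^ i) z)))"
  "\<exists>K>0. \<forall>z. norm (C ((S ^^ j) z)) \<le> K * (\<Sum>i\<le>j. norm (C ((B (- 1) ^^ i) z)))"
proof -
  obtain Kc where Kc: "\<And>v. norm (C v) \<le> Kc * norm v" "Kc > 0" using linear_bounded_pos[OF linear_C] by blast
  obtain Ks where Ks: "\<And>v. norm (S v) \<le> Ks * norm v" "Ks > 0" using linear_bounded_pos[OF linear_S] by blast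
  obtain Kb where Kb: "\<And>v. norm (B (- 1) v) \<le> Kb * norm v" "Kb > 0" using linear_bounded_pos[OF linear_B] by blast
  obtain K where K: "K > 0" "\<forall>(C :: complex^'n \<Rightarrow> complex^'n) B S a b z.
     linear C \<longrightarrow> linear B \<longrightarrow> (\<forall>v. norm (C v) \<le> Kc * norm v) \<longrightarrow> (\<forall>v. norm (B v) \<le> Ks * norm v) \<longrightarrow>
     \<bar>a\<bar> \<le> 1 \<longrightarrow> \<bar>b\<bar> \<le> 1 \<longrightarrow> (\<forall>v. S v = a *\<^sub>R B v + b *\<^sub>R C v) \<longrightarrow>
     norm (C ((S ^^ j) z)) \<le> K * (\<Sum>i\<le>j. norm (C ((B ^^ i) z)))"
    using norm_word_le[OF less_imp_le[OF Kc(2)] less_imp_le[OF Ks(2)], of j, where 'v="complex^'n"] by (elim exE conjE) (rule that)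
  have "norm (C ((B (- 1) ^^ j) z)) \<le> K * (\<Sum>i\<le>j. norm (C ((S ^^ i) z)))" for z
    by (rule K(2)[rule_format, where a = "- 1" and b = 1]) (use Kc Ks linear_C linear_S in \<open>auto simp: B_def\<close>)
  with K(1) show "\<exists>K>0. \<forall>z. norm (C ((B (- 1) ^^ j) z)) \<le> K * (\<Sum>i\<le>j. norm (C ((S ^^ i) z)))" by blast
  obtain K' where K': "K' > 0" "\<forall>(C :: complex^'n \<Rightarrow> complex^'n) B S a b z.
     linear C \<longrightarrow> linear B \<longrightarrow> (\<forall>v. norm (C v) \<le> Kc * norm v) \<longrightarrow> (\<forall>v. norm (B v) \<le> Kb * norm v) \<longrightarrow>
     \<bar>a\<bar> \<le> 1 \<longrightarrow> \<bar>b\<bar> \<le> 1 \<longrightarrow> (\<forall>v. S v = a *\<^sub>R B v + b *\<^sub>R C v) \<longrightarrow>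
     norm (C ((S ^^ j) z)) \<le> K' * (\<Sum>i\<le>j. norm (C ((B ^^ i) z)))"
    using norm_word_le[OF less_imp_le[OF Kc(2)] less_imp_le[OF Kb(2)], of j, where 'v="complex^'n"] by (elim exE conjE) (rule that)
  have "norm (C ((S ^^ j) z)) \<le> K' * (\<Sum>i\<le>j. norm (C ((B (- 1) ^^ i) z)))" for z
  proof (rule K'(2)[rule_format, where a = "- 1" and b = 1])
    show "S v = - 1 *\<^sub>R B (- 1) v + 1 *\<^sub>R C v" for v by (simp add: B_def)
  qed (use Kc Kb linear_C linear_B in auto)
  with K'(1) show "\<exists>K>0. \<forall>z. norm (C ((S ^^ j) z)) \<le> K * (\<Sum>i\<le>j. norm (C ((B (- 1) ^^ i) z)))" by blast
qed

text \<open>Hypocoercivity bounds a quadratic form, whereas the locale asks for a sum of norms.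
  Estimating h(C w, w) by a multiple of |C w| |w| with |w| = O(|x|) leaves one factor |x| to cancel,
  and words in the adjoint are traded for words in S.\<close>

lemma kernel_bound:
  assumes "hypocoercive_with (hdot H) (B 1) k"
  shows "\<exists>\<kappa>>0. \<forall>x. \<kappa> * norm x \<le> (\<Sum>j\<le>k. norm (C ((S ^^ j) x)))"
proof -
  obtain \<kappa> where \<kappa>: "\<kappa> > 0" and le: "\<And>x. \<kappa> * h x x \<le> (\<Sum>j\<le>k. h (C ((B (- 1) ^^ j) x)) ((B (- 1) ^^ j) x))"
    using assms unfolding hypocoercive_with_iff by blast
  obtain \<alpha> \<beta> where \<alpha>: "\<alpha> > 0" "\<And>v. \<alpha> * (norm v)\<^sup>2 \<le> h v v" using h_bounds by metis
  obtain Kb where Kb: "\<And>v. norm (B (- 1) v) \<le> Kb * norm v" "Kb > 0" using linear_bounded_pos[OF linear_B] by blast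
  obtain Kh where Kh: "\<And>v w. norm (h v w) \<le> norm v * norm w * Kh" "Kh > 0"
    using bounded_bilinear.pos_bounded[OF bounded_bilinear_h] by blast
  obtain K where K: "\<And>j. K j > 0" "\<And>j z. norm (C ((B (- 1) ^^ j) z)) \<le> K j * (\<Sum>i\<le>j. norm (C ((S ^^ i) z)))"
    using norm_B_S_words(1) by metis
  define L where "L = (\<Sum>j\<le>k. K j * Kb ^ j * Kh)"
  have L: "L > 0" unfolding L_def using K Kb Kh by (intro sum_pos) auto
  show ?thesis
  proof (intro exI[of _ "\<kappa> * \<alpha> / L"] conjI allI)
    show "\<kappa> * \<alpha> / L > 0" using \<kappa> \<alpha> L by simp
    fix x
    let ?D = "\<Sum>j\<le>k. norm (C ((S ^^ j) x))"
    have "\<kappa> * (\<alpha> * (norm x)\<^sup>2) \<le> \<kappa> * h x x" using \<kappa> \<alpha> by (intro mult_left_mono) auto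
    also have "\<dots> \<le> (\<Sum>j\<le>k. h (C ((B (- 1) ^^ j) x)) ((B (- 1) ^^ j) x))" by (rule le)
    also have "\<dots> \<le> (\<Sum>j\<le>k. K j * Kb ^ j * Kh * (?D * norm x))"
    proof (rule sum_mono)
      fix j assume j: "j \<in> {..k}"
      let ?w = "(B (- 1) ^^ j) x"
      have "norm (C ?w) \<le> K j * (\<Sum>i\<le>j. norm (C ((S ^^ i) x)))" by (rule K)
      also have "\<dots> \<le> K j * ?D" using K(1)[of j] j by (intro mult_left_mono sum_mono2) auto
      finally have 1: "norm (C ?w) \<le> K j * ?D" .
      have 2: "norm ?w \<le> Kb ^ j * norm x" using Kb by (intro norm_funpow_le) auto
      have "h (C ?w) ?w \<le> norm (C ?w) * norm ?w * Kh" using Kh(1)[of "C ?w" ?w] by simp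
      also have "\<dots> \<le> (K j * ?D) * (Kb ^ j * norm x) * Kh"
        using 1 2 Kh K(1)[of j] by (intro mult_right_mono mult_mono) (auto intro!: mult_nonneg_nonneg sum_nonneg)
      finally show "h (C ?w) ?w \<le> K j * Kb ^ j * Kh * (?D * norm x)" by (simp only: mult_ac)
    qed
    also have "\<dots> = L * ?D * norm x" by (simp only: L_def sum_distrib_right mult.assoc)
    finally have "(\<kappa> * \<alpha> * norm x) * norm x \<le> (L * ?D) * norm x" by (simp add: power2_eq_square mult_ac)
    then have "\<kappa> * \<alpha> * norm x \<le> L * ?D"
      by (cases "x = 0") (auto simp: L_def intro!: mult_nonneg_nonneg sum_nonneg less_imp_le[OF K(1)] zero_le_power[OF less_imp_le[OF Kb(2)]] less_imp_le[OF Kh(2)])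
    then show "\<kappa> * \<alpha> / L * norm x \<le> ?D"
      using L by (simp only: times_divide_eq_left pos_divide_le_eq mult.commute[of _ L])
  qed
qed

text \<open>Minimality of the index: if only 0 were annihilated by all C S^j with j < k, the form
  \<open>q\<close> of order k - 1 would be positive on the unit sphere, attain a positive minimum
  there and give hypocoercivity with k - 1. For k = 0 any nonzero vector will do; treating this case
  apart also guards against truncation in \<open>k - 1\<close>.\<close>

lemma extremal_vector:
  assumes "k = 0 \<or> \<not> hypocoercive_with (hdot H) (B 1) (k - 1)"
  obtains z where "z \<noteq> 0" "\<And>j. j < k \<Longrightarrow> C ((S ^^ j) z) = 0"
proof (cases "k = 0")
  case True
  obtain b :: "complex^'n" where "b \<in> Basis" using nonempty_Basis by blast
  then have "b \<noteq> 0" by (rule nonzero_Basis)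
  then show ?thesis using that[of b] True by simp
next
  case False
  obtain \<alpha> \<beta> where \<beta>: "\<beta> > 0" "\<And>v. h v v \<le> \<beta> * (norm v)\<^sup>2" using h_bounds by metis
  obtain c where c: "c > 0" "\<And>x. c * (norm (C x))\<^sup>2 \<le> h (C x) x" using C_coercive by blast
  interpret h: bounded_bilinear h by (rule bounded_bilinear_h)
  let ?B = "\<lambda>j. B (- 1) ^^ j"
  have linBj: "linear (?B j)" for j by (rule linear_funpow[OF linear_B])
  define q where "q x = (\<Sum>j\<le>k - 1. h (C (?B j x)) (?B j x))" for x
  show ?thesis
  proof (rule ccontr)
    assume "\<not> thesis"
    then have none: "z = 0" if "\<And>j. j < k \<Longrightarrow> C ((S ^^ j) z) = 0" for z
      using that \<open>\<And>z. z \<noteq> 0 \<Longrightarrow> (\<And>j. j < k \<Longrightarrow> C ((S ^^ j) z) = 0) \<Longrightarrow> thesis\<close> by blast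
    have nonneg: "h (C y) y \<ge> 0" for y using c(1) c(2)[of y] by (smt (verit) mult_nonneg_nonneg zero_le_power2)
    have qpos: "q x > 0" if "x \<noteq> 0" for x
    proof (rule ccontr)
      assume "\<not> q x > 0"
      then have "q x = 0" using sum_nonneg[of "{..k - 1}" "\<lambda>j. h (C (?B j x)) (?B j x)"] nonneg by (simp add: q_def)
      then have zero: "h (C (?B j x)) (?B j x) = 0" if "j \<le> k - 1" for j
        using that nonneg unfolding q_def by (simp add: sum_nonneg_eq_0_iff)
      have CB: "C (?B j x) = 0" if "j \<le> k - 1" for j
        using c(2)[of "?B j x"] zero[OF that] c(1) by (simp add: mult_le_0_iff)
      have "C ((S ^^ j) x) = 0" if j: "j < k" for j
      proof -
        obtain K where "norm (C ((S ^^ j) x)) \<le> K * (\<Sum>i\<le>j. norm (C (?B i x)))"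
          using norm_B_S_words(2) by blast
        also have "(\<Sum>i\<le>j. norm (C (?B i x))) = 0" using CB j by (intro sum.neutral) auto
        finally show ?thesis by simp
      qed
      then show False using none that by blast
    qed
    have "continuous_on (sphere 0 1) q"
      unfolding q_def
      by (intro continuous_intros h.continuous_on linear_continuous_on_compose[OF _ linear_C] linear_continuous_on
          linear_conv_bounded_linear[THEN iffD1] linBj)
    moreover obtain b :: "complex^'n" where "b \<in> Basis" using nonempty_Basis by blast
    then have "sphere 0 1 \<noteq> ({} :: (complex^'n) set)" by (auto intro!: exI[of _ b])
    ultimately obtain x0 where x0: "x0 \<in> sphere 0 1" "\<And>y. y \<in> sphere 0 1 \<Longrightarrow> q x0 \<le> q y"
      using continuous_attains_inf[OF compact_sphere] by metis
    have "x0 \<noteq> 0" using x0(1) by auto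
    then have q0: "q x0 > 0" by (rule qpos)
    have qle: "q x0 * (norm x)\<^sup>2 \<le> q x" for x
    proof (cases "x = 0")
      case True
      then show ?thesis using nonneg by (simp add: q_def sum_nonneg)
    next
      case False
      have "q x0 \<le> q (x /\<^sub>R norm x)" by (rule x0(2)) (use False in simp)
      also have "\<dots> = q x / (norm x)\<^sup>2"
        by (simp add: q_def linear_scale[OF linBj] linear_scale[OF linear_C] h.scaleR_left h.scaleR_right
            sum_distrib_left power2_eq_square divide_inverse mult_ac)
      finally show ?thesis using False by (simp add: field_simps)
    qed
    have "q x0 / \<beta> * h x x \<le> q x" for x
    proof -
      have "q x0 / \<beta> * h x x \<le> q x0 / \<beta> * (\<beta> * (norm x)\<^sup>2)" using q0 \<beta> by (intro mult_left_mono) auto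
      also have "\<dots> \<le> q x" using qle[of x] \<beta> by simp
      finally show ?thesis .
    qed
    then have "hypocoercive_with (hdot H) (B 1) (k - 1)"
      unfolding hypocoercive_with_iff q_def[symmetric] using q0 \<beta> by (intro exI[of _ "q x0 / \<beta>"]) auto
    with assms False show False by blast
  qed
qed

subsection \<open>The stationary states\<close>

text \<open>As \<open>C\<close> is self-adjoint, it is injective on its range and hence maps its range onto itself.\<close>

lemma kernel_decomposition:
  obtains u w where "z = u + w" "C u = 0" "\<And>v. C v = 0 \<Longrightarrow> hdot H v w = 0"
proof -
  have sub: "subspace (range C)" by (rule linear_subspace_image[OF linear_C subspace_UNIV])
  have "x = 0" if x: "x \<in> range C" "C x = 0" for x
  proof -
    obtain a where a: "x = C a" using x by blast
    have "hdot H x x = hdot H a (C x)" unfolding a by (rule hdot_C)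
    then show "x = 0" using x by (intro hdot_eq_zero) (simp add: hd.zero_right)
  qed
  then have "inj_on C (range C)"
    using linear_injective_on_subspace_0[OF linear_C sub] by blast
  moreover have "span (range C) = range C" using sub by (simp only: span_eq_iff)
  ultimately have "inj_on C (span (range C))" by (simp only:)
  then have "dim (C ` range C) = dim (range C)" by (rule dim_image_eq[OF linear_C])
  then have eq: "C ` range C = range C"
    by (intro subspace_dim_equal sub linear_subspace_image[OF linear_C]) auto
  have "C z \<in> C ` range C" unfolding eq by blast
  then obtain a where a: "C z = C (C a)" by blast
  show ?thesis
  proof (rule that)
    show "z = (z - C a) + C a" by simp
    show "C (z - C a) = 0" by (simp add: linear_diff[OF linear_C] a)
    show "hdot H v (C a) = 0" if "C v = 0" for v
      using hdot_C[of v a] that by (simp add: hd.zero_left)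
  qed
qed

lemma const_mode: "const_l2 v = fourier_mode 0 v"
  by (simp add: fourier_mode_class const_l2.abs_eq cexp_def)

lemma V_inf_iff: "x \<in> V_inf R H \<longleftrightarrow> (\<exists>v. C v = 0 \<and> x = fourier_mode 0 v)"
proof -
  have "V_inf R H = {fourier_mode 0 v |v. C v = 0}"
    by (simp only: V_inf_def const_mode C_def CH_mat_def)
  then show ?thesis by blast
qed

lemma orth_V_inf_iff:
  "x \<in> orth_complement (l2_inner H) (V_inf R H) \<longleftrightarrow> (\<forall>v. C v = 0 \<longrightarrow> hdot H v (fcoeff x 0) = 0)"
proof -
  have "x \<in> orth_complement (l2_inner H) (V_inf R H) \<longleftrightarrow> (\<forall>v. C v = 0 \<longrightarrow> l2_inner H (fourier_mode 0 v) x = 0)"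
    unfolding orth_complement_def mem_Collect_eq Ball_def V_inf_iff by (metis (no_types))
  then show ?thesis by (simp add: l2_inner_mode)
qed

section \<open>Energy, stationary projection and operator norm\<close>

definition energy :: "'n l2 \<Rightarrow> real" where "energy x = Re (l2_inner H x x)"

lemma energy_nonneg: "energy x \<ge> 0" and energy_eq_zero: "energy x = 0 \<Longrightarrow> x = 0"
proof -
  obtain \<alpha> \<beta> where a: "\<alpha> > 0" "\<And>v. \<alpha> * (norm v)\<^sup>2 \<le> Re (hdot H v v)" "\<And>v. Re (hdot H v v) \<le> \<beta> * (norm v)\<^sup>2"
    using pos_def_bounds[OF H] by metis
  have le: "\<alpha> * (norm x)\<^sup>2 \<le> energy x" unfolding energy_def by (rule l2_inner_bounds(1)[OF a(2,3)])
  moreover have "0 \<le> \<alpha> * (norm x)\<^sup>2" using a(1) by simp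
  ultimately show "energy x \<ge> 0" by linarith
  show "energy x = 0 \<Longrightarrow> x = 0" using le a(1) by (simp add: mult_le_0_iff)
qed

lemma ip_norm_energy: "ip_norm (l2_inner H) x = sqrt (energy x)"
  by (simp add: ip_norm_def energy_def)

lemma energy_has_sum: "((\<lambda>m. 2 * pi * h (fcoeff x m) (fcoeff x m)) has_sum energy x) UNIV"
  using has_sum_Re[OF parseval[of H x x]] by (simp add: energy_def h_def)

text \<open>The projection acts only on the zero mode, where it selects the kernel part u of the
  coefficient. Existence and uniqueness are both owed to the description behind
  \<open>orth_projection\<close>.\<close>

lemma Q_inf_spec:
  "Q_inf R H x \<in> V_inf R H \<and> x - Q_inf R H x \<in> orth_complement (l2_inner H) (V_inf R H)"
  unfolding Q_inf_def orth_projection_def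
proof (rule theI')
  interpret l: bounded_bilinear "l2_inner H" by (rule bounded_bilinear_l2_inner)
  obtain u w where uw: "fcoeff x 0 = u + w" "C u = 0" "\<And>v. C v = 0 \<Longrightarrow> hdot H v w = 0"
    using kernel_decomposition by blast
  show "\<exists>!y. y \<in> V_inf R H \<and> x - y \<in> orth_complement (l2_inner H) (V_inf R H)"
  proof (intro ex1I conjI)
    show "fourier_mode 0 u \<in> V_inf R H" using uw by (auto simp: V_inf_iff)
    show "x - fourier_mode 0 u \<in> orth_complement (l2_inner H) (V_inf R H)"
      using uw by (simp add: orth_V_inf_iff fcoeff_diff fcoeff_mode)
    fix y assume y: "y \<in> V_inf R H \<and> x - y \<in> orth_complement (l2_inner H) (V_inf R H)"
    then obtain v where v: "C v = 0" "y = fourier_mode 0 v" by (auto simp: V_inf_iff)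
    have Cvu: "C (v - u) = 0" using v uw by (simp add: linear_diff[OF linear_C])
    have "hdot H (v - u) (fcoeff x 0 - v) = 0"
      using y v Cvu by (simp add: orth_V_inf_iff fcoeff_diff fcoeff_mode)
    moreover have "hdot H (v - u) w = 0" using uw(3) Cvu by blast
    ultimately have "hdot H (v - u) (v - u) = 0"
      by (simp add: uw(1) hd.diff_right hd.add_right)
    then show "y = fourier_mode 0 u" using hdot_eq_zero v by fastforce
  qed
qed

lemma T_V_inf:
  assumes "x \<in> V_inf R H" "t \<ge> 0"
  shows "T t x = x"
proof -
  obtain v where v: "C v = 0" "x = fourier_mode 0 v" using assms by (auto simp: V_inf_iff)
  have "((\<lambda>_. v) has_vector_derivative - (Cm 0 *v v)) (at s)" for s
    using v by (simp add: Cm_zero)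
  from T_mode[OF this assms(2)] show ?thesis using v by simp
qed

text \<open>The zero mode conserves its product with every kernel vector, as C is self-adjoint. The
  argument is carried out for the complex product because \<open>orth_complement\<close> refers to
  it.\<close>

lemma T_orth_V_inf:
  assumes x: "x \<in> orth_complement (l2_inner H) (V_inf R H)" and t: "t \<ge> 0"
  shows "T t x \<in> orth_complement (l2_inner H) (V_inf R H)"
  unfolding orth_V_inf_iff
proof (intro allI impI)
  fix v assume v: "C v = 0"
  obtain y where y: "y 0 = fcoeff x 0" "\<And>s. (y has_vector_derivative - (Cm 0 *v y s)) (at s)"
    using mode_solution by metis
  have "((\<lambda>s. hdot H v (y s)) has_derivative (\<lambda>_. 0)) (at s within UNIV)" for s
  proof -
    have "((\<lambda>s. hdot H v (y s)) has_vector_derivative (hdot H v (- (Cm 0 *v y s)) + hdot H 0 (y s))) (at s)"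
      by (rule hd.has_vector_derivative[OF has_vector_derivative_const y(2)])
    then have "((\<lambda>s. hdot H v (y s)) has_vector_derivative 0) (at s)"
      by (simp add: Cm_zero hd.minus_right hd.zero_left hdot_C[symmetric] v)
    then show ?thesis by (simp add: has_vector_derivative_def)
  qed
  from has_derivative_zero_constant[OF convex_UNIV this] obtain a where "\<And>s. hdot H v (y s) = a" by blast
  moreover have "hdot H v (y 0) = 0" using x v y(1) by (simp add: orth_V_inf_iff)
  ultimately show "hdot H v (fcoeff (T t x) 0) = 0"
    unfolding fcoeff_T[OF y(2,1) t] by metis
qed

text \<open>T fixes the stationary states, so the difference is T after the complementary
  projection, and its norm is governed by decay on the complement.\<close>

lemma T_minus_Q_inf:
  assumes "t \<ge> 0"
  shows "T t x - Q_inf R H x = T t (x - Q_inf R H x)"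
proof -
  interpret bounded_linear "T t" by (rule T_bounded_linear[OF assms])
  show ?thesis using T_V_inf[of "Q_inf R H x" t] Q_inf_spec[of x] assms by (simp add: diff)
qed

lemma energy_minus_Q_inf: "energy (x - Q_inf R H x) \<le> energy x"
proof -
  interpret l: bounded_bilinear "l2_inner H" by (rule bounded_bilinear_l2_inner)
  let ?q = "Q_inf R H x"
  have q: "l2_inner H ?q (x - ?q) = 0"
    using Q_inf_spec[of x] by (auto simp: orth_complement_def)
  then have q': "l2_inner H (x - ?q) ?q = 0"
    using l2_inner_commute[OF H_hermitian, of ?q "x - ?q"] by simp
  have "energy x = Re (l2_inner H (?q + (x - ?q)) (?q + (x - ?q)))" by (simp add: energy_def)
  also have "\<dots> = energy ?q + energy (x - ?q)"
    unfolding l.add_left l.add_right q q' by (simp add: energy_def)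
  finally show ?thesis using energy_nonneg[of ?q] by simp
qed

lemma Q_inf_orth:
  assumes "x \<in> orth_complement (l2_inner H) (V_inf R H)"
  shows "Q_inf R H x = 0"
proof -
  interpret l: bounded_bilinear "l2_inner H" by (rule bounded_bilinear_l2_inner)
  have "l2_inner H (Q_inf R H x) (x - Q_inf R H x) = 0" "l2_inner H (Q_inf R H x) x = 0"
    using Q_inf_spec[of x] assms by (auto simp: orth_complement_def)
  then have "energy (Q_inf R H x) = 0" by (simp add: energy_def l.diff_right)
  then show ?thesis by (rule energy_eq_zero)
qed

text \<open>By the weighted Parseval identity a factor valid on every mode is valid for the whole
  energy.\<close>

lemma energy_T_le:
  assumes t: "t \<ge> 0" and r: "r \<ge> 0"
    and le: "\<And>m y. y 0 = fcoeff x m \<Longrightarrow> (\<And>s. (y has_vector_derivative - (Cm m *v y s)) (at s)) \<Longrightarrow>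
        h (y t) (y t) \<le> r * h (y 0) (y 0)"
  shows "energy (T t x) \<le> r * energy x"
proof (rule has_sum_mono[OF energy_has_sum[of "T t x"] has_sum_cmult_right[OF energy_has_sum[of x]]])
  fix m
  obtain y where y: "y 0 = fcoeff x m" "\<And>s. (y has_vector_derivative - (Cm m *v y s)) (at s)"
    using mode_solution by metis
  have "2 * pi * h (y t) (y t) \<le> 2 * pi * (r * h (y 0) (y 0))"
    by (intro mult_left_mono le[where m = m and y = y] y) auto
  then show "2 * pi * h (fcoeff (T t x) m) (fcoeff (T t x) m) \<le> r * (2 * pi * h (fcoeff x m) (fcoeff x m))"
    unfolding fcoeff_T[OF y(2,1) t] y(1)[symmetric] by (simp add: mult_ac)
qed

lemma op_norm_le:
  assumes "\<And>x. ip_norm (l2_inner H) (f x) \<le> b * ip_norm (l2_inner H) x" "b \<ge> 0"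
  shows "op_norm (l2_inner H) f \<le> b"
  unfolding op_norm_def
proof (rule cSUP_least)
  fix x
  show "ip_norm (l2_inner H) (f x) / ip_norm (l2_inner H) x \<le> b"
  \<comment> \<open>For x = 0 the quotient is 0 by convention, which is where b \<ge> 0 is
    used.\<close>
  proof (cases "ip_norm (l2_inner H) x = 0")
    case False
    then have "ip_norm (l2_inner H) x > 0" using energy_nonneg[of x] by (simp add: ip_norm_energy less_le)
    then show ?thesis using assms(1)[of x] by (simp add: divide_le_eq)
  qed (use assms(2) in simp)
qed simp

text \<open>The bound \<open>b\<close> guarantees that the real supremum in \<open>op_norm\<close>
  is taken over a bounded set.\<close>

lemma op_norm_ge:
  assumes "\<And>x. ip_norm (l2_inner H) (f x) \<le> b * ip_norm (l2_inner H) x" "b \<ge> 0"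
  shows "ip_norm (l2_inner H) (f x) / ip_norm (l2_inner H) x \<le> op_norm (l2_inner H) f"
  unfolding op_norm_def
proof (rule cSUP_upper)
  show "bdd_above (range (\<lambda>x. ip_norm (l2_inner H) (f x) / ip_norm (l2_inner H) x))"
  proof (rule bdd_aboveI2)
    fix x
    show "ip_norm (l2_inner H) (f x) / ip_norm (l2_inner H) x \<le> b"
    proof (cases "ip_norm (l2_inner H) x = 0")
      case False
      then have "ip_norm (l2_inner H) x > 0" using energy_nonneg[of x] by (simp add: ip_norm_energy less_le)
      then show ?thesis using assms(1)[of x] by (simp add: divide_le_eq)
    qed (use assms(2) in simp)
  qed
qed simp

end

locale hypocoercive_port_hamiltonian = port_hamiltonian P1 R H T
  for P1 R H :: "complex^'n^'n" and T +
  fixes k :: nat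
  assumes hypo: "hypocoercive (*s) (hdot H) ((*v) (C_mat P1 R H))"
    and index: "k = hypocoercivity_index (hdot H) ((*v) (C_mat P1 R H))"
begin

lemma hypocoercive_k: "hypocoercive_with (hdot H) (B 1) k"
  and k_minimal: "k = 0 \<or> \<not> hypocoercive_with (hdot H) (B 1) (k - 1)"
proof -
  have ex: "\<exists>m. hypocoercive_with (hdot H) (B 1) m"
    using hypo by (simp add: hypocoercive_def C_mat_B)
  have k: "k = (LEAST m. hypocoercive_with (hdot H) (B 1) m)"
    using index by (simp add: hypocoercivity_index_def C_mat_B)
  show "hypocoercive_with (hdot H) (B 1) k" unfolding k by (rule LeastI_ex[OF ex])
  show "k = 0 \<or> \<not> hypocoercive_with (hdot H) (B 1) (k - 1)"
    using not_less_Least[of "k - 1" "hypocoercive_with (hdot H) (B 1)"] k by (cases k) auto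
qed

lemma hypocoercive_pair_S_C: "\<exists>\<alpha> \<beta> c \<kappa>. hypocoercive_pair h S C k \<alpha> \<beta> c \<kappa>"
proof -
  obtain \<alpha> \<beta> where ab: "\<alpha> > 0" "\<And>v. \<alpha> * (norm v)\<^sup>2 \<le> h v v" "\<And>v. h v v \<le> \<beta> * (norm v)\<^sup>2"
    using h_bounds by metis
  obtain c where c: "c > 0" "\<And>x. c * (norm (C x))\<^sup>2 \<le> h (C x) x" using C_coercive by blast
  obtain \<kappa> where \<kappa>: "\<kappa> > 0" "\<And>x. \<kappa> * norm x \<le> (\<Sum>j\<le>k. norm (C ((S ^^ j) x)))"
    using kernel_bound[OF hypocoercive_k] by blast
  have "hypocoercive_pair h S C k \<alpha> \<beta> c \<kappa>"
    by (rule hypocoercive_pair.intro) (fact bounded_bilinear_h h_sym ab linear_S linear_C h_S c \<kappa>)+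
  then show ?thesis by blast
qed

lemma solution_eq: "- (Cm m *v v) = - (of_int m *\<^sub>R S v + 1 *\<^sub>R C v)"
  by (simp add: Cm_eq)

text \<open>Joins the modes m \<noteq> 0 and m = 0 under one constant. The side condition on y(0) is
  orthogonality to the stationary states.\<close>

lemma solution_decay:
  "\<exists>c>0. c \<le> 1 \<and> (\<forall>m y t. (\<forall>s. (y has_vector_derivative - (Cm m *v y s)) (at s)) \<longrightarrow>
     (m = 0 \<longrightarrow> (\<forall>v. C v = 0 \<longrightarrow> h v (y 0) = 0)) \<longrightarrow> 0 \<le> t \<longrightarrow> t \<le> 1 \<longrightarrow>
     h (y t) (y t) \<le> (1 - c * t ^ (2 * k + 1)) * h (y 0) (y 0))"
proof -
  obtain \<alpha> \<beta> c \<kappa> where "hypocoercive_pair h S C k \<alpha> \<beta> c \<kappa>" using hypocoercive_pair_S_C by blast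
  then interpret p: hypocoercive_pair h S C k \<alpha> \<beta> c \<kappa> .
  obtain c1 where c1: "c1 > 0" "c1 \<le> 1" and 1: "\<And>m y t. m \<noteq> (0::int) \<Longrightarrow>
     (\<forall>s. (y has_vector_derivative - (of_int m *\<^sub>R S (y s) + C (y s))) (at s)) \<Longrightarrow> 0 \<le> t \<Longrightarrow> t \<le> 1 \<Longrightarrow>
     h (y t) (y t) \<le> (1 - c1 * t ^ (2 * k + 1)) * h (y 0) (y 0)"
    using p.mode_decay by blast
  obtain c2 where c2: "c2 > 0" "c2 \<le> 1" and 2: "\<And>y t. (\<forall>s. (y has_vector_derivative - C (y s)) (at s)) \<Longrightarrow>
     (\<forall>v. C v = 0 \<longrightarrow> h v (y 0) = 0) \<Longrightarrow> 0 \<le> t \<Longrightarrow> t \<le> 1 \<Longrightarrow>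
     h (y t) (y t) \<le> (1 - c2 * t ^ (2 * k + 1)) * h (y 0) (y 0)"
    using p.zero_mode_decay[OF h_C] by blast
  show ?thesis
  proof (intro exI[of _ "min c1 c2"] conjI allI impI)
    show "min c1 c2 > 0" "min c1 c2 \<le> 1" using c1 c2 by auto
    fix m y and t :: real
    assume y: "\<forall>s. (y has_vector_derivative - (Cm m *v y s)) (at s)"
      and y0: "m = 0 \<longrightarrow> (\<forall>v. C v = 0 \<longrightarrow> h v (y 0) = 0)" and t: "0 \<le> t" "t \<le> 1"
    obtain d where d: "d \<in> {c1, c2}" "h (y t) (y t) \<le> (1 - d * t ^ (2 * k + 1)) * h (y 0) (y 0)"
    proof (cases "m = 0")
      case True
      have "h (y t) (y t) \<le> (1 - c2 * t ^ (2 * k + 1)) * h (y 0) (y 0)"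
        by (rule 2) (use y y0 True t in \<open>auto simp: Cm_zero\<close>)
      then show ?thesis using that by blast
    next
      case False
      have "h (y t) (y t) \<le> (1 - c1 * t ^ (2 * k + 1)) * h (y 0) (y 0)"
        by (rule 1[OF False _ t]) (use y in \<open>simp add: Cm_eq\<close>)
      then show ?thesis using that by blast
    qed
    have "min c1 c2 * t ^ (2 * k + 1) \<le> d * t ^ (2 * k + 1)"
      using d(1) t by (intro mult_right_mono) auto
    then have "(1 - d * t ^ (2 * k + 1)) * h (y 0) (y 0) \<le> (1 - min c1 c2 * t ^ (2 * k + 1)) * h (y 0) (y 0)"
      by (intro mult_right_mono p.h_nonneg) auto
    with d(2) show "h (y t) (y t) \<le> (1 - min c1 c2 * t ^ (2 * k + 1)) * h (y 0) (y 0)" by (rule order_trans)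
  qed
qed

lemma solution_contraction:
  assumes y: "\<And>s. (y has_vector_derivative - (Cm m *v y s)) (at s)" and t: "t \<ge> 0"
  shows "h (y t) (y t) \<le> h (y 0) (y 0)"
proof -
  obtain \<alpha> \<beta> c \<kappa> where "hypocoercive_pair h S C k \<alpha> \<beta> c \<kappa>" using hypocoercive_pair_S_C by blast
  then interpret p: hypocoercive_pair h S C k \<alpha> \<beta> c \<kappa> .
  show ?thesis by (rule p.energy_antimono[OF y[unfolded solution_eq] t]) simp
qed

lemma energy_contraction:
  assumes t: "t \<ge> 0"
  shows "energy (T t x) \<le> energy x"
proof -
  have "energy (T t x) \<le> 1 * energy x"
  proof (rule energy_T_le[OF t])
    fix m y assume y: "\<And>s. (y has_vector_derivative - (Cm m *v y s)) (at s)"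
    show "h (y t) (y t) \<le> 1 * h (y 0) (y 0)" using solution_contraction[OF y t] by simp
  qed simp
  then show ?thesis by simp
qed

lemma energy_decay:
  "\<exists>c>0. c \<le> 1 \<and> (\<forall>x\<in>orth_complement (l2_inner H) (V_inf R H). \<forall>t\<in>{0..1}.
     energy (T t x) \<le> (1 - c * t ^ (2 * k + 1)) * energy x)"
proof -
  obtain c where c: "c > 0" "c \<le> 1" and decay: "\<forall>m y t. (\<forall>s. (y has_vector_derivative - (Cm m *v y s)) (at s)) \<longrightarrow>
     (m = 0 \<longrightarrow> (\<forall>v. C v = 0 \<longrightarrow> h v (y 0) = 0)) \<longrightarrow> 0 \<le> t \<longrightarrow> t \<le> 1 \<longrightarrow>
     h (y t) (y t) \<le> (1 - c * t ^ (2 * k + 1)) * h (y 0) (y 0)"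
    using solution_decay by blast
  have "energy (T t x) \<le> (1 - c * t ^ (2 * k + 1)) * energy x"
    if x: "x \<in> orth_complement (l2_inner H) (V_inf R H)" and t: "0 \<le> t" "t \<le> 1" for x t
  proof (rule energy_T_le[OF t(1)])
    have "t ^ (2 * k + 1) \<le> 1" using t by (intro power_le_one) auto
    then show "0 \<le> 1 - c * t ^ (2 * k + 1)" using c t by (simp add: mult_le_one)
    fix m y
    assume y: "y 0 = fcoeff x m" "\<And>s. (y has_vector_derivative - (Cm m *v y s)) (at s)"
    have "m = 0 \<longrightarrow> (\<forall>v. C v = 0 \<longrightarrow> h v (y 0) = 0)"
      using x by (simp add: y(1) orth_V_inf_iff h_def)
    with y(2) t show "h (y t) (y t) \<le> (1 - c * t ^ (2 * k + 1)) * h (y 0) (y 0)"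
      using decay by blast
  qed
  then show ?thesis using c by (intro exI[of _ c]) simp
qed

abbreviation decay_norm :: "real \<Rightarrow> real" where
  "decay_norm t \<equiv> op_norm (l2_inner H) (\<lambda>x. T t x - Q_inf R H x)"

lemma T_minus_Q_inf_le:
  assumes "t \<ge> 0" "r \<ge> 0"
    and "\<And>x. x \<in> orth_complement (l2_inner H) (V_inf R H) \<Longrightarrow> energy (T t x) \<le> r * energy x"
  shows "ip_norm (l2_inner H) (T t x - Q_inf R H x) \<le> sqrt r * ip_norm (l2_inner H) x"
proof -
  have "energy (T t x - Q_inf R H x) \<le> r * energy (x - Q_inf R H x)"
    unfolding T_minus_Q_inf[OF assms(1)] using Q_inf_spec by (intro assms(3)) blast
  also have "\<dots> \<le> r * energy x" using assms(2) by (intro mult_left_mono energy_minus_Q_inf)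
  finally show ?thesis
    unfolding ip_norm_energy real_sqrt_mult[symmetric] by (rule real_sqrt_le_mono)
qed

lemma decay_norm_nonneg: "t \<ge> 0 \<Longrightarrow> decay_norm t \<ge> 0"
  using op_norm_ge[OF T_minus_Q_inf_le[of t 1], of 0] energy_contraction energy_nonneg
  by (simp add: ip_norm_energy) (meson divide_nonneg_nonneg order_trans real_sqrt_ge_zero)

text \<open>The upper bound is \<open>energy_decay\<close> carried over to the operator norm. For
  the lower bound the supremum is tested with the extremal vector on the mode m = 1, whose energy
  loss is O(t^(2k+1)).\<close>

lemma short_time_asymptotics:
  "\<exists>\<tau>>0. \<exists>c1>0. \<exists>c2>0. \<forall>t. 0 \<le> t \<and> t \<le> \<tau> \<longrightarrow>
     1 - c1 * t ^ (2 * k + 1) \<le> (decay_norm t)\<^sup>2 \<and> (decay_norm t)\<^sup>2 \<le> 1 - c2 * t ^ (2 * k + 1)"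
proof -
  obtain \<alpha> \<beta> c \<kappa> where "hypocoercive_pair h S C k \<alpha> \<beta> c \<kappa>" using hypocoercive_pair_S_C by blast
  then interpret p: hypocoercive_pair h S C k \<alpha> \<beta> c \<kappa> .
  obtain c2 where c2: "c2 > 0" "c2 \<le> 1" and decay: "\<And>x t. x \<in> orth_complement (l2_inner H) (V_inf R H) \<Longrightarrow>
     0 \<le> t \<Longrightarrow> t \<le> 1 \<Longrightarrow> energy (T t x) \<le> (1 - c2 * t ^ (2 * k + 1)) * energy x"
    using energy_decay by (elim exE conjE) (rule that; force)
  obtain z where z: "z \<noteq> 0" "\<And>j. j < k \<Longrightarrow> C ((S ^^ j) z) = 0"
    using extremal_vector[OF k_minimal] by metis
  obtain K where K: "K > 0" and low: "\<And>y t. (\<forall>s. (y has_vector_derivative - (S (y s) + C (y s))) (at s)) \<Longrightarrow> y 0 = z \<Longrightarrow>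
     0 \<le> t \<Longrightarrow> t \<le> 1 \<Longrightarrow> h z z - K * t ^ (2 * k + 1) \<le> h (y t) (y t)"
    using p.short_time_lower_bound[OF h_C z(2)] by blast
  have hz: "h z z > 0"
    using p.lower[of z] p.\<alpha> z(1) by (smt (verit) mult_pos_pos zero_less_norm_iff zero_less_power)
  show ?thesis
  proof (rule exI[of _ 1], rule conjI)
    show "\<exists>c1>0. \<exists>c2>0. \<forall>t. 0 \<le> t \<and> t \<le> 1 \<longrightarrow>
     1 - c1 * t ^ (2 * k + 1) \<le> (decay_norm t)\<^sup>2 \<and> (decay_norm t)\<^sup>2 \<le> 1 - c2 * t ^ (2 * k + 1)"
    proof (rule exI[of _ "K / h z z"], rule conjI, use K hz in simp, rule exI[of _ c2], intro conjI c2 allI impI)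
      fix t :: real assume t': "0 \<le> t \<and> t \<le> 1"
      then have t: "0 \<le> t" "t \<le> 1" by auto
      have "t ^ (2 * k + 1) \<le> 1" using t by (intro power_le_one) auto
      then have r: "0 \<le> 1 - c2 * t ^ (2 * k + 1)" using c2 t by (simp add: mult_le_one)
      have bd: "ip_norm (l2_inner H) (T t x - Q_inf R H x) \<le> sqrt (1 - c2 * t ^ (2 * k + 1)) * ip_norm (l2_inner H) x" for x
        using r decay t by (intro T_minus_Q_inf_le) auto
      have "decay_norm t \<le> sqrt (1 - c2 * t ^ (2 * k + 1))"
        by (rule op_norm_le[OF bd]) (use r in simp)
      then have "(decay_norm t)\<^sup>2 \<le> (sqrt (1 - c2 * t ^ (2 * k + 1)))\<^sup>2"
        using decay_norm_nonneg t by (intro power_mono) auto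
      then show "(decay_norm t)\<^sup>2 \<le> 1 - c2 * t ^ (2 * k + 1)" using r by simp
      \<comment> \<open>The mode 1 is orthogonal to the stationary states, and its equation y' = -(S
        + C) y is the one treated in \<open>short_time_lower_bound\<close>.\<close>
      define x where "x = fourier_mode 1 z"
      have fx: "fcoeff x m = (if m = 1 then z else 0)" for m unfolding x_def by (rule fcoeff_mode)
      have Qx: "Q_inf R H x = 0" by (rule Q_inf_orth) (simp add: orth_V_inf_iff fx hd.zero_right)
      obtain y where y: "y 0 = z" "\<And>s. (y has_vector_derivative - (Cm 1 *v y s)) (at s)"
        using mode_solution by metis
      have Tx: "T t x = fourier_mode 1 (y t)"
        using T_mode[OF y(2) t(1)] by (simp add: x_def y(1))
      have en: "energy (fourier_mode 1 v) = 2 * pi * h v v" for v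
        by (simp add: energy_def l2_inner_mode fcoeff_mode h_def)
      have "h z z - K * t ^ (2 * k + 1) \<le> h (y t) (y t)"
        by (rule low) (use y t in \<open>auto simp: Cm_one\<close>)
      then have "(h z z - K * t ^ (2 * k + 1)) / h z z \<le> h (y t) (y t) / h z z"
        using hz by (intro divide_right_mono) auto
      then have "1 - K / h z z * t ^ (2 * k + 1) \<le> h (y t) (y t) / h z z"
        using hz by (simp add: diff_divide_distrib)
      also have "\<dots> = (ip_norm (l2_inner H) (T t x - Q_inf R H x) / ip_norm (l2_inner H) x)\<^sup>2"
      proof -
        have "(ip_norm (l2_inner H) (T t x - Q_inf R H x) / ip_norm (l2_inner H) x)\<^sup>2 = energy (T t x) / energy x"
          using energy_nonneg[of "T t x"] energy_nonneg[of x] by (simp add: Qx ip_norm_energy power_divide)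
        then show ?thesis by (simp add: Tx en) (simp add: x_def en)
      qed
      also have "\<dots> \<le> (decay_norm t)\<^sup>2"
      proof (rule power_mono)
        show "ip_norm (l2_inner H) (T t x - Q_inf R H x) / ip_norm (l2_inner H) x \<le> decay_norm t"
          by (rule op_norm_ge[OF bd]) (use r in simp)
        show "0 \<le> ip_norm (l2_inner H) (T t x - Q_inf R H x) / ip_norm (l2_inner H) x"
          using energy_nonneg by (simp add: ip_norm_energy)
      qed
      finally show "1 - K / h z z * t ^ (2 * k + 1) \<le> (decay_norm t)\<^sup>2" .
    qed
  qed simp
qed

lemma exponential_decay: "\<exists>C>0. \<exists>\<omega>>0. \<forall>t\<ge>0. decay_norm t \<le> C * exp (- \<omega> * t)"
proof -
  let ?V = "orth_complement (l2_inner H) (V_inf R H)"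
  obtain c2 where c2: "c2 > 0" "c2 \<le> 1" and decay: "\<And>x t. x \<in> ?V \<Longrightarrow>
     0 \<le> t \<Longrightarrow> t \<le> 1 \<Longrightarrow> energy (T t x) \<le> (1 - c2 * t ^ (2 * k + 1)) * energy x"
    using energy_decay by (elim exE conjE) (rule that; force)
  \<comment> \<open>Contraction factor of the energy per unit of time; the minimum with 1/2 keeps q
    positive, so that ln q makes sense even for c2 = 1.\<close>
  define q where "q = 1 - min c2 (1/2)"
  have q: "0 < q" "q < 1" "1 - c2 \<le> q" using c2 by (auto simp: q_def)
  have step: "energy (T 1 x) \<le> q * energy x" if "x \<in> ?V" for x
    using decay[OF that, of 1] mult_right_mono[OF q(3) energy_nonneg[of x]] by simp
  have pow: "energy (T (real N) x) \<le> q ^ N * energy x" if "x \<in> ?V" for N x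
  proof (induction N)
    case (Suc N)
    have "T (real (Suc N)) x = T 1 (T (real N) x)" using T_add[of 1 "real N" x] by (simp add: add.commute)
    then have "energy (T (real (Suc N)) x) \<le> q * energy (T (real N) x)"
      using step T_orth_V_inf[OF that] by simp
    also have "\<dots> \<le> q * (q ^ N * energy x)" using Suc q by (intro mult_left_mono) auto
    finally show ?case by (simp add: mult.assoc)
  qed (simp add: T_zero)
  \<comment> \<open>Half of -ln q, since q contracts the energy, i.e. the square of the norm. The
    factor exp \<omega> in the final bound pays for the fractional part of t.\<close>
  define \<omega> where "\<omega> = - ln q / 2"
  have \<omega>: "\<omega> > 0" using q by (simp add: \<omega>_def)
  have sq: "sqrt q = exp (- \<omega>)"
  proof -
    have "sqrt q = sqrt (exp (ln q / 2) ^ 2)" using q by (simp add: exp_double[symmetric])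
    then show ?thesis by (simp add: \<omega>_def)
  qed
  have "decay_norm t \<le> exp \<omega> * exp (- \<omega> * t)" if t: "t \<ge> 0" for t
  proof -
    define N where "N = nat \<lfloor>t\<rfloor>"
    have N: "real N \<le> t" "t \<le> real N + 1" using t unfolding N_def by linarith+
    have "energy (T t x) \<le> q ^ N * energy x" if x: "x \<in> ?V" for x
    proof -
      have "T t x = T (t - real N) (T (real N) x)" using T_add[of "t - real N" "real N" x] N by simp
      then have "energy (T t x) \<le> energy (T (real N) x)" using energy_contraction N by simp
      then show ?thesis using pow[OF x] order_trans by blast
    qed
    then have "decay_norm t \<le> sqrt (q ^ N)"
      using t q by (intro op_norm_le T_minus_Q_inf_le) auto
    also have "\<dots> = exp (- \<omega> * real N)" by (simp add: real_sqrt_power sq exp_of_nat_mult[symmetric] mult.commute)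
    also have "\<dots> \<le> exp (\<omega> + - \<omega> * t)"
    proof -
      have "\<omega> * t \<le> \<omega> * (real N + 1)" using N \<omega> by (intro mult_left_mono) auto
      then show ?thesis by (simp add: algebra_simps)
    qed
    finally show ?thesis by (simp only: exp_add)
  qed
  then show ?thesis using \<omega> by (intro exI[of _ "exp \<omega>"] conjI exI[of _ \<omega>]) auto
qed

subsection \<open>The Lyapunov operator\<close>

abbreviation Pc :: "int \<Rightarrow> complex^'n \<Rightarrow> complex^'n" where "Pc \<equiv> P_coeff P1 R H k"

lemma Pc_nonzero:
  "m \<noteq> 0 \<Longrightarrow> Pc m v = (\<Sum>j\<le>k. (1 / of_int m ^ (2 * j)) *\<^sub>R ((B (- m) ^^ j) ((B m ^^ j) v)))"
  by (simp add: P_coeff_def Cm_B adjoint_B)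

lemma Pc_zero: "Pc 0 v = v"
  by (simp add: P_coeff_def)

lemma B_scale: "B m (c *s v) = c *s B m v"
  by (simp add: B_def S_scale C_scale vec_eq_iff algebra_simps)

lemma B_funpow_scale: "(B m ^^ j) (c *s v) = c *s (B m ^^ j) v"
  by (induction j) (simp_all add: B_scale)

lemma linear_Pc: "linear (Pc m)"
proof (cases "m = 0")
  case False
  have "linear (\<lambda>v. \<Sum>j\<le>k. (1 / of_int m ^ (2 * j)) *\<^sub>R ((B (- m) ^^ j) ((B m ^^ j) v)))"
    by (intro linear_compose_sum ballI linear_compose_scale_right
        linear_compose[OF linear_funpow[OF linear_B] linear_funpow[OF linear_B], unfolded o_def])
  then show ?thesis using Pc_nonzero[OF False] by presburger
qed (simp add: Pc_zero[abs_def] linear_iff)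

lemma Pc_scale: "Pc m (c *s v) = c *s Pc m v"
proof (cases "m = 0")
  case False
  have "r *\<^sub>R (c *s w) = c *s (r *\<^sub>R w)" for r and w :: "complex^'n" by (simp add: vec_eq_iff)
  moreover have "(\<Sum>j\<in>J. c *s f j) = c *s (\<Sum>j\<in>J. f j)" for J :: "nat set" and f :: "nat \<Rightarrow> complex^'n"
    by (simp add: vec_eq_iff sum_distrib_left)
  ultimately show ?thesis using False by (simp add: Pc_nonzero B_funpow_scale)
qed (simp add: Pc_zero)

lemma hdot_Pc_term: "hdot H v ((B (- m) ^^ j) ((B m ^^ j) w)) = hdot H ((B m ^^ j) v) ((B m ^^ j) w)"
  by (simp add: hdot_B_funpow)

lemma hdot_Pc_term': "hdot H ((B (- m) ^^ j) ((B m ^^ j) v)) w = hdot H ((B m ^^ j) v) ((B m ^^ j) w)"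
  by (simp add: hdot_B_funpow)

lemma hdot_Pc: "hdot H (Pc m v) w = hdot H v (Pc m w)"
  by (cases "m = 0")
    (simp_all add: Pc_zero Pc_nonzero hd.sum_left hd.sum_right hd.scaleR_left hd.scaleR_right hdot_Pc_term hdot_Pc_term')

text \<open>The summand j = 0 is the identity, and the others contribute positive multiples of h(u,
  u) with u = C_m^j v.\<close>

lemma Pc_ge: "h v v \<le> h (Pc m v) v"
proof (cases "m = 0")
  case False
  have h0: "0 \<le> h u u" for u
  proof -
    obtain \<alpha> \<beta> where "\<alpha> > 0" "\<And>v. \<alpha> * (norm v)\<^sup>2 \<le> h v v" using h_bounds by metis
    then show ?thesis by (meson less_imp_le mult_nonneg_nonneg order_trans zero_le_power2)
  qed
  have "h (Pc m v) v = (\<Sum>j\<le>k. 1 / of_int m ^ (2 * j) * h ((B m ^^ j) v) ((B m ^^ j) v))"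
    using False by (simp add: h_def Pc_nonzero hd.sum_left hd.scaleR_left hdot_Pc_term')
  moreover have "1 / of_int m ^ (2 * 0) * h ((B m ^^ 0) v) ((B m ^^ 0) v) \<le> \<dots>"
    by (rule member_le_sum) (auto intro!: divide_nonneg_nonneg h0 simp: power_mult)
  ultimately show ?thesis by simp
qed (simp add: Pc_zero)

text \<open>C_m and its adjoint grow at most like |m|, so the weight m^(-2j) absorbs the growth of
  the 2j factors.\<close>

lemma Pc_bounded: obtains K where "K > 0" "\<And>m v. norm (Pc m v) \<le> K * norm v"
proof -
  obtain Kc where Kc: "\<And>v. norm (C v) \<le> Kc * norm v" "Kc > 0" using linear_bounded_pos[OF linear_C] by blast
  obtain Ks where Ks: "\<And>v. norm (S v) \<le> Ks * norm v" "Ks > 0" using linear_bounded_pos[OF linear_S] by blast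
  define Kb where "Kb = Ks + Kc"
  have Kb: "Kb > 0" using Ks Kc by (simp add: Kb_def)
  have B: "norm (B m v) \<le> (real_of_int \<bar>m\<bar> * Kb) * norm v" if "m \<noteq> 0" for m v
  proof -
    have m: "real_of_int \<bar>m\<bar> \<ge> 1" using that by linarith
    have "norm (B m v) \<le> real_of_int \<bar>m\<bar> * norm (S v) + norm (C v)"
      unfolding B_def by (rule order_trans[OF norm_triangle_ineq]) simp
    also have "\<dots> \<le> real_of_int \<bar>m\<bar> * (Ks * norm v) + real_of_int \<bar>m\<bar> * (Kc * norm v)"
    proof (intro add_mono mult_left_mono Ks)
      have "norm (C v) \<le> 1 * (Kc * norm v)" using Kc by simp
      also have "\<dots> \<le> real_of_int \<bar>m\<bar> * (Kc * norm v)" using m Kc by (intro mult_right_mono) auto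
      finally show "norm (C v) \<le> real_of_int \<bar>m\<bar> * (Kc * norm v)" .
    qed auto
    finally show ?thesis by (simp add: Kb_def algebra_simps)
  qed
  define K where "K = 1 + (\<Sum>j\<le>k. Kb ^ (2 * j))"
  have s0: "(\<Sum>j\<le>k. Kb ^ (2 * j)) \<ge> 0" using Kb by (intro sum_nonneg) auto
  show ?thesis
  proof (rule that)
    show "K > 0" using s0 by (simp add: K_def)
    fix m v
    show "norm (Pc m v) \<le> K * norm v"
    proof (cases "m = 0")
      case False
      define \<mu> where "\<mu> = real_of_int \<bar>m\<bar>"
      have \<mu>: "\<mu> > 0" using False by (simp add: \<mu>_def)
      have m2: "real_of_int m ^ (2 * j) = \<mu> ^ (2 * j)" for j by (simp add: \<mu>_def power_mult)
      have "norm (Pc m v) \<le> (\<Sum>j\<le>k. Kb ^ (2 * j) * norm v)"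
        unfolding Pc_nonzero[OF False]
      proof (rule sum_norm_le)
        fix j
        have "norm ((B (- m) ^^ j) ((B m ^^ j) v)) \<le> (\<mu> * Kb) ^ j * norm ((B m ^^ j) v)"
          by (rule norm_funpow_le) (use B[of "- m"] False \<mu> Kb in \<open>auto simp: \<mu>_def\<close>)
        also have "\<dots> \<le> (\<mu> * Kb) ^ j * ((\<mu> * Kb) ^ j * norm v)"
          by (intro mult_left_mono norm_funpow_le) (use B[of m] False \<mu> Kb in \<open>auto simp: \<mu>_def\<close>)
        also have "\<dots> = \<mu> ^ (2 * j) * (Kb ^ (2 * j) * norm v)"
          by (simp add: power_mult_distrib mult_2 power_add)
        finally show "norm ((1 / of_int m ^ (2 * j)) *\<^sub>R ((B (- m) ^^ j) ((B m ^^ j) v))) \<le> Kb ^ (2 * j) * norm v"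
          unfolding m2 norm_scaleR using \<mu> by (simp add: field_simps)
      qed
      also have "\<dots> \<le> K * norm v"
        by (simp add: K_def sum_distrib_right[symmetric] mult_right_mono)
      finally show ?thesis .
    next
      case True
      then show ?thesis using mult_right_mono[of 1 K "norm v"] s0 by (simp add: Pc_zero K_def)
    qed
  qed
qed

abbreviation P :: "'n l2 \<Rightarrow> 'n l2" where "P \<equiv> op_P P1 R H k"

text \<open>Uniformly bounded multipliers preserve square summability, so
  \<open>fourier_synthesis\<close> yields the element that \<open>op_P\<close> describes. Everything
  about P then reduces to the maps \<open>Pc m\<close>.\<close>

lemma fcoeff_P: "fcoeff (P x) m = Pc m (fcoeff x m)"
proof -
  obtain K where K: "K > 0" "\<And>m v. norm (Pc m v) \<le> K * norm v" using Pc_bounded by blast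
  have "(\<Sum>m\<in>F. (norm (Pc m (fcoeff x m)))\<^sup>2) \<le> K\<^sup>2 * ((norm x)\<^sup>2 / (2 * pi))" if "finite F" for F
  proof -
    have "(\<Sum>m\<in>F. (norm (Pc m (fcoeff x m)))\<^sup>2) \<le> (\<Sum>m\<in>F. K\<^sup>2 * (norm (fcoeff x m))\<^sup>2)"
    proof (rule sum_mono)
      fix m
      show "(norm (Pc m (fcoeff x m)))\<^sup>2 \<le> K\<^sup>2 * (norm (fcoeff x m))\<^sup>2"
        using power_mono[OF K(2) norm_ge_zero, of m "fcoeff x m" 2] by (simp add: power_mult_distrib)
    qed
    also have "\<dots> = K\<^sup>2 * (\<Sum>m\<in>F. (norm (fcoeff x m))\<^sup>2)" by (simp add: sum_distrib_left)
    also have "\<dots> \<le> K\<^sup>2 * ((norm x)\<^sup>2 / (2 * pi))"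
      using bessel[OF that, of x] by (intro mult_left_mono) (simp_all add: field_simps)
    finally show ?thesis .
  qed
  from fourier_synthesis[OF this] obtain y where y: "\<And>m. fcoeff y m = Pc m (fcoeff x m)" by blast
  have "P x = y"
    unfolding op_P_def has_fourier_expansion_iff[OF H]
  proof (rule the_equality)
    show "\<exists>z. (\<forall>m. fcoeff x m = z m) \<and> (\<forall>m. fcoeff y m = Pc m (z m))" using y by (intro exI[of _ "fcoeff x"]) simp
    fix y' assume "\<exists>z. (\<forall>m. fcoeff x m = z m) \<and> (\<forall>m. fcoeff y' m = Pc m (z m))"
    then show "y' = y" by (intro fcoeff_inject) (auto simp: y)
  qed
  then show ?thesis using y by simp
qed

lemma P_self_adjoint: "self_adjoint_wrt (l2_inner H) P"
  unfolding self_adjoint_wrt_def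
proof (intro allI)
  fix x y
  show "l2_inner H (P x) y = l2_inner H x (P y)"
    using parseval[of H "P x" y] parseval[of H x "P y"] by (simp add: fcoeff_P hdot_Pc has_sum_unique)
qed

lemma P_ge: "op_ge (l2_inner H) P (\<lambda>x. x)"
  unfolding op_ge_def
proof
  fix x
  have "((\<lambda>m. 2 * pi * h (Pc m (fcoeff x m)) (fcoeff x m)) has_sum Re (l2_inner H (P x) x)) UNIV"
    using has_sum_Re[OF parseval[of H "P x" x]] by (simp add: h_def fcoeff_P)
  from has_sum_mono[OF energy_has_sum this] show "Re (l2_inner H x x) \<le> Re (l2_inner H (P x) x)"
    by (simp add: Pc_ge energy_def)
qed

lemma P_bounded: "bounded_operator scaleC_l2 (l2_inner H) P"
  unfolding bounded_operator_def
proof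
  show "Vector_Spaces.linear scaleC_l2 scaleC_l2 P"
    unfolding Vector_Spaces.linear_iff
    by (intro conjI allI vector_space_scaleC_l2 fcoeff_inject)
      (simp_all add: fcoeff_P fcoeff_add fcoeff_scaleC Pc_scale linear_add[OF linear_Pc])
  obtain K where K: "K > 0" "\<And>m v. norm (Pc m v) \<le> K * norm v" using Pc_bounded by blast
  obtain \<alpha> \<beta> where ab: "\<alpha> > 0" "\<beta> > 0" "\<And>v. \<alpha> * (norm v)\<^sup>2 \<le> h v v" "\<And>v. h v v \<le> \<beta> * (norm v)\<^sup>2"
    using h_bounds by metis
  define L where "L = \<beta> * K\<^sup>2 / \<alpha>"
  have L: "L \<ge> 0" using ab by (simp add: L_def)
  have le: "h (Pc m v) (Pc m v) \<le> L * h v v" for m v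
  proof -
    have "h (Pc m v) (Pc m v) \<le> \<beta> * (K * norm v)\<^sup>2"
      by (rule order_trans[OF ab(4)]) (use ab K in \<open>intro mult_left_mono power_mono, auto\<close>)
    also have "\<dots> = L * (\<alpha> * (norm v)\<^sup>2)" using ab by (simp add: L_def power_mult_distrib)
    also have "\<dots> \<le> L * h v v" using L by (intro mult_left_mono ab)
    finally show ?thesis .
  qed
  have "energy (P x) \<le> L * energy x" for x
  proof (rule has_sum_mono[OF energy_has_sum has_sum_cmult_right[OF energy_has_sum]])
    fix m
    show "2 * pi * h (fcoeff (P x) m) (fcoeff (P x) m) \<le> L * (2 * pi * h (fcoeff x m) (fcoeff x m))"
      using mult_left_mono[OF le[of m "fcoeff x m"], of "2 * pi"] by (simp add: fcoeff_P mult_ac)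
  qed
  then have "ip_norm (l2_inner H) (P x) \<le> sqrt L * ip_norm (l2_inner H) x" for x
    unfolding ip_norm_energy real_sqrt_mult[symmetric] by (rule real_sqrt_le_mono)
  then show "\<exists>K. \<forall>x. ip_norm (l2_inner H) (P x) \<le> K * ip_norm (l2_inner H) x" by blast
qed

text \<open>For m \<noteq> 0 the lower bound is \<open>weighted_form_coercive\<close>. For m = 0 the
  multiplier is the identity, and orthogonality to the stationary states enters through
  \<open>coercive_on_complement\<close>.\<close>

lemma P_dissipative:
  "\<exists>\<sigma>>0. \<forall>x \<in> domain_A \<inter> orth_complement (l2_inner H) (V_inf R H).
     Re (l2_inner H (op_A P1 R H x) (P x) + l2_inner H (P x) (op_A P1 R H x)) \<le> - \<sigma> * (ip_norm (l2_inner H) x)\<^sup>2"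
proof -
  obtain \<alpha> \<beta> c \<kappa> where "hypocoercive_pair h S C k \<alpha> \<beta> c \<kappa>" using hypocoercive_pair_S_C by blast
  then interpret p: hypocoercive_pair h S C k \<alpha> \<beta> c \<kappa> .
  obtain g1 where g1: "g1 > 0" "\<And>m x. m \<noteq> 0 \<Longrightarrow> g1 * (norm x)\<^sup>2 \<le> (\<Sum>j\<le>k. 1 / of_int m ^ (2 * j) *
       h (C ((B m ^^ j) x)) ((B m ^^ j) x))"
    using p.weighted_form_coercive unfolding B_def[abs_def] by blast
  obtain g2 where g2: "g2 > 0" "\<And>x. (\<forall>v. C v = 0 \<longrightarrow> h v x = 0) \<Longrightarrow> g2 * (norm x)\<^sup>2 \<le> h (C x) x"
    using p.coercive_on_complement by blast
  define g where "g = min g1 g2"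
  have g: "g > 0" using g1 g2 by (simp add: g_def)
  \<comment> \<open>The 2 stems from the two conjugate summands, \<beta> from passing from |z|^2 to
    the energy h(z, z).\<close>
  define \<sigma> where "\<sigma> = 2 * g / \<beta>"
  have h_B: "h (B m v) v = h (C v) v" for m v
    by (simp add: B_def p.h.add_left p.h.scaleR_left h_S)
  have main: "h (- B m z) (Pc m z) \<le> - (g / \<beta>) * h z z"
    if z: "m = 0 \<Longrightarrow> (\<And>v. C v = 0 \<Longrightarrow> h v z = 0)" for m z
  proof -
    have "g * (norm z)\<^sup>2 \<le> h (B m z) (Pc m z)"
    proof (cases "m = 0")
      case True
      have "g * (norm z)\<^sup>2 \<le> g2 * (norm z)\<^sup>2" by (intro mult_right_mono) (auto simp: g_def)
      also have "\<dots> \<le> h (C z) z" using z True by (intro g2) auto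
      finally show ?thesis by (simp add: True Pc_zero h_B)
    next
      case False
      have "g * (norm z)\<^sup>2 \<le> g1 * (norm z)\<^sup>2" by (intro mult_right_mono) (auto simp: g_def)
      also have "\<dots> \<le> (\<Sum>j\<le>k. 1 / of_int m ^ (2 * j) * h (C ((B m ^^ j) z)) ((B m ^^ j) z))" by (rule g1(2)[OF False])
      \<comment> \<open>The adjoint powers move to the left factor, where they become powers of C_m
        and commute with it; the skew part then drops out of h(C_m w, w).\<close>
      also have "\<dots> = h (B m z) (Pc m z)"
        using False by (simp add: h_def Pc_nonzero hd.sum_right hd.scaleR_right hdot_Pc_term)
          (simp add: h_def[symmetric] funpow_swap1[symmetric] h_B)
      finally show ?thesis .
    qed
    moreover have "g / \<beta> * h z z \<le> g * (norm z)\<^sup>2"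
      using mult_left_mono[OF p.upper[of z], of "g / \<beta>"] g p.\<beta> by simp
    ultimately show ?thesis by (simp add: p.h.minus_left)
  qed
  show ?thesis
  proof (intro exI[of _ \<sigma>] conjI ballI)
    show "\<sigma> > 0" using g p.\<beta> by (simp add: \<sigma>_def)
    fix x assume x: "x \<in> domain_A \<inter> orth_complement (l2_inner H) (V_inf R H)"
    let ?A = "op_A P1 R H x"
    have coeffA: "fcoeff ?A m = - B m (fcoeff x m)" for m
      using fcoeff_op_A[of x m] x by (simp add: Cm_eq B_def)
    have "((\<lambda>m. 2 * pi * h (- B m (fcoeff x m)) (Pc m (fcoeff x m))) has_sum Re (l2_inner H ?A (P x))) UNIV"
      using has_sum_Re[OF parseval[of H ?A "P x"]] by (simp add: h_def fcoeff_P coeffA)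
    moreover have "((\<lambda>m. - (g / \<beta>) * (2 * pi * h (fcoeff x m) (fcoeff x m))) has_sum - (g / \<beta>) * energy x) UNIV"
      by (rule has_sum_cmult_right[OF energy_has_sum])
    ultimately have "Re (l2_inner H ?A (P x)) \<le> - (g / \<beta>) * energy x"
    proof (rule has_sum_mono)
      fix m
      have "h (- B m (fcoeff x m)) (Pc m (fcoeff x m)) \<le> - (g / \<beta>) * h (fcoeff x m) (fcoeff x m)"
        by (rule main) (use x in \<open>simp add: orth_V_inf_iff h_def\<close>)
      from mult_left_mono[OF this, of "2 * pi"]
      show "2 * pi * h (- B m (fcoeff x m)) (Pc m (fcoeff x m)) \<le> - (g / \<beta>) * (2 * pi * h (fcoeff x m) (fcoeff x m))"
        by (simp add: mult_ac)
    qed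
    moreover have "Re (l2_inner H (P x) ?A) = Re (l2_inner H ?A (P x))"
      using arg_cong[OF l2_inner_commute[OF H_hermitian, of ?A "P x"], of Re] by simp
    moreover have "(ip_norm (l2_inner H) x)\<^sup>2 = energy x"
      using energy_nonneg[of x] by (simp add: ip_norm_energy)
    ultimately show "Re (l2_inner H ?A (P x) + l2_inner H (P x) ?A) \<le> - \<sigma> * (ip_norm (l2_inner H) x)\<^sup>2"
      by (simp add: \<sigma>_def)
  qed
qed

end

theorem proposition2:
  fixes P1 R H :: "complex^'n^'n"
    and T :: "real \<Rightarrow> 'n l2 \<Rightarrow> 'n l2"
    and m_HC :: nat
  assumes "hermitian P1" and "invertible P1"
    and "pos_semidef R"
    and "pos_def H"
    and "hypocoercive (*s) (hdot H) ((*v) (C_mat P1 R H))"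
    and "m_HC = hypocoercivity_index (hdot H) ((*v) (C_mat P1 R H))"
    and "generates_c0_semigroup scaleC_l2 (l2_inner H) domain_A (op_A P1 R H) T"
  shows
    "(\<exists>\<tau>>0. \<exists>c1>0. \<exists>c2>0. \<forall>t. 0 \<le> t \<and> t \<le> \<tau> \<longrightarrow>
        1 - c1 * t ^ (2 * m_HC + 1) \<le> (op_norm (l2_inner H) (\<lambda>x. T t x - Q_inf R H x))\<^sup>2 \<and>
        (op_norm (l2_inner H) (\<lambda>x. T t x - Q_inf R H x))\<^sup>2 \<le> 1 - c2 * t ^ (2 * m_HC + 1))
     \<and>
     ((\<forall>t\<ge>0. T t ` V_inf R H \<subseteq> V_inf R H \<and>
        T t ` orth_complement (l2_inner H) (V_inf R H)
          \<subseteq> orth_complement (l2_inner H) (V_inf R H)) \<and>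
      (\<exists>C>0. \<exists>\<omega>>0. \<forall>t\<ge>0.
        op_norm (l2_inner H) (\<lambda>x. T t x - Q_inf R H x) \<le> C * exp (- \<omega> * t)))
     \<and>
     (bounded_operator scaleC_l2 (l2_inner H) (op_P P1 R H m_HC) \<and>
      self_adjoint_wrt (l2_inner H) (op_P P1 R H m_HC) \<and>
      op_ge (l2_inner H) (op_P P1 R H m_HC) (\<lambda>x. x) \<and>
      (\<exists>\<sigma>>0. \<forall>x \<in> domain_A \<inter> orth_complement (l2_inner H) (V_inf R H).
        Re (l2_inner H (op_A P1 R H x) (op_P P1 R H m_HC x)
            + l2_inner H (op_P P1 R H m_HC x) (op_A P1 R H x))
          \<le> - \<sigma> * (ip_norm (l2_inner H) x)\<^sup>2))"
proof -
  interpret hypocoercive_port_hamiltonian P1 R H T m_HC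
    by unfold_locales (fact assms)+
  have "T t ` V_inf R H \<subseteq> V_inf R H \<and>
      T t ` orth_complement (l2_inner H) (V_inf R H) \<subseteq> orth_complement (l2_inner H) (V_inf R H)"
    if "t \<ge> 0" for t
    using T_V_inf[OF _ that] T_orth_V_inf[OF _ that] by (auto simp: image_subset_iff)
  then show ?thesis
    by (intro conjI allI impI short_time_asymptotics exponential_decay P_bounded P_self_adjoint P_ge P_dissipative) blast+
qed

end
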